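(* Let $A$ be an $R$-algebra, $\omega\in\mathrm{DR}^2_RA$ a bi-symplectic 2-form, $\mathbf w\in A$ a representative of the class $\mu_{\mathrm{nc}}(\omega)\in A/R$, and $A_{\mathbf w}:=A/A\mathbf wA$. Then: (i) For any $p\in A_\natural$ the derivation $\theta_p$ preserves the ideal $A\mathbf wA$, hence induces a well-defined derivation $\bar\theta_p:A_{\mathbf w}\to A_{\mathbf w}$. (ii) The Lie bracket on $A_\natural$ descends to a well-defined Lie bracket on $(A_{\mathbf w})_\natural$. (iii) There is a Lie algebra map $\bar\varphi:(A_{\mathbf w})_\natural\to \mathrm{Der}_R(A_{\mathbf w})/\mathrm{Inn}_R(A_{\mathbf w})$ such that, for every $p\in A_\natural$ with image $\pi(p)$ under the projection $\pi:A_\natural\to(A_{\mathbf w})_\natural$, the element $\bar\varphi(\pi(p))$ is the class of $\bar\theta_p$.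
   Context: $\Bbbk$ is a field of characteristic $0$, $\otimes=\otimes_\Bbbk$, and $R$ is a finite dimensional semisimple $\Bbbk$-algebra with a fixed symmetric separability element $\mathbf e=\mathbf e'\otimes\mathbf e''=\sum_i e_i\otimes e^i\in R\otimes R$ (that is, $r\mathbf e=\mathbf e r$ for $r\in R$, $\sum_i e_ie^i=1$, and $\mathbf e$ is flip-invariant). An $R$-algebra is a unital associative $\Bbbk$-algebra $A$ with a unit preserving embedding $R\hookrightarrow A$ (for the quotient $A_{\mathbf w}$ the map from $R$ need not be injective; then $A_{\mathbf w}/R$ means the quotient by the image of $R$). For an $A$-bimodule $M$, $M_\natural:=M/[A,M]$; in particular $A_\natural=A/[A,A]$. Forms: $\Omega^1_RA=\ker(A\otimes_RA\to A)$, $da=a\otimes1-1\otimes a$; $\Omega^\bullet_RA=T_A^\bullet(\Omega^1_RA)$ with its DG algebra structure; $\mathrm{DR}^\bullet_RA=\Omega^\bullet_RA/[\Omega^\bullet_RA,\Omega^\bullet_RA]_{\mathrm{super}}$ with induced differential $d$; so $\mathrm{DR}^0_RA=A_\natural$, $\mathrm{DR}^1_RA=(\Omega^1_RA)_\natural$. $\mathrm{Der}_RA$ is the Lie algebra of derivations $A\to A$ vanishing on $R$, and $\mathrm{Inn}_RA$ its ideal of inner derivations. Double derivations: $\mathbb{D}\mathrm{er}_RA$ is the space of derivations $\Theta:A\to A\otimes A$, $\Theta(a)=\Theta'(a)\otimes\Theta''(a)$, with $\Theta(R)=0$, for the outer bimodule structure $b(a'\otimes a'')c=ba'\otimes a''c$.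 It is an $A$-bimodule via the inner structure $b(a'\otimes a'')c=a'c\otimes ba''$. Let $i_\Theta:\Omega^\bullet_RA\to\Omega^\bullet_RA\otimes\Omega^\bullet_RA$ (outer bimodule) be the degree $-1$ super-derivation with $i_\Theta(u\,dv)=u\Theta(v)$ and $\iota_\Theta\alpha=(i_\Theta\alpha)^\diamond$, with $(\alpha\otimes\beta)^\diamond=(-1)^{kl}\beta\alpha$ for $\alpha\in\Omega^k,\beta\in\Omega^l$; it descends to $\iota_\Theta:\mathrm{DR}^n_RA\to\Omega^{n-1}_RA$. A form $\omega\in\mathrm{DR}^2_RA$ is bi-symplectic if $d\omega=0$ and $\iota(\omega):\mathbb{D}\mathrm{er}_RA\to\Omega^1_RA$, $\Theta\mapsto\iota_\Theta\omega$, is a bijection. Then $\mathsf H_\omega:\mathrm{DR}^1_RA\to\mathrm{Der}_RA$ is the composite of the inverse of the induced bijection $\iota(\omega)_\natural:(\mathbb{D}\mathrm{er}_RA)_\natural\to\mathrm{DR}^1_RA$ with the map $(\mathbb{D}\mathrm{er}_RA)_\natural\to\mathrm{Der}_RA$ induced by $\Theta\mapsto(a\mapsto\Theta'(a)\Theta''(a))$. For $p\in A_\natural$ put $\theta_p:=\mathsf H_\omega(dp)$. The Lie bracket on $A_\natural$ is $\{p,q\}:=\theta_p(q)\bmod[A,A]$. Put $\Delta\in\mathbb{D}\mathrm{er}_RA$, $\Delta(a)=a\mathbf e'\otimes\mathbf e''-\mathbf e'\otimes\mathbf e''a$. For closed $\omega\in\mathrm{DR}^2_RA$, $\mu_{\mathrm{nc}}(\omega)\in(A/R)^R$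 (centralizer of $R$ in $A/R$) is the unique class with $d\mu_{\mathrm{nc}}(\omega)=\iota_\Delta\omega$ in $\Omega^1_RA$. *)

theory Defs
  imports "HOL-Algebra.Module" "HOL-Algebra.QuotRing" "HOL-Algebra.Generated_Groups"
    "HOL-Algebra.Free_Abelian_Groups"
begin

section \<open>Algebras over a field\<close>

definition char_zero :: "('k, 'z) ring_scheme \<Rightarrow> bool" where
  "char_zero K \<longleftrightarrow> (\<forall>n::nat. 0 < n \<longrightarrow> [n] \<cdot>\<^bsub>K\<^esub> \<one>\<^bsub>K\<^esub> \<noteq> \<zero>\<^bsub>K\<^esub>)"

text \<open>The locale \<open>algebra\<close> of the library is restricted to commutative algebras.\<close>

locale assoc_algebra = module K A + ring A for K and A (structure) +
  assumes smult_mult_left: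
      "\<lbrakk>c \<in> carrier K; x \<in> carrier A; y \<in> carrier A\<rbrakk> \<Longrightarrow> (c \<odot>\<^bsub>A\<^esub> x) \<otimes>\<^bsub>A\<^esub> y = c \<odot>\<^bsub>A\<^esub> (x \<otimes>\<^bsub>A\<^esub> y)"
    and smult_mult_right:
      "\<lbrakk>c \<in> carrier K; x \<in> carrier A; y \<in> carrier A\<rbrakk> \<Longrightarrow> x \<otimes>\<^bsub>A\<^esub> (c \<odot>\<^bsub>A\<^esub> y) = c \<odot>\<^bsub>A\<^esub> (x \<otimes>\<^bsub>A\<^esub> y)"

definition finite_dim :: "('k, 'z) ring_scheme \<Rightarrow> ('k, 'm, 'y) module_scheme \<Rightarrow> bool" where
  "finite_dim K M \<longleftrightarrow> (\<exists>B. finite B \<and> B \<subseteq> carrier M \<and>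
     (\<forall>x\<in>carrier M. \<exists>c\<in>B \<rightarrow> carrier K. x = (\<Oplus>\<^bsub>M\<^esub>b\<in>B. c b \<odot>\<^bsub>M\<^esub> b)))"

definition left_ideal :: "'a set \<Rightarrow> ('a, 'z) ring_scheme \<Rightarrow> bool" where
  "left_ideal J A \<longleftrightarrow> subgroup J (add_monoid A) \<and> (\<forall>a\<in>carrier A. \<forall>x\<in>J. a \<otimes>\<^bsub>A\<^esub> x \<in> J)"

definition semisimple :: "('a, 'z) ring_scheme \<Rightarrow> bool" where
  "semisimple A \<longleftrightarrow> (\<forall>I. left_ideal I A \<longrightarrow>
     (\<exists>J. left_ideal J A \<and> I \<inter> J = {\<zero>\<^bsub>A\<^esub>} \<and> I <+>\<^bsub>A\<^esub> J = carrier A))"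

text \<open>\<open>quot_module M N\<close> is the quotient of \<open>M\<close> by the submodule \<open>N\<close>. When \<open>M\<close> is an algebra and
  \<open>N\<close> a two-sided ideal it is the quotient algebra; otherwise its multiplication has no meaning.\<close>

definition quot_module :: "('k, 'm, 'z) module_scheme \<Rightarrow> 'm set \<Rightarrow> ('k, 'm set) module" where
  "quot_module M N = ring.extend (M Quot N)
     (module.fields (\<lambda>c X. \<Union>x\<in>X. N +>\<^bsub>M\<^esub> (c \<odot>\<^bsub>M\<^esub> x)))"


section \<open>Lie algebras\<close>

record ('k, 'l) lie = "('k, 'l) module" +
  bracket :: "'l \<Rightarrow> 'l \<Rightarrow> 'l"

locale lie_algebra = field K + module K L for K and L (structure) +
  assumes bracket_closed:
      "\<lbrakk>x \<in> carrier L; y \<in> carrier L\<rbrakk> \<Longrightarrow> bracket L x y \<in> carrier L"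
    and bracket_add_left:
      "\<lbrakk>x \<in> carrier L; y \<in> carrier L; z \<in> carrier L\<rbrakk> \<Longrightarrow>
        bracket L (x \<oplus>\<^bsub>L\<^esub> y) z = bracket L x z \<oplus>\<^bsub>L\<^esub> bracket L y z"
    and bracket_add_right:
      "\<lbrakk>x \<in> carrier L; y \<in> carrier L; z \<in> carrier L\<rbrakk> \<Longrightarrow>
        bracket L x (y \<oplus>\<^bsub>L\<^esub> z) = bracket L x y \<oplus>\<^bsub>L\<^esub> bracket L x z"
    and bracket_smult_left:
      "\<lbrakk>c \<in> carrier K; x \<in> carrier L; y \<in> carrier L\<rbrakk> \<Longrightarrow>
        bracket L (c \<odot>\<^bsub>L\<^esub> x) y = c \<odot>\<^bsub>L\<^esub> bracket L x y"
    and bracket_smult_right: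
      "\<lbrakk>c \<in> carrier K; x \<in> carrier L; y \<in> carrier L\<rbrakk> \<Longrightarrow>
        bracket L x (c \<odot>\<^bsub>L\<^esub> y) = c \<odot>\<^bsub>L\<^esub> bracket L x y"
    and bracket_self:
      "x \<in> carrier L \<Longrightarrow> bracket L x x = \<zero>\<^bsub>L\<^esub>"
    and jacobi:
      "\<lbrakk>x \<in> carrier L; y \<in> carrier L; z \<in> carrier L\<rbrakk> \<Longrightarrow>
        bracket L x (bracket L y z) \<oplus>\<^bsub>L\<^esub> bracket L y (bracket L z x)
          \<oplus>\<^bsub>L\<^esub> bracket L z (bracket L x y) = \<zero>\<^bsub>L\<^esub>"

definition with_bracket :: "('k, 'l) module \<Rightarrow> ('l \<Rightarrow> 'l \<Rightarrow> 'l) \<Rightarrow> ('k, 'l) lie" where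
  "with_bracket M br = module.extend M (lie.fields br)"

text \<open>The quotient of a Lie algebra by a Lie ideal.\<close>

definition quot_lie :: "('k, 'l) lie \<Rightarrow> 'l set \<Rightarrow> ('k, 'l set) lie" where
  "quot_lie L N = with_bracket (quot_module L N)
     (\<lambda>X Y. \<Union>x\<in>X. \<Union>y\<in>Y. N +>\<^bsub>L\<^esub> bracket L x y)"

definition lie_hom :: "('k, 'z) ring_scheme \<Rightarrow> ('k, 'l) lie \<Rightarrow> ('k, 'm) lie \<Rightarrow> ('l \<Rightarrow> 'm) set" where
  "lie_hom K L M = {f \<in> carrier L \<rightarrow> carrier M.
     (\<forall>x\<in>carrier L. \<forall>y\<in>carrier L. f (x \<oplus>\<^bsub>L\<^esub> y) = f x \<oplus>\<^bsub>M\<^esub> f y) \<and>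
     (\<forall>c\<in>carrier K. \<forall>x\<in>carrier L. f (c \<odot>\<^bsub>L\<^esub> x) = c \<odot>\<^bsub>M\<^esub> f x) \<and>
     (\<forall>x\<in>carrier L. \<forall>y\<in>carrier L. f (bracket L x y) = bracket M (f x) (f y))}"


section \<open>Additive maps, bimodules and tensor products\<close>

text \<open>\<open>the_add_hom M P \<Phi>\<close> is the unique additive map \<open>M \<rightarrow> P\<close> with property \<open>\<Phi>\<close>; below, \<open>\<Phi>\<close> always
  prescribes the values on a generating set.\<close>

definition the_add_hom ::
    "('m, 'y) ring_scheme \<Rightarrow> ('p, 'z) ring_scheme \<Rightarrow> (('m \<Rightarrow> 'p) \<Rightarrow> bool) \<Rightarrow> 'm \<Rightarrow> 'p" where
  "the_add_hom M P \<Phi> =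
     (THE h. h \<in> extensional (carrier M) \<and> h \<in> hom (add_monoid M) (add_monoid P) \<and> \<Phi> h)"

text \<open>An \<open>'s\<close>-\<open>'t\<close>-bimodule; as for \<open>module\<close>, the fields \<open>mult\<close> and \<open>one\<close> inherited from \<open>ring\<close> play
  no role.\<close>

record ('s, 'm, 't) bimodule = "'m ring" +
  lact :: "'s \<Rightarrow> 'm \<Rightarrow> 'm" (infixr \<open>\<triangleright>\<index>\<close> 70)
  ract :: "'m \<Rightarrow> 't \<Rightarrow> 'm" (infixl \<open>\<triangleleft>\<index>\<close> 70)

text \<open>The ring \<open>A\<close> as a bimodule, with scalars acting on the left through \<open>f\<close> and on the right
  through \<open>g\<close>.\<close>

definition self_bimodule ::
    "('a, 'z) ring_scheme \<Rightarrow> ('s \<Rightarrow> 'a) \<Rightarrow> ('t \<Rightarrow> 'a) \<Rightarrow> ('s, 'a, 't) bimodule" where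
  "self_bimodule A f g =
     \<lparr>carrier = carrier A, monoid.mult = monoid.mult A, one = \<one>\<^bsub>A\<^esub>, ring.zero = \<zero>\<^bsub>A\<^esub>, add = add A,
      lact = (\<lambda>s x. f s \<otimes>\<^bsub>A\<^esub> x), ract = (\<lambda>x t. x \<otimes>\<^bsub>A\<^esub> g t)\<rparr>"

text \<open>\<open>[A, M]\<close>, the additive span of all \<open>am - ma\<close>.\<close>

definition commutators :: "('a, 'z) ring_scheme \<Rightarrow> ('a, 'm, 'a) bimodule \<Rightarrow> 'm set" where
  "commutators A M = generate (add_monoid M)
     {(a \<triangleright>\<^bsub>M\<^esub> m) \<ominus>\<^bsub>M\<^esub> (m \<triangleleft>\<^bsub>M\<^esub> a) | a m. a \<in> carrier A \<and> m \<in> carrier M}"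

text \<open>The tensor product of a right \<open>S\<close>-module \<open>M\<close> and a left \<open>S\<close>-module \<open>N\<close> is the quotient of the
  free abelian group on \<open>M \<times> N\<close> by the usual relations. It keeps the outer actions, from the left
  on \<open>M\<close> and from the right on \<open>N\<close>.\<close>

type_synonym 'x frag = "'x \<Rightarrow>\<^sub>0 int"

definition tensor_rels ::
    "('s, 'z) ring_scheme \<Rightarrow> ('l, 'm, 's) bimodule \<Rightarrow> ('s, 'n, 't) bimodule \<Rightarrow> ('m \<times> 'n) frag set" where
  "tensor_rels S M N = generate (free_Abelian_group (carrier M \<times> carrier N))
     ({frag_of (x \<oplus>\<^bsub>M\<^esub> x', y) - frag_of (x, y) - frag_of (x', y) | x x' y.
         x \<in> carrier M \<and> x' \<in> carrier M \<and> y \<in> carrier N} \<union>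
      {frag_of (x, y \<oplus>\<^bsub>N\<^esub> y') - frag_of (x, y) - frag_of (x, y') | x y y'.
         x \<in> carrier M \<and> y \<in> carrier N \<and> y' \<in> carrier N} \<union>
      {frag_of (x \<triangleleft>\<^bsub>M\<^esub> s, y) - frag_of (x, s \<triangleright>\<^bsub>N\<^esub> y) | x s y.
         x \<in> carrier M \<and> s \<in> carrier S \<and> y \<in> carrier N})"

definition tens ::
    "('s, 'z) ring_scheme \<Rightarrow> ('l, 'm, 's) bimodule \<Rightarrow> ('s, 'n, 't) bimodule \<Rightarrow>
      'm \<Rightarrow> 'n \<Rightarrow> ('m \<times> 'n) frag set" where
  "tens S M N x y =
     tensor_rels S M N #>\<^bsub>free_Abelian_group (carrier M \<times> carrier N)\<^esub> frag_of (x, y)"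

definition tensor_group ::
    "('s, 'z) ring_scheme \<Rightarrow> ('l, 'm, 's) bimodule \<Rightarrow> ('s, 'n, 't) bimodule \<Rightarrow>
      ('m \<times> 'n) frag set ring" where
  "tensor_group S M N =
     (let Q = free_Abelian_group (carrier M \<times> carrier N) Mod tensor_rels S M N
      in \<lparr>carrier = carrier Q, monoid.mult = undefined, one = undefined,
          ring.zero = \<one>\<^bsub>Q\<^esub>, add = monoid.mult Q\<rparr>)"

definition tensor ::
    "('s, 'z) ring_scheme \<Rightarrow> ('l, 'm, 's) bimodule \<Rightarrow> ('s, 'n, 't) bimodule \<Rightarrow>
      ('l, ('m \<times> 'n) frag set, 't) bimodule" where
  "tensor S M N = ring.extend (tensor_group S M N) (bimodule.fields
     (\<lambda>l. the_add_hom (tensor_group S M N) (tensor_group S M N)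
        (\<lambda>h. \<forall>x\<in>carrier M. \<forall>y\<in>carrier N. h (tens S M N x y) = tens S M N (l \<triangleright>\<^bsub>M\<^esub> x) y))
     (\<lambda>u t. the_add_hom (tensor_group S M N) (tensor_group S M N)
        (\<lambda>h. \<forall>x\<in>carrier M. \<forall>y\<in>carrier N. h (tens S M N x y) = tens S M N x (y \<triangleleft>\<^bsub>N\<^esub> t)) u))"

text \<open>For a \<open>K\<close>-algebra \<open>A\<close>, the scalar \<open>c\<close> acts on \<open>A\<close> as multiplication by \<open>c \<odot> \<one>\<close>. Thus
  \<open>tensor2 K A\<close> is \<open>A \<otimes>\<^sub>K A\<close> with its outer \<open>A\<close>-bimodule structure and \<open>tns2\<close> forms its
  elementary tensors.\<close>

definition scal :: "('k, 'a, 'z) module_scheme \<Rightarrow> 'k \<Rightarrow> 'a" where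
  "scal A c = c \<odot>\<^bsub>A\<^esub> \<one>\<^bsub>A\<^esub>"

definition tensor2 :: "'k ring \<Rightarrow> ('k, 'a) module \<Rightarrow> ('a, ('a \<times> 'a) frag set, 'a) bimodule" where
  "tensor2 K A = tensor K (self_bimodule A (\<lambda>x. x) (scal A)) (self_bimodule A (scal A) (\<lambda>x. x))"

definition tns2 :: "'k ring \<Rightarrow> ('k, 'a) module \<Rightarrow> 'a \<Rightarrow> 'a \<Rightarrow> ('a \<times> 'a) frag set" where
  "tns2 K A = tens K (self_bimodule A (\<lambda>x. x) (scal A)) (self_bimodule A (scal A) (\<lambda>x. x))"

definition mult2 :: "'k ring \<Rightarrow> ('k, 'a) module \<Rightarrow> ('a \<times> 'a) frag set \<Rightarrow> 'a" where
  "mult2 K A = the_add_hom (tensor2 K A) A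
     (\<lambda>h. \<forall>x\<in>carrier A. \<forall>y\<in>carrier A. h (tns2 K A x y) = x \<otimes>\<^bsub>A\<^esub> y)"

definition flip2 :: "'k ring \<Rightarrow> ('k, 'a) module \<Rightarrow> ('a \<times> 'a) frag set \<Rightarrow> ('a \<times> 'a) frag set" where
  "flip2 K A = the_add_hom (tensor2 K A) (tensor2 K A)
     (\<lambda>h. \<forall>x\<in>carrier A. \<forall>y\<in>carrier A. h (tns2 K A x y) = tns2 K A y x)"

definition symmetric_separability_element ::
    "'k ring \<Rightarrow> ('k, 'r) module \<Rightarrow> ('r \<times> 'r) frag set \<Rightarrow> bool" where
  "symmetric_separability_element K R e \<longleftrightarrow>
     e \<in> carrier (tensor2 K R) \<and>
     (\<forall>r\<in>carrier R. r \<triangleright>\<^bsub>tensor2 K R\<^esub> e = e \<triangleleft>\<^bsub>tensor2 K R\<^esub> r) \<and>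
     mult2 K R e = \<one>\<^bsub>R\<^esub> \<and>
     flip2 K R e = e"


section \<open>Algebras over a base algebra\<close>

text \<open>The structure map \<open>\<eta> : R \<rightarrow> A\<close> is not required to be injective in \<open>algebra_over\<close>, so that
  quotients of \<open>R\<close>-algebras are covered; an \<open>R\<close>-algebra proper has an injective \<open>\<eta>\<close>.\<close>

definition algebra_over :: "'k ring \<Rightarrow> ('k, 'r) module \<Rightarrow> ('k, 'a) module \<Rightarrow> ('r \<Rightarrow> 'a) \<Rightarrow> bool" where
  "algebra_over K R A \<eta> \<longleftrightarrow> assoc_algebra K R \<and> assoc_algebra K A \<and> \<eta> \<in> ring_hom R A \<and>
     (\<forall>c\<in>carrier K. \<forall>r\<in>carrier R. \<eta> (c \<odot>\<^bsub>R\<^esub> r) = c \<odot>\<^bsub>A\<^esub> \<eta> r)"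

definition R_algebra :: "'k ring \<Rightarrow> ('k, 'r) module \<Rightarrow> ('k, 'a) module \<Rightarrow> ('r \<Rightarrow> 'a) \<Rightarrow> bool" where
  "R_algebra K R A \<eta> \<longleftrightarrow> algebra_over K R A \<eta> \<and> inj_on \<eta> (carrier R)"

locale algebra_over_data =
  fixes K :: "'k ring" and R :: "('k, 'r) module" and A :: "('k, 'a) module" and \<eta> :: "'r \<Rightarrow> 'a"
begin

text \<open>\<open>A\<^sub>\<natural> = DR\<^sup>0 = A/[A, A]\<close>.\<close>

definition A_comm :: "'a set" where
  "A_comm = commutators A (self_bimodule A (\<lambda>x. x) (\<lambda>x. x))"

definition A_nat :: "('k, 'a set) module" where
  "A_nat = quot_module A A_comm"


subsection \<open>Derivations\<close>

definition Der :: "('k, 'a \<Rightarrow> 'a) lie" where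
  "Der = \<lparr>
     carrier = {D \<in> extensional (carrier A).
       D \<in> hom (add_monoid A) (add_monoid A) \<and>
       (\<forall>c\<in>carrier K. \<forall>x\<in>carrier A. D (c \<odot>\<^bsub>A\<^esub> x) = c \<odot>\<^bsub>A\<^esub> D x) \<and>
       (\<forall>x\<in>carrier A. \<forall>y\<in>carrier A. D (x \<otimes>\<^bsub>A\<^esub> y) = (x \<otimes>\<^bsub>A\<^esub> D y) \<oplus>\<^bsub>A\<^esub> (D x \<otimes>\<^bsub>A\<^esub> y)) \<and>
       (\<forall>r\<in>carrier R. D (\<eta> r) = \<zero>\<^bsub>A\<^esub>)},
     monoid.mult = undefined, one = undefined,
     ring.zero = (\<lambda>x\<in>carrier A. \<zero>\<^bsub>A\<^esub>),
     add = (\<lambda>D E. \<lambda>x\<in>carrier A. D x \<oplus>\<^bsub>A\<^esub> E x),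
     smult = (\<lambda>c D. \<lambda>x\<in>carrier A. c \<odot>\<^bsub>A\<^esub> D x),
     bracket = (\<lambda>D E. \<lambda>x\<in>carrier A. D (E x) \<ominus>\<^bsub>A\<^esub> E (D x))\<rparr>"

definition Inn :: "('a \<Rightarrow> 'a) set" where
  "Inn = {D \<in> carrier Der. \<exists>a\<in>carrier A. \<forall>x\<in>carrier A. D x = (a \<otimes>\<^bsub>A\<^esub> x) \<ominus>\<^bsub>A\<^esub> (x \<otimes>\<^bsub>A\<^esub> a)}"


subsection \<open>Double derivations\<close>

abbreviation AA where "AA \<equiv> tensor2 K A"

text \<open>The inner structure on \<open>A \<otimes> A\<close>: \<open>b(x \<otimes> y)c = xc \<otimes> by\<close>.\<close>

definition inner_act :: "'a \<Rightarrow> 'a \<Rightarrow> ('a \<times> 'a) frag set \<Rightarrow> ('a \<times> 'a) frag set" where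
  "inner_act b c = the_add_hom AA AA
     (\<lambda>h. \<forall>x\<in>carrier A. \<forall>y\<in>carrier A. h (tns2 K A x y) = tns2 K A (x \<otimes>\<^bsub>A\<^esub> c) (b \<otimes>\<^bsub>A\<^esub> y))"

definition DDer :: "('a, 'a \<Rightarrow> ('a \<times> 'a) frag set, 'a) bimodule" where
  "DDer = \<lparr>
     carrier = {\<Theta> \<in> extensional (carrier A).
       \<Theta> \<in> hom (add_monoid A) (add_monoid AA) \<and>
       (\<forall>c\<in>carrier K. \<forall>x\<in>carrier A. \<Theta> (c \<odot>\<^bsub>A\<^esub> x) = scal A c \<triangleright>\<^bsub>AA\<^esub> \<Theta> x) \<and>
       (\<forall>x\<in>carrier A. \<forall>y\<in>carrier A. \<Theta> (x \<otimes>\<^bsub>A\<^esub> y) = (x \<triangleright>\<^bsub>AA\<^esub> \<Theta> y) \<oplus>\<^bsub>AA\<^esub> (\<Theta> x \<triangleleft>\<^bsub>AA\<^esub> y)) \<and>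
       (\<forall>r\<in>carrier R. \<Theta> (\<eta> r) = \<zero>\<^bsub>AA\<^esub>)},
     monoid.mult = undefined, one = undefined,
     ring.zero = (\<lambda>x\<in>carrier A. \<zero>\<^bsub>AA\<^esub>),
     add = (\<lambda>\<Theta> \<Phi>. \<lambda>x\<in>carrier A. \<Theta> x \<oplus>\<^bsub>AA\<^esub> \<Phi> x),
     lact = (\<lambda>b \<Theta>. \<lambda>x\<in>carrier A. inner_act b \<one>\<^bsub>A\<^esub> (\<Theta> x)),
     ract = (\<lambda>\<Theta> c. \<lambda>x\<in>carrier A. inner_act \<one>\<^bsub>A\<^esub> c (\<Theta> x))\<rparr>"

text \<open>The derivation \<open>a \<mapsto> \<Theta>'(a)\<Theta>''(a)\<close>.\<close>

definition der_of :: "('a \<Rightarrow> ('a \<times> 'a) frag set) \<Rightarrow> 'a \<Rightarrow> 'a" where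
  "der_of \<Theta> = (\<lambda>x\<in>carrier A. mult2 K A (\<Theta> x))"

text \<open>\<open>\<Delta>(a) = ae' \<otimes> e'' - e' \<otimes> e''a\<close>.\<close>

definition Delta :: "('r \<times> 'r) frag set \<Rightarrow> 'a \<Rightarrow> ('a \<times> 'a) frag set" where
  "Delta e = (\<lambda>a\<in>carrier A.
     the_add_hom (tensor2 K R) AA
       (\<lambda>h. \<forall>r\<in>carrier R. \<forall>s\<in>carrier R. h (tns2 K R r s) =
          tns2 K A (a \<otimes>\<^bsub>A\<^esub> \<eta> r) (\<eta> s) \<ominus>\<^bsub>AA\<^esub> tns2 K A (\<eta> r) (\<eta> s \<otimes>\<^bsub>A\<^esub> a)) e)"


subsection \<open>Relative noncommutative forms\<close>

abbreviation AtR where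
  "AtR \<equiv> tensor R (self_bimodule A (\<lambda>x. x) \<eta>) (self_bimodule A \<eta> (\<lambda>x. x))"

abbreviation tnsR where
  "tnsR \<equiv> tens R (self_bimodule A (\<lambda>x. x) \<eta>) (self_bimodule A \<eta> (\<lambda>x. x))"

definition multR :: "('a \<times> 'a) frag set \<Rightarrow> 'a" where
  "multR = the_add_hom AtR A
     (\<lambda>h. \<forall>x\<in>carrier A. \<forall>y\<in>carrier A. h (tnsR x y) = x \<otimes>\<^bsub>A\<^esub> y)"

text \<open>\<open>\<Omega>\<^sup>n\<close> is the \<open>n\<close>-th tensor power of the bimodule \<open>\<Omega>\<^sup>1\<close> over \<open>A\<close>. Only the degrees up to 3 of the
  tensor algebra enter: a 2-form \<open>\<omega>\<close>, its differential, and its contractions.\<close>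

definition Omega1 :: "('a, ('a \<times> 'a) frag set, 'a) bimodule" where
  "Omega1 = AtR\<lparr>carrier := {u \<in> carrier AtR. multR u = \<zero>\<^bsub>A\<^esub>}\<rparr>"

definition Omega2 where "Omega2 = tensor A Omega1 Omega1"

definition Omega3 where "Omega3 = tensor A Omega2 Omega1"

text \<open>Products of forms, \<open>wedgemn : \<Omega>\<^sup>m \<times> \<Omega>\<^sup>n \<rightarrow> \<Omega>\<^sup>m\<^sup>+\<^sup>n\<close>.\<close>

definition wedge11 where "wedge11 = tens A Omega1 Omega1"

definition wedge21 where "wedge21 = tens A Omega2 Omega1"

definition wedge12 where
  "wedge12 \<alpha> = the_add_hom Omega2 Omega3
     (\<lambda>h. \<forall>\<beta>\<in>carrier Omega1. \<forall>\<gamma>\<in>carrier Omega1.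
        h (wedge11 \<beta> \<gamma>) = wedge21 (wedge11 \<alpha> \<beta>) \<gamma>)"

text \<open>The differential \<open>dn : \<Omega>\<^sup>n \<rightarrow> \<Omega>\<^sup>n\<^sup>+\<^sup>1\<close>. Since \<open>ab = 0\<close> summed over the terms of an element
  \<open>a \<otimes> b\<close> of \<open>\<Omega>\<^sup>1\<close> gives \<open>a \<otimes> b = -a db\<close>, the forms \<open>u dv\<close> generate \<open>\<Omega>\<^sup>1\<close> additively.\<close>

definition d0 :: "'a \<Rightarrow> ('a \<times> 'a) frag set" where
  "d0 a = tnsR a \<one>\<^bsub>A\<^esub> \<ominus>\<^bsub>AtR\<^esub> tnsR \<one>\<^bsub>A\<^esub> a"

definition d1 where
  "d1 = the_add_hom Omega1 Omega2
     (\<lambda>h. \<forall>u\<in>carrier A. \<forall>v\<in>carrier A. h (u \<triangleright>\<^bsub>Omega1\<^esub> d0 v) = wedge11 (d0 u) (d0 v))"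

definition d2 where
  "d2 = the_add_hom Omega2 Omega3
     (\<lambda>h. \<forall>\<alpha>\<in>carrier Omega1. \<forall>\<beta>\<in>carrier Omega1.
        h (wedge11 \<alpha> \<beta>) = wedge21 (d1 \<alpha>) \<beta> \<ominus>\<^bsub>Omega3\<^esub> wedge12 \<alpha> (d1 \<beta>))"

text \<open>The degree \<open>n\<close> part of \<open>[\<Omega>, \<Omega>]\<close>, spanned by \<open>\<alpha>\<beta> - (-1)\<^sup>k\<^sup>l\<beta>\<alpha>\<close> for \<open>\<alpha> \<in> \<Omega>\<^sup>k\<close>, \<open>\<beta> \<in> \<Omega>\<^sup>l\<close>, \<open>k + l = n\<close>.\<close>

definition comm1 where "comm1 = commutators A Omega1"

definition comm2 where
  "comm2 = generate (add_monoid Omega2)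
     ({(a \<triangleright>\<^bsub>Omega2\<^esub> \<xi>) \<ominus>\<^bsub>Omega2\<^esub> (\<xi> \<triangleleft>\<^bsub>Omega2\<^esub> a) | a \<xi>. a \<in> carrier A \<and> \<xi> \<in> carrier Omega2} \<union>
      {wedge11 \<alpha> \<beta> \<oplus>\<^bsub>Omega2\<^esub> wedge11 \<beta> \<alpha> | \<alpha> \<beta>. \<alpha> \<in> carrier Omega1 \<and> \<beta> \<in> carrier Omega1})"

definition comm3 where
  "comm3 = generate (add_monoid Omega3)
     ({(a \<triangleright>\<^bsub>Omega3\<^esub> \<zeta>) \<ominus>\<^bsub>Omega3\<^esub> (\<zeta> \<triangleleft>\<^bsub>Omega3\<^esub> a) | a \<zeta>. a \<in> carrier A \<and> \<zeta> \<in> carrier Omega3} \<union>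
      {wedge12 \<alpha> \<xi> \<ominus>\<^bsub>Omega3\<^esub> wedge21 \<xi> \<alpha> | \<alpha> \<xi>. \<alpha> \<in> carrier Omega1 \<and> \<xi> \<in> carrier Omega2})"

text \<open>\<open>DRn\<close> is the group \<open>DR\<^sup>n\<close>, written multiplicatively as is usual for \<open>Mod\<close>; \<open>DR\<^sup>0\<close> is \<open>A_nat\<close>.
  A map that is constant on cosets is passed to the quotient with \<open>the_elem (f ` X)\<close>.\<close>

definition DR1 where "DR1 = Omega1 A_Mod comm1"
definition DR2 where "DR2 = Omega2 A_Mod comm2"
definition DR3 where "DR3 = Omega3 A_Mod comm3"

definition dDR0 where "dDR0 p = the_elem ((\<lambda>a. comm1 +>\<^bsub>Omega1\<^esub> d0 a) ` p)"
definition dDR2 where "dDR2 \<omega> = the_elem ((\<lambda>\<xi>. comm3 +>\<^bsub>Omega3\<^esub> d2 \<xi>) ` \<omega>)"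


subsection \<open>Contraction\<close>

text \<open>\<open>i1 \<Theta>\<close> is \<open>i\<^sub>\<Theta>\<close> on \<open>\<Omega>\<^sup>1\<close>, with values in \<open>A \<otimes> A\<close>.\<close>

definition i1 :: "('a \<Rightarrow> ('a \<times> 'a) frag set) \<Rightarrow> ('a \<times> 'a) frag set \<Rightarrow> ('a \<times> 'a) frag set" where
  "i1 \<Theta> = the_add_hom Omega1 AA
     (\<lambda>h. \<forall>u\<in>carrier A. \<forall>v\<in>carrier A. h (u \<triangleright>\<^bsub>Omega1\<^esub> d0 v) = u \<triangleright>\<^bsub>AA\<^esub> \<Theta> v)"

text \<open>\<open>x \<otimes> y \<mapsto> y\<beta>x\<close>. This is both \<open>((x \<otimes> y)\<beta>)\<^sup>\<diamond> = (x \<otimes> y\<beta>)\<^sup>\<diamond>\<close> and \<open>(\<beta>(x \<otimes> y))\<^sup>\<diamond> = (\<beta>x \<otimes> y)\<^sup>\<diamond>\<close>,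
  as the sign is trivial when one of the factors has degree 0.\<close>

definition sandwich :: "('a \<times> 'a) frag set \<Rightarrow> ('a \<times> 'a) frag set \<Rightarrow> ('a \<times> 'a) frag set" where
  "sandwich \<beta> = the_add_hom AA Omega1
     (\<lambda>h. \<forall>x\<in>carrier A. \<forall>y\<in>carrier A. h (tns2 K A x y) = (y \<triangleright>\<^bsub>Omega1\<^esub> \<beta>) \<triangleleft>\<^bsub>Omega1\<^esub> x)"

text \<open>\<open>\<iota>\<^sub>\<Theta>\<close> on \<open>\<Omega>\<^sup>2\<close>: the super-derivation rule \<open>i\<^sub>\<Theta>(\<alpha>\<beta>) = i\<^sub>\<Theta>(\<alpha>)\<beta> - \<alpha>i\<^sub>\<Theta>(\<beta>)\<close> followed by \<open>\<diamond>\<close>.\<close>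

definition iota2 where
  "iota2 \<Theta> = the_add_hom Omega2 Omega1
     (\<lambda>h. \<forall>\<alpha>\<in>carrier Omega1. \<forall>\<beta>\<in>carrier Omega1.
        h (wedge11 \<alpha> \<beta>) = sandwich \<beta> (i1 \<Theta> \<alpha>) \<ominus>\<^bsub>Omega1\<^esub> sandwich \<alpha> (i1 \<Theta> \<beta>))"

definition iota where "iota \<Theta> \<omega> = the_elem (iota2 \<Theta> ` \<omega>)"


subsection \<open>Bi-symplectic forms\<close>

definition bisymplectic where
  "bisymplectic \<omega> \<longleftrightarrow> \<omega> \<in> carrier DR2 \<and> dDR2 \<omega> = \<one>\<^bsub>DR3\<^esub> \<and>
     bij_betw (\<lambda>\<Theta>. iota \<Theta> \<omega>) (carrier DDer) (carrier Omega1)"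

definition DDer_nat where "DDer_nat = DDer A_Mod commutators A DDer"

definition iota_nat where
  "iota_nat \<omega> X = the_elem ((\<lambda>\<Theta>. comm1 +>\<^bsub>Omega1\<^esub> iota \<Theta> \<omega>) ` X)"

definition Ham where
  "Ham \<omega> \<beta> = the_elem (der_of ` inv_into (carrier DDer_nat) (iota_nat \<omega>) \<beta>)"

definition theta where "theta \<omega> p = Ham \<omega> (dDR0 p)"

definition nc_bracket where
  "nc_bracket \<omega> p q = the_elem ((\<lambda>x. A_comm +>\<^bsub>A\<^esub> theta \<omega> p x) ` q)"

text \<open>\<open>is_mu_nc e \<omega> c\<close> says that \<open>c\<close> is the class \<open>\<mu>\<^sub>n\<^sub>c(\<omega>) \<in> (A/R)\<^sup>R\<close>, which is determined by these
  conditions.\<close>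

definition is_mu_nc where
  "is_mu_nc e \<omega> c \<longleftrightarrow> c \<in> carrier (A A_Mod \<eta> ` carrier R) \<and>
     (\<forall>r\<in>carrier R. \<forall>x\<in>c. (\<eta> r \<otimes>\<^bsub>A\<^esub> x) \<ominus>\<^bsub>A\<^esub> (x \<otimes>\<^bsub>A\<^esub> \<eta> r) \<in> \<eta> ` carrier R) \<and>
     the_elem (d0 ` c) = iota (Delta e) \<omega>"


subsection \<open>The quotient by the two-sided ideal generated by an element\<close>

definition Ideal_w :: "'a \<Rightarrow> 'a set" where "Ideal_w w = Idl\<^bsub>A\<^esub> {w}"

definition A_w :: "'a \<Rightarrow> ('k, 'a set) module" where "A_w w = quot_module A (Ideal_w w)"

definition eta_w :: "'a \<Rightarrow> 'r \<Rightarrow> 'a set" where "eta_w w r = Ideal_w w +>\<^bsub>A\<^esub> \<eta> r"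

definition theta_bar where
  "theta_bar \<omega> w p =
     (\<lambda>X\<in>carrier (A_w w). the_elem ((\<lambda>x. Ideal_w w +>\<^bsub>A\<^esub> theta \<omega> p x) ` X))"

text \<open>The projection \<open>\<pi> : A\<^sub>\<natural> \<rightarrow> (A\<^sub>w)\<^sub>\<natural>\<close>.\<close>

definition A_w_nat :: "'a \<Rightarrow> ('k, 'a set set) module" where
  "A_w_nat w = algebra_over_data.A_nat (A_w w)"

definition proj_w :: "'a \<Rightarrow> 'a set \<Rightarrow> 'a set set" where
  "proj_w w p = the_elem
     ((\<lambda>a. algebra_over_data.A_comm (A_w w) +>\<^bsub>A_w w\<^esub> (Ideal_w w +>\<^bsub>A\<^esub> a)) ` p)"

definition Der_w :: "'a \<Rightarrow> ('k, 'a set \<Rightarrow> 'a set) lie" where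
  "Der_w w = algebra_over_data.Der K R (A_w w) (eta_w w)"

definition Inn_w :: "'a \<Rightarrow> ('a set \<Rightarrow> 'a set) set" where
  "Inn_w w = algebra_over_data.Inn K R (A_w w) (eta_w w)"

end

end

(* Write i_D for the contraction of forms with a derivation D of A. For a double derivation Theta with
   associated derivation D(a) = Theta'(a)Theta''(a) one has iota_Theta omega = i_D omega modulo
   [A, Omega^1], so theta_p satisfies i_{theta_p} omega = dp in DR^1. For any derivation D and double
   derivation Theta, i_D iota_Theta = - iota_Theta i_D from Omega^2 to A (no quotient is taken).
   Since every 1-form da is some iota_Theta omega, this shows that a derivation D is determined by
   i_D omega in DR^1, and, taking Theta = Delta, that theta_p(w) = i_{theta_p} dw =
   - iota_Delta(dp) = 0, whence (i). As omega is closed, Cartan calculus gives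
   i_{[theta_p, theta_q]} omega = d{p,q}, hence [theta_p, theta_q] = theta_{p,q}; this and
   i_D i_D = 0 give the Lie bracket. Finally, if dc = iota_Phi omega, then d(cw) = iota_{c Delta + w Phi} omega
   in DR^1, so theta_{cw} is the sum of the inner derivation [-, e'ce''] and of a derivation with values
   in AwA; so p from AwA acts on A_w by inner derivations, and (ii), (iii) follow. *)

theory Submission
  imports Defs
begin

section \<open>Additive maps\<close>

text \<open>Forms live in iterated quotients of free abelian groups and every map on them is a
  definite description, so each operator must first be shown to exist; identities are then checked
  on products of one-forms. The obstacle is that the equations for theta_p hold in DR only, that is
  up to supercommutators, whereas uniqueness of a derivation and theta_p(w) = 0 are exact statements
  in A. To bridge this, one representative of omega in Omega^2 is fixed and the error terms are
  carried along. Contraction with a derivation takes supercommutators to supercommutators, but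
  contraction with a double derivation takes them to zero, because it joins the two ends of a form.
  So an equation known in DR^1 can be tested exactly by contracting with double derivations. In this
  test iota_Delta(da) = 0 because both halves of Delta(a) become e'' a e'. The combination c Delta +
  w Phi comes from d(cw) = c dw + dc w, where dc w may be replaced by w dc in DR^1, and from the
  linearity of contraction over the inner bimodule structure on double derivations.\<close>

definition addhom :: "('m, 'y) ring_scheme \<Rightarrow> ('p, 'z) ring_scheme \<Rightarrow> ('m \<Rightarrow> 'p) set" where
  "addhom M P = hom (add_monoid M) (add_monoid P)"

definition add_span :: "('m, 'y) ring_scheme \<Rightarrow> 'm set \<Rightarrow> 'm set" where
  "add_span M G = generate (add_monoid M) G"

lemma addhom_iff: "h \<in> addhom M P \<longleftrightarrow> (\<forall>x\<in>carrier M. h x \<in> carrier P) \<and>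
    (\<forall>x\<in>carrier M. \<forall>y\<in>carrier M. h (x \<oplus>\<^bsub>M\<^esub> y) = h x \<oplus>\<^bsub>P\<^esub> h y)"
  by (auto simp: addhom_def hom_def)

lemma addhomI:
  assumes "\<And>x. x \<in> carrier M \<Longrightarrow> h x \<in> carrier P"
    and "\<And>x y. \<lbrakk>x \<in> carrier M; y \<in> carrier M\<rbrakk> \<Longrightarrow> h (x \<oplus>\<^bsub>M\<^esub> y) = h x \<oplus>\<^bsub>P\<^esub> h y"
  shows "h \<in> addhom M P"
  using assms by (auto simp: addhom_iff)

lemma addhom_closed: "\<lbrakk>h \<in> addhom M P; x \<in> carrier M\<rbrakk> \<Longrightarrow> h x \<in> carrier P"
  by (auto simp: addhom_iff)

lemma addhom_add:
  "\<lbrakk>h \<in> addhom M P; x \<in> carrier M; y \<in> carrier M\<rbrakk> \<Longrightarrow> h (x \<oplus>\<^bsub>M\<^esub> y) = h x \<oplus>\<^bsub>P\<^esub> h y"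
  by (auto simp: addhom_iff)

lemma addhom_group_hom:
  "\<lbrakk>h \<in> addhom M P; abelian_group M; abelian_group P\<rbrakk> \<Longrightarrow> group_hom (add_monoid M) (add_monoid P) h"
  by (simp add: group_hom_def group_hom_axioms_def abelian_group.a_group addhom_def)

lemma addhom_zero:
  "\<lbrakk>h \<in> addhom M P; abelian_group M; abelian_group P\<rbrakk> \<Longrightarrow> h \<zero>\<^bsub>M\<^esub> = \<zero>\<^bsub>P\<^esub>"
  using group_hom.hom_one[OF addhom_group_hom] by fastforce

lemma addhom_inv:
  "\<lbrakk>h \<in> addhom M P; abelian_group M; abelian_group P; x \<in> carrier M\<rbrakk> \<Longrightarrow> h (\<ominus>\<^bsub>M\<^esub> x) = \<ominus>\<^bsub>P\<^esub> h x"
  using group_hom.hom_inv[OF addhom_group_hom] by (fastforce simp: a_inv_def)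

lemma addhom_minus:
  "\<lbrakk>h \<in> addhom M P; abelian_group M; abelian_group P; x \<in> carrier M; y \<in> carrier M\<rbrakk>
    \<Longrightarrow> h (x \<ominus>\<^bsub>M\<^esub> y) = h x \<ominus>\<^bsub>P\<^esub> h y"
  by (simp add: a_minus_def addhom_add addhom_inv abelian_group.a_inv_closed)

lemma addhom_id: "(\<lambda>x. x) \<in> addhom M M"
  by (auto simp: addhom_iff)

lemma addhom_comp:
  "\<lbrakk>f \<in> addhom N P; g \<in> addhom M N\<rbrakk> \<Longrightarrow> (\<lambda>x. f (g x)) \<in> addhom M P"
  by (auto simp: addhom_iff)

lemma addhom_restrict:
  "\<lbrakk>h \<in> addhom M P; abelian_group M\<rbrakk> \<Longrightarrow> restrict h (carrier M) \<in> addhom M P"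
  by (auto simp: addhom_iff abelian_groupE)

context abelian_group
begin

lemma diff_eq: "\<lbrakk>x \<in> carrier G; y \<in> carrier G; z \<in> carrier G\<rbrakk> \<Longrightarrow> x \<ominus> y = z \<longleftrightarrow> x = z \<oplus> y"
  by (metis a_minus_def a_assoc a_inv_closed l_neg minus_closed r_neg r_zero)

lemma eq_diff: "\<lbrakk>x \<in> carrier G; y \<in> carrier G; z \<in> carrier G\<rbrakk> \<Longrightarrow> z = x \<ominus> y \<longleftrightarrow> z \<oplus> y = x"
  by (metis diff_eq)

lemma add_diff: "\<lbrakk>x \<in> carrier G; y \<in> carrier G; z \<in> carrier G\<rbrakk> \<Longrightarrow> x \<oplus> (y \<ominus> z) = (x \<oplus> y) \<ominus> z"
  by (simp add: a_minus_def a_ac)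

lemma diff_add: "\<lbrakk>x \<in> carrier G; y \<in> carrier G; z \<in> carrier G\<rbrakk> \<Longrightarrow> (x \<ominus> y) \<oplus> z = (x \<oplus> z) \<ominus> y"
  by (simp add: a_minus_def a_ac)

lemma diff_diff: "\<lbrakk>x \<in> carrier G; y \<in> carrier G; z \<in> carrier G\<rbrakk> \<Longrightarrow> (x \<ominus> y) \<ominus> z = x \<ominus> (y \<oplus> z)"
  by (simp add: a_minus_def a_ac minus_add)

lemma diff_diff2: "\<lbrakk>x \<in> carrier G; y \<in> carrier G; z \<in> carrier G\<rbrakk> \<Longrightarrow> x \<ominus> (y \<ominus> z) = (x \<oplus> z) \<ominus> y"
  by (simp add: a_minus_def a_ac minus_add)

lemma neg_add: "\<lbrakk>x \<in> carrier G; y \<in> carrier G\<rbrakk> \<Longrightarrow> (\<ominus> x) \<oplus> y = y \<ominus> x"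
  by (simp add: a_minus_def a_comm)

lemma add_neg: "\<lbrakk>x \<in> carrier G; y \<in> carrier G\<rbrakk> \<Longrightarrow> y \<oplus> (\<ominus> x) = y \<ominus> x"
  by (simp add: a_minus_def)

lemma diff_neg: "\<lbrakk>x \<in> carrier G; y \<in> carrier G\<rbrakk> \<Longrightarrow> y \<ominus> (\<ominus> x) = y \<oplus> x"
  by (simp add: a_minus_def)

lemma neg_diff: "\<lbrakk>x \<in> carrier G; y \<in> carrier G\<rbrakk> \<Longrightarrow> (\<ominus> x) \<ominus> y = \<ominus> (x \<oplus> y)"
  by (simp add: a_minus_def minus_add)

lemma neg_of_diff: "\<lbrakk>x \<in> carrier G; y \<in> carrier G\<rbrakk> \<Longrightarrow> \<ominus> (x \<ominus> y) = y \<ominus> x"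
  by (simp add: a_minus_def minus_add a_comm)

lemma eq_neg: "\<lbrakk>x \<in> carrier G; y \<in> carrier G\<rbrakk> \<Longrightarrow> x = \<ominus> y \<longleftrightarrow> x \<oplus> y = \<zero>"
  by (metis l_neg minus_equality)

lemma diff_self: "x \<in> carrier G \<Longrightarrow> x \<ominus> x = \<zero>"
  by (simp add: a_minus_def r_neg)

lemma diff_zero: "x \<in> carrier G \<Longrightarrow> x \<ominus> \<zero> = x"
  by (simp add: a_minus_def)

text \<open>These rules bring an identity of signed sums into the form \<open>x = y\<close> without negative terms.\<close>

lemmas diff_simps = diff_eq eq_diff add_diff diff_add diff_diff diff_diff2 neg_add add_neg diff_neg
  neg_diff neg_of_diff eq_neg diff_zero a_ac

lemma addhom_plus:
  assumes "f \<in> addhom M G" "g \<in> addhom M G"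
  shows "(\<lambda>x. f x \<oplus> g x) \<in> addhom M G"
  using assms by (auto simp: addhom_iff a_ac)

lemma addhom_neg:
  assumes "f \<in> addhom M G"
  shows "(\<lambda>x. \<ominus> f x) \<in> addhom M G"
  using assms by (auto simp: addhom_iff minus_add)

lemma addhom_diff:
  assumes "f \<in> addhom M G" "g \<in> addhom M G"
  shows "(\<lambda>x. f x \<ominus> g x) \<in> addhom M G"
  using assms by (auto simp: addhom_iff a_minus_def minus_add a_ac)

lemma addhom_const_zero: "(\<lambda>x. \<zero>) \<in> addhom M G"
  by (auto simp: addhom_iff)

lemma add_span_subgroup: "H \<subseteq> carrier G \<Longrightarrow> subgroup (add_span G H) (add_monoid G)"
  unfolding add_span_def using group.generate_is_subgroup[OF a_group] by simp

lemma subgroupI_add: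
  assumes "H \<subseteq> carrier G" "\<zero> \<in> H" "\<And>x y. \<lbrakk>x \<in> H; y \<in> H\<rbrakk> \<Longrightarrow> x \<ominus> y \<in> H"
  shows "subgroup H (add_monoid G)"
proof -
  have neg: "\<ominus> x \<in> H" if "x \<in> H" for x
    using assms(3)[OF assms(2) that] that assms(1) by (auto simp: a_minus_def)
  have "x \<oplus> y \<in> H" if "x \<in> H" "y \<in> H" for x y
    using assms(3)[OF that(1) neg[OF that(2)]] that assms(1) by (auto simp: a_minus_def)
  with assms neg show ?thesis
    by (auto simp: subgroup_def a_inv_def[symmetric])
qed

lemma subgroupD_add:
  assumes "subgroup H (add_monoid G)"
  shows "H \<subseteq> carrier G" "\<zero> \<in> H" "\<And>x y. \<lbrakk>x \<in> H; y \<in> H\<rbrakk> \<Longrightarrow> x \<oplus> y \<in> H"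
    "\<And>x. x \<in> H \<Longrightarrow> \<ominus> x \<in> H" "\<And>x y. \<lbrakk>x \<in> H; y \<in> H\<rbrakk> \<Longrightarrow> x \<ominus> y \<in> H"
  using assms by (auto simp: subgroup_def a_inv_def[symmetric] a_minus_def)

lemma add_span_incl: "x \<in> H \<Longrightarrow> x \<in> add_span G H"
  unfolding add_span_def by (rule generate.incl)

lemma add_span_least:
  "\<lbrakk>H \<subseteq> B; subgroup B (add_monoid G)\<rbrakk> \<Longrightarrow> add_span G H \<subseteq> B"
  unfolding add_span_def using group.generate_subgroup_incl[OF a_group] by blast

end

lemma addhom_vimage_subgroup:
  assumes "abelian_group M" "abelian_group P" "f \<in> addhom M P" "subgroup B (add_monoid P)"
  shows "subgroup {x \<in> carrier M. f x \<in> B} (add_monoid M)"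
proof -
  interpret M: abelian_group M by fact
  interpret P: abelian_group P by fact
  show ?thesis
    using P.subgroupD_add[OF assms(4)]
    by (intro M.subgroupI_add) (auto simp: addhom_zero[OF assms(3,1,2)] addhom_minus[OF assms(3,1,2)])
qed

text \<open>The preimage of a subgroup is a subgroup, so it contains a span as soon as it contains
  the generators. The inclusions between commutator spaces below are instances.\<close>

lemma addhom_span_into:
  assumes "abelian_group M" "abelian_group P" "f \<in> addhom M P" "subgroup B (add_monoid P)"
    and "H \<subseteq> carrier M" "\<And>x. x \<in> H \<Longrightarrow> f x \<in> B" "x \<in> add_span M H"
  shows "f x \<in> B"
  using abelian_group.add_span_least[OF assms(1) _ addhom_vimage_subgroup[OF assms(1-4)], of H] assms(5-)
  by blast

text \<open>The difference of the two maps sends the generators into the trivial subgroup. This is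
  the uniqueness half of every definite description, and it reduces identities of operators to
  elementary tensors.\<close>

lemma addhom_eq_on_span:
  assumes "abelian_group M" "abelian_group P" "f \<in> addhom M P" "g \<in> addhom M P"
    and "carrier M \<subseteq> add_span M H" "H \<subseteq> carrier M" "\<And>x. x \<in> H \<Longrightarrow> f x = g x"
  shows "\<forall>x\<in>carrier M. f x = g x"
proof
  fix x assume "x \<in> carrier M"
  interpret P: abelian_group P by fact
  have "subgroup {\<zero>\<^bsub>P\<^esub>} (add_monoid P)"
    by (rule P.subgroupI_add) (auto simp: P.diff_self)
  moreover have "f y \<ominus>\<^bsub>P\<^esub> g y \<in> {\<zero>\<^bsub>P\<^esub>}" if "y \<in> H" for y
    using assms(6,7) that addhom_closed[OF assms(4), of y] by (auto simp: P.diff_self)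
  ultimately have "f x \<ominus>\<^bsub>P\<^esub> g x \<in> {\<zero>\<^bsub>P\<^esub>}"
    using addhom_span_into[where f = "\<lambda>x. f x \<ominus>\<^bsub>P\<^esub> g x" and H = H and x = x,
        OF assms(1,2) P.addhom_diff[OF assms(3,4)] _ assms(6)] assms(5) \<open>x \<in> carrier M\<close>
    by blast
  then show "f x = g x"
    using addhom_closed[OF assms(3)] addhom_closed[OF assms(4)] \<open>x \<in> carrier M\<close>
    by (simp add: P.diff_eq)
qed

text \<open>A definite description has a meaning only with existence and uniqueness: uniqueness
  comes from the spanning set of all \<open>g x y\<close>, existence has to be supplied as the map
  \<open>k\<close>. Restricting \<open>k\<close> to the carrier meets the demand that the map be
  extensional.\<close>

lemma the_add_hom_works:
  assumes M: "abelian_group M" and P: "abelian_group P"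
    and g: "\<And>x y. \<lbrakk>x \<in> X; y \<in> Y\<rbrakk> \<Longrightarrow> g x y \<in> carrier M"
    and span: "carrier M \<subseteq> add_span M {g x y | x y. x \<in> X \<and> y \<in> Y}"
    and k: "k \<in> addhom M P" "\<And>x y. \<lbrakk>x \<in> X; y \<in> Y\<rbrakk> \<Longrightarrow> k (g x y) = f x y"
  defines "h \<equiv> the_add_hom M P (\<lambda>h. \<forall>x\<in>X. \<forall>y\<in>Y. h (g x y) = f x y)"
  shows "h \<in> addhom M P" and "\<And>x y. \<lbrakk>x \<in> X; y \<in> Y\<rbrakk> \<Longrightarrow> h (g x y) = f x y"
proof -
  let ?r = "restrict k (carrier M)"
  have "h = ?r"
    unfolding h_def the_add_hom_def addhom_def[symmetric]
  proof (rule the_equality)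
    show "?r \<in> extensional (carrier M) \<and> ?r \<in> addhom M P \<and> (\<forall>x\<in>X. \<forall>y\<in>Y. ?r (g x y) = f x y)"
      using addhom_restrict[OF k(1) M] g k(2) by auto
  next
    fix h assume h: "h \<in> extensional (carrier M) \<and> h \<in> addhom M P \<and> (\<forall>x\<in>X. \<forall>y\<in>Y. h (g x y) = f x y)"
    have "\<forall>x\<in>carrier M. h x = k x"
      by (rule addhom_eq_on_span[OF M P _ k(1) span]) (use h g k in auto)
    then show "h = ?r"
      using h by (auto simp: extensional_def fun_eq_iff)
  qed
  then show "h \<in> addhom M P" and "\<And>x y. \<lbrakk>x \<in> X; y \<in> Y\<rbrakk> \<Longrightarrow> h (g x y) = f x y"
    using addhom_restrict[OF k(1) M] g k(2) by auto
qed


section \<open>Bimodules and their tensor products\<close>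

locale bimod = S: ring S + T: ring T + abelian_group M
  for S :: "('s, 'x) ring_scheme" and M :: "('s, 'm, 't, 'y) bimodule_scheme" (structure)
    and T :: "('t, 'z) ring_scheme" +
  assumes lact_closed [simp]: "\<lbrakk>s \<in> carrier S; m \<in> carrier M\<rbrakk> \<Longrightarrow> s \<triangleright> m \<in> carrier M"
    and ract_closed [simp]: "\<lbrakk>m \<in> carrier M; t \<in> carrier T\<rbrakk> \<Longrightarrow> m \<triangleleft> t \<in> carrier M"
    and lact_add: "\<lbrakk>s \<in> carrier S; m \<in> carrier M; n \<in> carrier M\<rbrakk> \<Longrightarrow> s \<triangleright> (m \<oplus> n) = s \<triangleright> m \<oplus> s \<triangleright> n"
    and ract_add: "\<lbrakk>t \<in> carrier T; m \<in> carrier M; n \<in> carrier M\<rbrakk> \<Longrightarrow> (m \<oplus> n) \<triangleleft> t = m \<triangleleft> t \<oplus> n \<triangleleft> t"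
    and lact_add_left: "\<lbrakk>s \<in> carrier S; s' \<in> carrier S; m \<in> carrier M\<rbrakk> \<Longrightarrow>
      (s \<oplus>\<^bsub>S\<^esub> s') \<triangleright> m = s \<triangleright> m \<oplus> s' \<triangleright> m"
    and ract_add_right: "\<lbrakk>t \<in> carrier T; t' \<in> carrier T; m \<in> carrier M\<rbrakk> \<Longrightarrow>
      m \<triangleleft> (t \<oplus>\<^bsub>T\<^esub> t') = m \<triangleleft> t \<oplus> m \<triangleleft> t'"
    and lact_assoc: "\<lbrakk>s \<in> carrier S; s' \<in> carrier S; m \<in> carrier M\<rbrakk> \<Longrightarrow>
      (s \<otimes>\<^bsub>S\<^esub> s') \<triangleright> m = s \<triangleright> s' \<triangleright> m"
    and ract_assoc: "\<lbrakk>t \<in> carrier T; t' \<in> carrier T; m \<in> carrier M\<rbrakk> \<Longrightarrow>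
      m \<triangleleft> (t \<otimes>\<^bsub>T\<^esub> t') = m \<triangleleft> t \<triangleleft> t'"
    and lact_one [simp]: "m \<in> carrier M \<Longrightarrow> \<one>\<^bsub>S\<^esub> \<triangleright> m = m"
    and ract_one [simp]: "m \<in> carrier M \<Longrightarrow> m \<triangleleft> \<one>\<^bsub>T\<^esub> = m"
    and lact_ract: "\<lbrakk>s \<in> carrier S; m \<in> carrier M; t \<in> carrier T\<rbrakk> \<Longrightarrow> (s \<triangleright> m) \<triangleleft> t = s \<triangleright> (m \<triangleleft> t)"
begin

lemma bimod: "bimod S M T" ..

lemma abelian_group: "abelian_group M" ..

lemma lact_addhom: "s \<in> carrier S \<Longrightarrow> (\<lambda>m. s \<triangleright> m) \<in> addhom M M"
  by (rule addhomI) (auto simp: lact_add)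

lemma ract_addhom: "t \<in> carrier T \<Longrightarrow> (\<lambda>m. m \<triangleleft> t) \<in> addhom M M"
  by (rule addhomI) (auto simp: ract_add)

lemma lact_addhom_left: "m \<in> carrier M \<Longrightarrow> (\<lambda>s. s \<triangleright> m) \<in> addhom S M"
  by (rule addhomI) (auto simp: lact_add_left)

lemma ract_addhom_right: "m \<in> carrier M \<Longrightarrow> (\<lambda>t. m \<triangleleft> t) \<in> addhom T M"
  by (rule addhomI) (auto simp: ract_add_right)

lemma lact_zero [simp]: "s \<in> carrier S \<Longrightarrow> s \<triangleright> \<zero> = \<zero>"
  by (rule addhom_zero[OF lact_addhom]) (auto intro: abelian_group)

lemma ract_zero [simp]: "t \<in> carrier T \<Longrightarrow> \<zero> \<triangleleft> t = \<zero>"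
  by (rule addhom_zero[OF ract_addhom]) (auto intro: abelian_group)

lemma lact_diff: "\<lbrakk>s \<in> carrier S; m \<in> carrier M; n \<in> carrier M\<rbrakk> \<Longrightarrow> s \<triangleright> (m \<ominus> n) = s \<triangleright> m \<ominus> s \<triangleright> n"
  by (rule addhom_minus[OF lact_addhom]) (auto intro: abelian_group)

lemma ract_diff: "\<lbrakk>t \<in> carrier T; m \<in> carrier M; n \<in> carrier M\<rbrakk> \<Longrightarrow> (m \<ominus> n) \<triangleleft> t = m \<triangleleft> t \<ominus> n \<triangleleft> t"
  by (rule addhom_minus[OF ract_addhom]) (auto intro: abelian_group)

lemma lact_diff_left: "\<lbrakk>s \<in> carrier S; s' \<in> carrier S; m \<in> carrier M\<rbrakk> \<Longrightarrow>
    (s \<ominus>\<^bsub>S\<^esub> s') \<triangleright> m = s \<triangleright> m \<ominus> s' \<triangleright> m"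
  by (rule addhom_minus[OF lact_addhom_left]) (auto intro: abelian_group S.is_abelian_group)

lemma ract_diff_right: "\<lbrakk>t \<in> carrier T; t' \<in> carrier T; m \<in> carrier M\<rbrakk> \<Longrightarrow>
    m \<triangleleft> (t \<ominus>\<^bsub>T\<^esub> t') = m \<triangleleft> t \<ominus> m \<triangleleft> t'"
  by (rule addhom_minus[OF ract_addhom_right]) (auto intro: abelian_group T.is_abelian_group)

lemma lact_neg: "\<lbrakk>s \<in> carrier S; m \<in> carrier M\<rbrakk> \<Longrightarrow> s \<triangleright> (\<ominus> m) = \<ominus> (s \<triangleright> m)"
  by (rule addhom_inv[OF lact_addhom]) (auto intro: abelian_group)

lemma ract_neg: "\<lbrakk>t \<in> carrier T; m \<in> carrier M\<rbrakk> \<Longrightarrow> (\<ominus> m) \<triangleleft> t = \<ominus> (m \<triangleleft> t)"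
  by (rule addhom_inv[OF ract_addhom]) (auto intro: abelian_group)

lemmas act_simps = lact_add ract_add lact_add_left ract_add_right lact_assoc ract_assoc lact_ract
  lact_diff ract_diff lact_diff_left ract_diff_right lact_neg ract_neg

lemma addhom_lact: "\<lbrakk>s \<in> carrier S; f \<in> addhom N M\<rbrakk> \<Longrightarrow> (\<lambda>x. s \<triangleright> f x) \<in> addhom N M"
  by (rule addhom_comp[OF lact_addhom])

lemma addhom_ract: "\<lbrakk>t \<in> carrier T; f \<in> addhom N M\<rbrakk> \<Longrightarrow> (\<lambda>x. f x \<triangleleft> t) \<in> addhom N M"
  by (rule addhom_comp[OF ract_addhom])

lemma addhom_lact_left: "\<lbrakk>m \<in> carrier M; f \<in> addhom N S\<rbrakk> \<Longrightarrow> (\<lambda>x. f x \<triangleright> m) \<in> addhom N M"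
  by (rule addhom_comp[OF lact_addhom_left])

lemma addhom_ract_right: "\<lbrakk>m \<in> carrier M; f \<in> addhom N T\<rbrakk> \<Longrightarrow> (\<lambda>x. m \<triangleleft> f x) \<in> addhom N M"
  by (rule addhom_comp[OF ract_addhom_right])

end

section \<open>The tensor product of bimodules and its universal property\<close>

locale tensor_bimod = M: bimod L M S + N: bimod S N T
  for L :: "('l, 'x) ring_scheme" and M :: "('l, 'm, 's) bimodule" and S :: "('s, 'y) ring_scheme"
    and N :: "('s, 'n, 't) bimodule" and T :: "('t, 'z) ring_scheme"
begin

abbreviation F where "F \<equiv> free_Abelian_group (carrier M \<times> carrier N)"
abbreviation I where "I \<equiv> tensor_rels S M N"
abbreviation t where "t \<equiv> tens S M N"
abbreviation MN where "MN \<equiv> tensor S M N"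
abbreviation TG where "TG \<equiv> tensor_group S M N"

definition rels :: "('m \<times> 'n) frag set" where
  "rels = {frag_of (x \<oplus>\<^bsub>M\<^esub> x', y) - frag_of (x, y) - frag_of (x', y) | x x' y.
         x \<in> carrier M \<and> x' \<in> carrier M \<and> y \<in> carrier N} \<union>
      {frag_of (x, y \<oplus>\<^bsub>N\<^esub> y') - frag_of (x, y) - frag_of (x, y') | x y y'.
         x \<in> carrier M \<and> y \<in> carrier N \<and> y' \<in> carrier N} \<union>
      {frag_of (x \<triangleleft>\<^bsub>M\<^esub> s, y) - frag_of (x, s \<triangleright>\<^bsub>N\<^esub> y) | x s y.
         x \<in> carrier M \<and> s \<in> carrier S \<and> y \<in> carrier N}"

lemma tensor_rels_eq: "I = generate F rels"
  by (simp add: tensor_rels_def rels_def)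

lemma F_diff: "\<lbrakk>u \<in> carrier F; v \<in> carrier F\<rbrakk> \<Longrightarrow> u - v \<in> carrier F"
  using keys_diff[of u v] by auto

lemma rels_sub: "rels \<subseteq> carrier F"
proof -
  have "frag_of (x, y) \<in> carrier F" if "x \<in> carrier M" "y \<in> carrier N" for x y
    using that by simp
  then show ?thesis
    unfolding rels_def by (auto simp del: carrier_free_Abelian_group_iff intro!: F_diff)
qed

lemma I_subgroup: "subgroup I F"
  unfolding tensor_rels_eq by (rule group.generate_is_subgroup[OF group_free_Abelian_group rels_sub])

lemma I_normal: "I \<lhd> F"
  using I_subgroup abelian_free_Abelian_group comm_group.normal_iff_subgroup by blast

lemma TG_simps: "carrier TG = carrier (F Mod I)" "add TG = monoid.mult (F Mod I)" "ring.zero TG = one (F Mod I)"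
  by (simp_all add: tensor_group_def Let_def)

lemma MN_simps: "carrier MN = carrier TG" "add MN = add TG" "ring.zero MN = ring.zero TG"
  by (simp_all add: tensor_def ring.defs)

lemma abelian_group_TG: "abelian_group TG"
proof -
  have "comm_group (F Mod I)"
    using comm_group.abelian_FactGroup[OF abelian_free_Abelian_group I_subgroup] .
  then interpret Q: comm_group "F Mod I" .
  show ?thesis
    by (rule abelian_groupI) (unfold TG_simps, use Q.l_inv_ex in \<open>simp_all add: Q.m_ac del: one_FactGroup mult_FactGroup\<close>)
qed

lemma abelian_group_MN: "abelian_group MN"
  using abelian_groupE[OF abelian_group_TG]
  by (intro abelian_groupI) (simp_all add: MN_simps)

interpretation TG: abelian_group TG by (rule abelian_group_TG)
interpretation MN: abelian_group MN by (rule abelian_group_MN)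

definition pr where "pr u = I #>\<^bsub>F\<^esub> u"

lemma pr_hom: "pr \<in> hom F (F Mod I)"
  using normal.r_coset_hom_Mod[OF I_normal] unfolding pr_def .

lemma pr_closed: "u \<in> carrier F \<Longrightarrow> pr u \<in> carrier TG"
  unfolding TG_simps by (rule hom_in_carrier[OF pr_hom])

lemma pr_add: "\<lbrakk>u \<in> carrier F; v \<in> carrier F\<rbrakk> \<Longrightarrow> pr (u + v) = pr u \<oplus>\<^bsub>TG\<^esub> pr v"
  unfolding TG_simps using hom_mult[OF pr_hom, of u v] by simp

lemma pr_diff: "\<lbrakk>u \<in> carrier F; v \<in> carrier F\<rbrakk> \<Longrightarrow> pr (u - v) = pr u \<ominus>\<^bsub>TG\<^esub> pr v"
  using pr_add[of "u - v" v] F_diff[of u v] by (simp add: TG.eq_diff pr_closed)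

lemma pr_zero: "u \<in> rels \<Longrightarrow> pr u = \<zero>\<^bsub>TG\<^esub>"
  unfolding TG_simps one_FactGroup pr_def
  by (rule subgroup.rcos_const[OF I_subgroup group_free_Abelian_group])
    (simp add: tensor_rels_eq generate.incl)

lemma pr_surj: "carrier TG = pr ` carrier F"
  by (auto simp: TG_simps carrier_FactGroup pr_def)

lemma t_pr: "t x y = pr (frag_of (x, y))"
  by (simp add: tens_def pr_def)

lemma t_closed_TG: "\<lbrakk>x \<in> carrier M; y \<in> carrier N\<rbrakk> \<Longrightarrow> t x y \<in> carrier TG"
  unfolding t_pr by (rule pr_closed) simp

lemma t_add_left_TG: "\<lbrakk>x \<in> carrier M; x' \<in> carrier M; y \<in> carrier N\<rbrakk> \<Longrightarrow>
    t (x \<oplus>\<^bsub>M\<^esub> x') y = t x y \<oplus>\<^bsub>TG\<^esub> t x' y"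
  and t_add_right_TG: "\<lbrakk>x \<in> carrier M; y \<in> carrier N; y' \<in> carrier N\<rbrakk> \<Longrightarrow>
    t x (y \<oplus>\<^bsub>N\<^esub> y') = t x y \<oplus>\<^bsub>TG\<^esub> t x y'"
  and t_balanced_TG: "\<lbrakk>x \<in> carrier M; s \<in> carrier S; y \<in> carrier N\<rbrakk> \<Longrightarrow>
    t (x \<triangleleft>\<^bsub>M\<^esub> s) y = t x (s \<triangleright>\<^bsub>N\<^esub> y)"
proof -
  have f: "frag_of (x, y) \<in> carrier F" if "x \<in> carrier M" "y \<in> carrier N" for x y
    using that by simp
  note [simp del] = carrier_free_Abelian_group_iff
  note [simp] = f t_closed_TG
  {
    assume xy: "x \<in> carrier M" "x' \<in> carrier M" "y \<in> carrier N"
    have "pr (frag_of (x \<oplus>\<^bsub>M\<^esub> x', y) - frag_of (x, y) - frag_of (x', y)) = \<zero>\<^bsub>TG\<^esub>"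
      by (rule pr_zero) (use xy in \<open>auto simp: rels_def\<close>)
    then show "t (x \<oplus>\<^bsub>M\<^esub> x') y = t x y \<oplus>\<^bsub>TG\<^esub> t x' y"
      using xy by (simp add: pr_diff F_diff t_pr[symmetric] TG.diff_simps)
  next
    assume xy: "x \<in> carrier M" "y \<in> carrier N" "y' \<in> carrier N"
    have "pr (frag_of (x, y \<oplus>\<^bsub>N\<^esub> y') - frag_of (x, y) - frag_of (x, y')) = \<zero>\<^bsub>TG\<^esub>"
      by (rule pr_zero) (use xy in \<open>auto simp: rels_def\<close>)
    then show "t x (y \<oplus>\<^bsub>N\<^esub> y') = t x y \<oplus>\<^bsub>TG\<^esub> t x y'"
      using xy by (simp add: pr_diff F_diff t_pr[symmetric] TG.diff_simps)
  next
    assume xy: "x \<in> carrier M" "s \<in> carrier S" "y \<in> carrier N"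
    have "pr (frag_of (x \<triangleleft>\<^bsub>M\<^esub> s, y) - frag_of (x, s \<triangleright>\<^bsub>N\<^esub> y)) = \<zero>\<^bsub>TG\<^esub>"
      by (rule pr_zero) (use xy in \<open>auto simp: rels_def\<close>)
    then show "t (x \<triangleleft>\<^bsub>M\<^esub> s) y = t x (s \<triangleright>\<^bsub>N\<^esub> y)"
      using xy by (simp add: pr_diff t_pr[symmetric] TG.diff_simps)
  }
qed

lemma tens_gens: "{t x y | x y. x \<in> carrier M \<and> y \<in> carrier N} \<subseteq> carrier TG"
  by (auto simp: t_closed_TG)

lemma span_TG: "carrier TG \<subseteq> add_span TG {t x y | x y. x \<in> carrier M \<and> y \<in> carrier N}"
  (is "_ \<subseteq> add_span TG ?H")
proof -
  note sub = TG.subgroupD_add[OF TG.add_span_subgroup[OF tens_gens]]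
  have "pr u \<in> add_span TG ?H" if "Poly_Mapping.keys u \<subseteq> carrier M \<times> carrier N" for u
  proof (rule free_Abelian_group_induct[OF that])
    have "pr 0 = \<zero>\<^bsub>TG\<^esub>"
      using pr_diff[of 0 0] pr_closed[of 0] by (simp add: TG.diff_self)
    then show "pr 0 \<in> add_span TG ?H" using sub(2) by simp
  next
    show "pr (x - y) \<in> add_span TG ?H" if "Poly_Mapping.keys x \<subseteq> carrier M \<times> carrier N"
      "Poly_Mapping.keys y \<subseteq> carrier M \<times> carrier N" "pr x \<in> add_span TG ?H" "pr y \<in> add_span TG ?H" for x y
      using that sub(5) by (simp add: pr_diff)
  next
    show "pr (frag_of a) \<in> add_span TG ?H" if "a \<in> carrier M \<times> carrier N" for a
      using that by (cases a) (auto simp: t_pr[symmetric] intro!: TG.add_span_incl)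
  qed
  then show ?thesis by (auto simp: pr_surj)
qed

definition balanced :: "('p, 'w) ring_scheme \<Rightarrow> ('m \<Rightarrow> 'n \<Rightarrow> 'p) \<Rightarrow> bool" where
  "balanced P f \<longleftrightarrow>
     (\<forall>x\<in>carrier M. f x \<in> addhom N P) \<and>
     (\<forall>y\<in>carrier N. (\<lambda>x. f x y) \<in> addhom M P) \<and>
     (\<forall>x\<in>carrier M. \<forall>s\<in>carrier S. \<forall>y\<in>carrier N. f (x \<triangleleft>\<^bsub>M\<^esub> s) y = f x (s \<triangleright>\<^bsub>N\<^esub> y))"

lemma balancedI:
  assumes "\<And>x. x \<in> carrier M \<Longrightarrow> (\<lambda>y. f x y) \<in> addhom N P"
    and "\<And>y. y \<in> carrier N \<Longrightarrow> (\<lambda>x. f x y) \<in> addhom M P"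
    and "\<And>x s y. \<lbrakk>x \<in> carrier M; s \<in> carrier S; y \<in> carrier N\<rbrakk> \<Longrightarrow> f (x \<triangleleft>\<^bsub>M\<^esub> s) y = f x (s \<triangleright>\<^bsub>N\<^esub> y)"
  shows "balanced P f"
  using assms by (auto simp: balanced_def)

text \<open>A balanced map extends to the free abelian group, kills the relations and so factors
  through the quotient. The bare group \<open>TG\<close> comes first because the two actions on
  \<open>MN\<close> are themselves descriptions over \<open>TG\<close> and are available only once
  this is known.\<close>

lemma universal_TG:
  assumes P: "abelian_group P" and f: "balanced P f"
  shows "\<exists>k\<in>addhom TG P. \<forall>x\<in>carrier M. \<forall>y\<in>carrier N. k (t x y) = f x y"
proof -
  interpret P: abelian_group P by fact
  have fc: "f x y \<in> carrier P" if "x \<in> carrier M" "y \<in> carrier N" for x y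
    using f that unfolding balanced_def by (blast intro: addhom_closed)
  have fadd: "f (x \<oplus>\<^bsub>M\<^esub> x') y = f x y \<oplus>\<^bsub>P\<^esub> f x' y" if "x \<in> carrier M" "x' \<in> carrier M" "y \<in> carrier N" for x x' y
    using f that addhom_add[of "\<lambda>x. f x y" M P x x'] unfolding balanced_def by blast
  have fadd': "f x (y \<oplus>\<^bsub>N\<^esub> y') = f x y \<oplus>\<^bsub>P\<^esub> f x y'" if "x \<in> carrier M" "y \<in> carrier N" "y' \<in> carrier N" for x y y'
    using f that addhom_add[of "f x" N P y y'] unfolding balanced_def by blast
  obtain k where k: "k \<in> hom F (add_monoid P)"
    and kf: "\<And>z. z \<in> carrier M \<times> carrier N \<Longrightarrow> k (frag_of z) = case_prod f z"
  proof -
    have "case_prod f ` (carrier M \<times> carrier N) \<subseteq> carrier (add_monoid P)"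
      using fc by auto
    from comm_group.free_Abelian_group_universal[OF P.a_comm_group this] that show thesis
      by blast
  qed
  have kadd: "k (u + v) = k u \<oplus>\<^bsub>P\<^esub> k v" if "u \<in> carrier F" "v \<in> carrier F" for u v
    using hom_mult[OF k that] by simp
  have kc: "k u \<in> carrier P" if "u \<in> carrier F" for u
    using hom_in_carrier[OF k that] by simp
  have kdiff: "k (u - v) = k u \<ominus>\<^bsub>P\<^esub> k v" if "u \<in> carrier F" "v \<in> carrier F" for u v
    using kadd[of "u - v" v] F_diff[of u v] that kc[of u] kc[of v] kc[of "u - v"] by (simp add: P.eq_diff)
  have fr: "frag_of (x, y) \<in> carrier F" if "x \<in> carrier M" "y \<in> carrier N" for x y
    using that by simp
  have krel: "k u = \<zero>\<^bsub>P\<^esub>" if "u \<in> rels" for u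
  proof -
    note [simp del] = carrier_free_Abelian_group_iff
    show ?thesis
      using that unfolding rels_def
    proof (elim UnE CollectE exE conjE)
      fix x x' y assume u: "u = frag_of (x \<oplus>\<^bsub>M\<^esub> x', y) - frag_of (x, y) - frag_of (x', y)"
        "x \<in> carrier M" "x' \<in> carrier M" "y \<in> carrier N"
      then have "f (x \<oplus>\<^bsub>M\<^esub> x') y = f x y \<oplus>\<^bsub>P\<^esub> f x' y"
        by (intro fadd fadd')
      with u show ?thesis
        by (simp add: kdiff F_diff fr kf fc P.diff_simps)
    next
      fix x y y' assume u: "u = frag_of (x, y \<oplus>\<^bsub>N\<^esub> y') - frag_of (x, y) - frag_of (x, y')"
        "x \<in> carrier M" "y \<in> carrier N" "y' \<in> carrier N"
      then have "f x (y \<oplus>\<^bsub>N\<^esub> y') = f x y \<oplus>\<^bsub>P\<^esub> f x y'"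
        by (intro fadd fadd')
      with u show ?thesis
        by (simp add: kdiff F_diff fr kf fc P.diff_simps)
    next
      fix x s y assume u: "u = frag_of (x \<triangleleft>\<^bsub>M\<^esub> s, y) - frag_of (x, s \<triangleright>\<^bsub>N\<^esub> y)"
        "x \<in> carrier M" "s \<in> carrier S" "y \<in> carrier N"
      then have "f (x \<triangleleft>\<^bsub>M\<^esub> s) y = f x (s \<triangleright>\<^bsub>N\<^esub> y)"
        using f unfolding balanced_def by blast
      with u show ?thesis
        by (simp add: kdiff F_diff fr kf fc P.diff_simps)
    qed
  qed
  interpret k: group_hom F "add_monoid P" k
    by (simp add: group_hom_def group_hom_axioms_def P.a_group k)
  have "I \<subseteq> kernel F (add_monoid P) k"
    unfolding tensor_rels_eq
    by (rule group.generate_subgroup_incl[OF group_free_Abelian_group _ k.subgroup_kernel])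
      (use krel rels_sub in \<open>auto simp: kernel_def simp del: carrier_free_Abelian_group_iff\<close>)
  from k.FactGroup_universal_kernel[OF I_normal this]
  obtain g where g: "g \<in> hom (F Mod I) (add_monoid P)" "\<And>u. u \<in> carrier F \<Longrightarrow> g (I #>\<^bsub>F\<^esub> u) = k u"
    by blast
  have "g \<in> addhom TG P"
    using hom_in_carrier[OF g(1)] hom_mult[OF g(1)] by (simp add: addhom_iff TG_simps)
  then show ?thesis
    using g(2) kf by (intro bexI[of _ g]) (auto simp: tens_def)
qed

lemma addhom_TG: "addhom TG P = addhom MN P" "addhom Q TG = addhom Q MN"
  by (auto simp: addhom_iff MN_simps)

lemma tens_closed [simp]: "\<lbrakk>x \<in> carrier M; y \<in> carrier N\<rbrakk> \<Longrightarrow> t x y \<in> carrier MN"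
  by (simp add: MN_simps t_closed_TG)

lemma tens_addhom_left: "y \<in> carrier N \<Longrightarrow> (\<lambda>x. t x y) \<in> addhom M MN"
  by (auto simp: addhom_iff MN_simps t_closed_TG t_add_left_TG)

lemma tens_addhom_right: "x \<in> carrier M \<Longrightarrow> (\<lambda>y. t x y) \<in> addhom N MN"
  by (auto simp: addhom_iff MN_simps t_closed_TG t_add_right_TG)

lemma tens_balanced: "\<lbrakk>x \<in> carrier M; s \<in> carrier S; y \<in> carrier N\<rbrakk> \<Longrightarrow>
    t (x \<triangleleft>\<^bsub>M\<^esub> s) y = t x (s \<triangleright>\<^bsub>N\<^esub> y)"
  by (rule t_balanced_TG)

lemma tens_span: "carrier MN \<subseteq> add_span MN {t x y | x y. x \<in> carrier M \<and> y \<in> carrier N}" (is "_ \<subseteq> add_span MN ?H")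
proof -
  have H: "?H \<subseteq> carrier MN"
    by auto
  \<comment> \<open>An inverse is determined by carrier, addition and zero, and \<open>TG\<close>
    and \<open>MN\<close> share these three.\<close>
  have neg: "\<ominus>\<^bsub>MN\<^esub> x = \<ominus>\<^bsub>TG\<^esub> x" for x
    by (simp add: a_inv_def m_inv_def MN_simps)
  have "subgroup (add_span MN ?H) (add_monoid TG)"
    using MN.subgroupD_add[OF MN.add_span_subgroup[OF H]]
    by (intro TG.subgroupI_add) (simp_all add: MN_simps a_minus_def neg)
  moreover have "?H \<subseteq> add_span MN ?H"
    by (blast intro: MN.add_span_incl)
  ultimately have "carrier TG \<subseteq> add_span MN ?H"
    by (rule subset_trans[OF span_TG TG.add_span_least, rotated])
  then show ?thesis by (simp add: MN_simps)
qed

lemma tensor_hom: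
  assumes P: "abelian_group P" and f: "balanced P f"
  defines "h \<equiv> the_add_hom MN P (\<lambda>h. \<forall>x\<in>carrier M. \<forall>y\<in>carrier N. h (t x y) = f x y)"
  shows "h \<in> addhom MN P" and "\<And>x y. \<lbrakk>x \<in> carrier M; y \<in> carrier N\<rbrakk> \<Longrightarrow> h (t x y) = f x y"
proof -
  obtain k where k: "k \<in> addhom MN P" "\<forall>x\<in>carrier M. \<forall>y\<in>carrier N. k (t x y) = f x y"
    using universal_TG[OF P f] addhom_TG by blast
  note W = the_add_hom_works[where g = t and X = "carrier M" and Y = "carrier N",
      OF abelian_group_MN P tens_closed tens_span k(1) k(2)[rule_format], folded h_def]
  show "h \<in> addhom MN P" and "\<And>x y. \<lbrakk>x \<in> carrier M; y \<in> carrier N\<rbrakk> \<Longrightarrow> h (t x y) = f x y"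
    by (rule W; assumption)+
qed

text \<open>The actions of \<open>MN\<close> are described as additive endomaps of
  \<open>TG\<close>, so the universal property is needed with \<open>TG\<close> literally as source
  and target.\<close>

lemma tensor_hom_TG:
  assumes f: "balanced TG f"
  defines "h \<equiv> the_add_hom TG TG (\<lambda>h. \<forall>x\<in>carrier M. \<forall>y\<in>carrier N. h (t x y) = f x y)"
  shows "h \<in> addhom MN MN" and "\<And>x y. \<lbrakk>x \<in> carrier M; y \<in> carrier N\<rbrakk> \<Longrightarrow> h (t x y) = f x y"
proof -
  obtain k where k: "k \<in> addhom TG TG" "\<forall>x\<in>carrier M. \<forall>y\<in>carrier N. k (t x y) = f x y"
    using universal_TG[OF abelian_group_TG f] by blast
  note W = the_add_hom_works[where g = t and X = "carrier M" and Y = "carrier N",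
      OF abelian_group_TG abelian_group_TG t_closed_TG span_TG k(1) k(2)[rule_format], folded h_def,
      unfolded addhom_TG]
  show "h \<in> addhom MN MN" and "\<And>x y. \<lbrakk>x \<in> carrier M; y \<in> carrier N\<rbrakk> \<Longrightarrow> h (t x y) = f x y"
    by (rule W; assumption)+
qed

lemma tensor_eqI:
  assumes "abelian_group P" "f \<in> addhom MN P" "g \<in> addhom MN P"
    and "\<And>x y. \<lbrakk>x \<in> carrier M; y \<in> carrier N\<rbrakk> \<Longrightarrow> f (t x y) = g (t x y)"
  shows "\<forall>u\<in>carrier MN. f u = g u"
  by (rule addhom_eq_on_span[OF abelian_group_MN assms(1-3) tens_span]) (use assms(4) in auto)

lemma lact_works:
  assumes "l \<in> carrier L"
  shows "lact MN l \<in> addhom MN MN"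
    and "\<And>x y. \<lbrakk>x \<in> carrier M; y \<in> carrier N\<rbrakk> \<Longrightarrow> l \<triangleright>\<^bsub>MN\<^esub> t x y = t (l \<triangleright>\<^bsub>M\<^esub> x) y"
proof -
  have "balanced TG (\<lambda>x y. t (l \<triangleright>\<^bsub>M\<^esub> x) y)"
    unfolding balanced_def addhom_TG
    using assms by (auto simp: tens_balanced M.lact_ract[symmetric] intro: tens_addhom_right
        addhom_comp[OF tens_addhom_left M.lact_addhom])
  from tensor_hom_TG[OF this] show "lact MN l \<in> addhom MN MN"
    and "\<And>x y. \<lbrakk>x \<in> carrier M; y \<in> carrier N\<rbrakk> \<Longrightarrow> l \<triangleright>\<^bsub>MN\<^esub> t x y = t (l \<triangleright>\<^bsub>M\<^esub> x) y"
    by (simp_all add: tensor_def ring.defs bimodule.defs)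
qed

lemma ract_works:
  assumes "r \<in> carrier T"
  shows "(\<lambda>u. u \<triangleleft>\<^bsub>MN\<^esub> r) \<in> addhom MN MN"
    and "\<And>x y. \<lbrakk>x \<in> carrier M; y \<in> carrier N\<rbrakk> \<Longrightarrow> t x y \<triangleleft>\<^bsub>MN\<^esub> r = t x (y \<triangleleft>\<^bsub>N\<^esub> r)"
proof -
  have "balanced TG (\<lambda>x y. t x (y \<triangleleft>\<^bsub>N\<^esub> r))"
    unfolding balanced_def addhom_TG
    using assms by (auto simp: tens_balanced N.lact_ract intro: tens_addhom_left
        addhom_comp[OF tens_addhom_right N.ract_addhom])
  from tensor_hom_TG[OF this] show "(\<lambda>u. u \<triangleleft>\<^bsub>MN\<^esub> r) \<in> addhom MN MN"
    and "\<And>x y. \<lbrakk>x \<in> carrier M; y \<in> carrier N\<rbrakk> \<Longrightarrow> t x y \<triangleleft>\<^bsub>MN\<^esub> r = t x (y \<triangleleft>\<^bsub>N\<^esub> r)"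
    by (simp_all add: tensor_def ring.defs bimodule.defs)
qed

text \<open>Each axiom equates two additive maps of the tensor argument, so it is inherited, on
  elementary tensors, from the factor that carries the action.\<close>

lemma tensor_bimod: "bimod L MN T"
proof -
  note [simp] = lact_works ract_works addhom_closed[OF tens_addhom_left] addhom_closed[OF tens_addhom_right]
  note LR = lact_works(1) addhom_comp[OF lact_works(1)] ract_works(1) addhom_comp[OF ract_works(1)] addhom_id
    MN.addhom_plus
  have 1: "\<forall>m\<in>carrier MN. (s \<oplus>\<^bsub>L\<^esub> s') \<triangleright>\<^bsub>MN\<^esub> m = s \<triangleright>\<^bsub>MN\<^esub> m \<oplus>\<^bsub>MN\<^esub> s' \<triangleright>\<^bsub>MN\<^esub> m"
    if "s \<in> carrier L" "s' \<in> carrier L" for s s'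
    by (rule tensor_eqI[OF abelian_group_MN])
      (use that in \<open>auto intro!: LR simp: M.lact_add_left addhom_add[OF tens_addhom_left]\<close>)
  have 2: "\<forall>m\<in>carrier MN. m \<triangleleft>\<^bsub>MN\<^esub> (s \<oplus>\<^bsub>T\<^esub> s') = m \<triangleleft>\<^bsub>MN\<^esub> s \<oplus>\<^bsub>MN\<^esub> m \<triangleleft>\<^bsub>MN\<^esub> s'"
    if "s \<in> carrier T" "s' \<in> carrier T" for s s'
    by (rule tensor_eqI[OF abelian_group_MN])
      (use that in \<open>auto intro!: LR simp: N.ract_add_right addhom_add[OF tens_addhom_right]\<close>)
  have 3: "\<forall>m\<in>carrier MN. (s \<otimes>\<^bsub>L\<^esub> s') \<triangleright>\<^bsub>MN\<^esub> m = s \<triangleright>\<^bsub>MN\<^esub> s' \<triangleright>\<^bsub>MN\<^esub> m"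
    if "s \<in> carrier L" "s' \<in> carrier L" for s s'
    by (rule tensor_eqI[OF abelian_group_MN]) (use that in \<open>auto intro!: LR simp: M.lact_assoc\<close>)
  have 4: "\<forall>m\<in>carrier MN. m \<triangleleft>\<^bsub>MN\<^esub> (s \<otimes>\<^bsub>T\<^esub> s') = m \<triangleleft>\<^bsub>MN\<^esub> s \<triangleleft>\<^bsub>MN\<^esub> s'"
    if "s \<in> carrier T" "s' \<in> carrier T" for s s'
    by (rule tensor_eqI[OF abelian_group_MN]) (use that in \<open>auto intro!: LR simp: N.ract_assoc\<close>)
  have 5: "\<forall>m\<in>carrier MN. \<one>\<^bsub>L\<^esub> \<triangleright>\<^bsub>MN\<^esub> m = m" "\<forall>m\<in>carrier MN. m \<triangleleft>\<^bsub>MN\<^esub> \<one>\<^bsub>T\<^esub> = m"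
    by (rule tensor_eqI[OF abelian_group_MN]; auto intro!: LR)+
  have 6: "\<forall>m\<in>carrier MN. (s \<triangleright>\<^bsub>MN\<^esub> m) \<triangleleft>\<^bsub>MN\<^esub> s' = s \<triangleright>\<^bsub>MN\<^esub> (m \<triangleleft>\<^bsub>MN\<^esub> s')"
    if "s \<in> carrier L" "s' \<in> carrier T" for s s'
    by (rule tensor_eqI[OF abelian_group_MN]) (use that in \<open>auto intro!: LR\<close>)
  show ?thesis
    by unfold_locales
      (use 1 2 3 4 5 6 in \<open>auto simp: addhom_closed[OF lact_works(1)] addhom_closed[OF ract_works(1)]
        addhom_add[OF lact_works(1)] addhom_add[OF ract_works(1)]\<close>)
qed

end

section \<open>Rings as bimodules over other rings\<close>

lemma (in ring) self_bimod:
  assumes "ring S" "ring T" "f \<in> ring_hom S R" "g \<in> ring_hom T R"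
  shows "bimod S (self_bimodule R f g) T"
proof -
  interpret S: ring S by fact
  interpret T: ring T by fact
  have "abelian_group (self_bimodule R f g)"
    by (rule abelian_groupI) (auto simp: self_bimodule_def a_ac add.l_inv_ex)
  then interpret M: abelian_group "self_bimodule R f g" .
  show ?thesis
    using assms(3,4)
    by unfold_locales (auto simp: self_bimodule_def ring_hom_memE l_distr r_distr m_assoc)
qed

lemma self_bimodule_simps [simp]:
  "carrier (self_bimodule A f g) = carrier A"
  "x \<oplus>\<^bsub>self_bimodule A f g\<^esub> y = x \<oplus>\<^bsub>A\<^esub> y"
  "\<zero>\<^bsub>self_bimodule A f g\<^esub> = \<zero>\<^bsub>A\<^esub>"
  "s \<triangleright>\<^bsub>self_bimodule A f g\<^esub> x = f s \<otimes>\<^bsub>A\<^esub> x"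
  "x \<triangleleft>\<^bsub>self_bimodule A f g\<^esub> t = x \<otimes>\<^bsub>A\<^esub> g t"
  by (simp_all add: self_bimodule_def)

lemma self_bimodule_minus [simp]:
  "\<ominus>\<^bsub>self_bimodule A f g\<^esub> x = \<ominus>\<^bsub>A\<^esub> x"
  "x \<ominus>\<^bsub>self_bimodule A f g\<^esub> y = x \<ominus>\<^bsub>A\<^esub> y"
  by (simp_all add: a_minus_def a_inv_def m_inv_def)

lemma addhom_self_bimodule [simp]:
  "addhom (self_bimodule A f g) P = addhom A P" "addhom Q (self_bimodule A f g) = addhom Q A"
  by (auto simp: addhom_iff)

lemma ring_hom_ident: "(\<lambda>x. x) \<in> ring_hom S S"
  by (auto simp: ring_hom_def)

section \<open>Algebras over the field and their tensor square\<close>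

locale kalgebra = assoc_algebra K A for K :: "'k ring" and A :: "('k, 'a) module" (structure)
begin

abbreviation KL where "KL \<equiv> self_bimodule A (\<lambda>x. x) (scal A)"
abbreviation KR where "KR \<equiv> self_bimodule A (scal A) (\<lambda>x. x)"
abbreviation A2 where "A2 \<equiv> tensor2 K A"

lemma scal_closed [simp]: "c \<in> carrier K \<Longrightarrow> scal A c \<in> carrier A"
  by (simp add: scal_def)

lemma scal_mult: "\<lbrakk>c \<in> carrier K; x \<in> carrier A\<rbrakk> \<Longrightarrow> scal A c \<otimes> x = c \<odot> x"
  by (simp add: scal_def smult_mult_left)

lemma mult_scal: "\<lbrakk>c \<in> carrier K; x \<in> carrier A\<rbrakk> \<Longrightarrow> x \<otimes> scal A c = c \<odot> x"
  by (simp add: scal_def smult_mult_right)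

lemma scal_hom: "scal A \<in> ring_hom K A"
  by (rule ring_hom_memI) (simp_all add: scal_def smult_mult_left smult_assoc1 smult_l_distr)

lemma tensor_bimod_A2: "tensor_bimod A KL K KR A"
  unfolding tensor_bimod_def
  by (intro conjI self_bimod ring_hom_ident scal_hom) unfold_locales

lemma self_alg_bimod: "bimod A (self_bimodule A (\<lambda>x. x) (\<lambda>x. x)) A"
  by (intro self_bimod ring_hom_ident) unfold_locales

interpretation T2: tensor_bimod A KL K KR A
  by (rule tensor_bimod_A2)

lemma bimod_A2: "bimod A A2 A"
  unfolding tensor2_def by (rule T2.tensor_bimod)

lemma tns2_closed [simp]: "\<lbrakk>x \<in> carrier A; y \<in> carrier A\<rbrakk> \<Longrightarrow> tns2 K A x y \<in> carrier A2"
  unfolding tensor2_def tns2_def by (rule T2.tens_closed) simp_all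

lemma tns2_addhom_left: "y \<in> carrier A \<Longrightarrow> (\<lambda>x. tns2 K A x y) \<in> addhom A A2"
  using T2.tens_addhom_left[of y] by (simp add: tensor2_def tns2_def)

lemma tns2_addhom_right: "x \<in> carrier A \<Longrightarrow> (\<lambda>y. tns2 K A x y) \<in> addhom A A2"
  using T2.tens_addhom_right[of x] by (simp add: tensor2_def tns2_def)

lemma tns2_smult: "\<lbrakk>x \<in> carrier A; y \<in> carrier A; c \<in> carrier K\<rbrakk> \<Longrightarrow> tns2 K A (c \<odot> x) y = tns2 K A x (c \<odot> y)"
  using T2.tens_balanced[of x c y] by (simp add: tns2_def scal_mult mult_scal)

lemma tns2_lact: "\<lbrakk>a \<in> carrier A; x \<in> carrier A; y \<in> carrier A\<rbrakk> \<Longrightarrow>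
    a \<triangleright>\<^bsub>A2\<^esub> tns2 K A x y = tns2 K A (a \<otimes> x) y"
  using T2.lact_works(2)[of a x y] by (simp add: tensor2_def tns2_def)

lemma tns2_ract: "\<lbrakk>a \<in> carrier A; x \<in> carrier A; y \<in> carrier A\<rbrakk> \<Longrightarrow>
    tns2 K A x y \<triangleleft>\<^bsub>A2\<^esub> a = tns2 K A x (y \<otimes> a)"
  using T2.ract_works(2)[of a x y] by (simp add: tensor2_def tns2_def)

lemma A2_eqI:
  assumes "abelian_group P" "f \<in> addhom A2 P" "g \<in> addhom A2 P"
    and "\<And>x y. \<lbrakk>x \<in> carrier A; y \<in> carrier A\<rbrakk> \<Longrightarrow> f (tns2 K A x y) = g (tns2 K A x y)"
  shows "\<forall>u\<in>carrier A2. f u = g u"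
  using T2.tensor_eqI[of P f g] assms by (simp add: tensor2_def tns2_def)

lemma A2_into:
  assumes "abelian_group P" "f \<in> addhom A2 P" "subgroup B (add_monoid P)"
    and "\<And>x y. \<lbrakk>x \<in> carrier A; y \<in> carrier A\<rbrakk> \<Longrightarrow> f (tns2 K A x y) \<in> B" "u \<in> carrier A2"
  shows "f u \<in> B"
proof (rule addhom_span_into[OF _ assms(1-3)])
  show "abelian_group A2"
    unfolding tensor2_def by (rule T2.abelian_group_MN)
  show "u \<in> add_span A2 {tns2 K A x y | x y. x \<in> carrier A \<and> y \<in> carrier A}"
    using T2.tens_span assms(5) by (auto simp: tensor2_def tns2_def)
qed (use assms(4) in auto)

lemma A2_hom:
  assumes P: "abelian_group P"
    and "\<And>x. x \<in> carrier A \<Longrightarrow> (\<lambda>y. f x y) \<in> addhom A P"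
    and "\<And>y. y \<in> carrier A \<Longrightarrow> (\<lambda>x. f x y) \<in> addhom A P"
    and "\<And>x y c. \<lbrakk>x \<in> carrier A; y \<in> carrier A; c \<in> carrier K\<rbrakk> \<Longrightarrow> f (c \<odot> x) y = f x (c \<odot> y)"
  defines "h \<equiv> the_add_hom A2 P (\<lambda>h. \<forall>x\<in>carrier A. \<forall>y\<in>carrier A. h (tns2 K A x y) = f x y)"
  shows "h \<in> addhom A2 P" and "\<And>x y. \<lbrakk>x \<in> carrier A; y \<in> carrier A\<rbrakk> \<Longrightarrow> h (tns2 K A x y) = f x y"
proof -
  have "T2.balanced P f"
    by (rule T2.balancedI) (use assms in \<open>simp_all add: scal_mult mult_scal\<close>)
  from T2.tensor_hom[OF P this]
  show "h \<in> addhom A2 P" and "\<And>x y. \<lbrakk>x \<in> carrier A; y \<in> carrier A\<rbrakk> \<Longrightarrow> h (tns2 K A x y) = f x y"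
    by (simp_all add: h_def tensor2_def tns2_def)
qed

text \<open>On x \<otimes> y the scalar passes across the tensor sign, so its two outer actions
  agree.\<close>

lemma A2_central: "c \<in> carrier K \<Longrightarrow> \<forall>u\<in>carrier A2. scal A c \<triangleright>\<^bsub>A2\<^esub> u = u \<triangleleft>\<^bsub>A2\<^esub> scal A c"
proof -
  assume c: "c \<in> carrier K"
  interpret A2: bimod A A2 A by (rule bimod_A2)
  show ?thesis
    by (rule A2_eqI[OF A2.abelian_group])
      (use c in \<open>auto intro: A2.lact_addhom A2.ract_addhom simp: tns2_lact tns2_ract scal_mult mult_scal tns2_smult\<close>)
qed

end

text \<open>Scalars acting alike on both sides is what makes y m x balanced over K in x and y, so
  that m can be sandwiched by an element of the tensor square of A. The instances are A, its tensor
  square and the one-forms.\<close>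

locale central_bimod = kalgebra K A + bimod A M A
  for K :: "'k ring" and A :: "('k, 'a) module" and M :: "('a, 'm, 'a) bimodule" (structure) +
  assumes central: "\<lbrakk>c \<in> carrier K; m \<in> carrier M\<rbrakk> \<Longrightarrow> scal A c \<triangleright> m = m \<triangleleft> scal A c"

lemma (in kalgebra) central_A2: "central_bimod K A A2"
proof -
  interpret bimod A A2 A by (rule bimod_A2)
  show ?thesis by unfold_locales (use A2_central in auto)
qed

lemma (in kalgebra) central_self: "central_bimod K A (self_bimodule A (\<lambda>x. x) (\<lambda>x. x))"
proof -
  interpret B: bimod A "self_bimodule A (\<lambda>x. x) (\<lambda>x. x)" A by (rule self_alg_bimod)
  show ?thesis by unfold_locales (auto simp: scal_mult mult_scal)
qed

section \<open>Relative one-forms over \<open>R\<close>\<close>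

locale nc_forms = algebra_over_data K R A \<eta> + R: kalgebra K R + kalgebra K A
  for K :: "'k ring" and R :: "('k, 'r) module" and A :: "('k, 'a) module" (structure) and \<eta> :: "'r \<Rightarrow> 'a" +
  assumes eta_hom: "\<eta> \<in> ring_hom R A"
    and eta_smult: "\<lbrakk>c \<in> carrier K; r \<in> carrier R\<rbrakk> \<Longrightarrow> \<eta> (c \<odot>\<^bsub>R\<^esub> r) = c \<odot> \<eta> r"
begin

lemma eta_simps [simp]:
  "r \<in> carrier R \<Longrightarrow> \<eta> r \<in> carrier A"
  "\<eta> \<one>\<^bsub>R\<^esub> = \<one>"
  "\<lbrakk>r \<in> carrier R; s \<in> carrier R\<rbrakk> \<Longrightarrow> \<eta> (r \<otimes>\<^bsub>R\<^esub> s) = \<eta> r \<otimes> \<eta> s"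
  "\<lbrakk>r \<in> carrier R; s \<in> carrier R\<rbrakk> \<Longrightarrow> \<eta> (r \<oplus>\<^bsub>R\<^esub> s) = \<eta> r \<oplus> \<eta> s"
  using eta_hom by (auto dest: ring_hom_memE)

lemma eta_scal: "c \<in> carrier K \<Longrightarrow> \<eta> (scal R c) = scal A c"
  by (simp add: scal_def eta_smult)

abbreviation AS where "AS \<equiv> self_bimodule A (\<lambda>x. x) (\<lambda>x. x)"
abbreviation AL where "AL \<equiv> self_bimodule A (\<lambda>x. x) \<eta>"
abbreviation AR where "AR \<equiv> self_bimodule A \<eta> (\<lambda>x. x)"

lemma tensor_bimod_AtR: "tensor_bimod A AL R AR A"
  unfolding tensor_bimod_def
  by (intro conjI self_bimod ring_hom_ident eta_hom) unfold_locales

sublocale AtR: tensor_bimod A AL R AR A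
  by (rule tensor_bimod_AtR)

sublocale AtR: bimod A AtR A
  by (rule AtR.tensor_bimod)

sublocale AA: bimod A AA A
  by (rule bimod_A2)

sublocale AA: central_bimod K A AA
  by (rule central_A2)

sublocale AS: central_bimod K A AS
  by (rule central_self)

lemma multR_props: "multR \<in> addhom AtR A" "\<lbrakk>x \<in> carrier A; y \<in> carrier A\<rbrakk> \<Longrightarrow> multR (tnsR x y) = x \<otimes> y"
proof -
  have "AtR.balanced A (\<lambda>x y. x \<otimes> y)"
    by (rule AtR.balancedI) (auto intro!: addhomI simp: l_distr r_distr m_assoc)
  from AtR.tensor_hom[OF is_abelian_group this]
  show "multR \<in> addhom AtR A" "\<lbrakk>x \<in> carrier A; y \<in> carrier A\<rbrakk> \<Longrightarrow> multR (tnsR x y) = x \<otimes> y"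
    by (simp_all add: multR_def)
qed


lemma tnsR_add_left: "\<lbrakk>x \<in> carrier A; x' \<in> carrier A; y \<in> carrier A\<rbrakk> \<Longrightarrow>
    tnsR (x \<oplus> x') y = tnsR x y \<oplus>\<^bsub>AtR\<^esub> tnsR x' y"
  using addhom_add[OF AtR.tens_addhom_left, of y x x'] by simp

lemma tnsR_add_right: "\<lbrakk>x \<in> carrier A; y \<in> carrier A; y' \<in> carrier A\<rbrakk> \<Longrightarrow>
    tnsR x (y \<oplus> y') = tnsR x y \<oplus>\<^bsub>AtR\<^esub> tnsR x y'"
  using addhom_add[OF AtR.tens_addhom_right, of x y y'] by simp

lemma tnsR_balanced: "\<lbrakk>x \<in> carrier A; r \<in> carrier R; y \<in> carrier A\<rbrakk> \<Longrightarrow>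
    tnsR (x \<otimes> \<eta> r) y = tnsR x (\<eta> r \<otimes> y)"
  using AtR.tens_balanced[of x r y] by simp

lemma tnsR_closed [simp]: "\<lbrakk>x \<in> carrier A; y \<in> carrier A\<rbrakk> \<Longrightarrow> tnsR x y \<in> carrier AtR"
  using AtR.tens_closed[of x y] by simp

lemma tnsR_lact: "\<lbrakk>a \<in> carrier A; x \<in> carrier A; y \<in> carrier A\<rbrakk> \<Longrightarrow>
    a \<triangleright>\<^bsub>AtR\<^esub> tnsR x y = tnsR (a \<otimes> x) y"
  using AtR.lact_works(2)[of a x y] by simp

lemma tnsR_ract: "\<lbrakk>a \<in> carrier A; x \<in> carrier A; y \<in> carrier A\<rbrakk> \<Longrightarrow>
    tnsR x y \<triangleleft>\<^bsub>AtR\<^esub> a = tnsR x (y \<otimes> a)"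
  using AtR.ract_works(2)[of a x y] by simp

lemma AtR_eqI:
  assumes "abelian_group P" "f \<in> addhom AtR P" "g \<in> addhom AtR P"
    and "\<And>x y. \<lbrakk>x \<in> carrier A; y \<in> carrier A\<rbrakk> \<Longrightarrow> f (tnsR x y) = g (tnsR x y)"
  shows "\<forall>u\<in>carrier AtR. f u = g u"
  using AtR.tensor_eqI[of P f g] assms by simp

lemma multR_lact: "\<lbrakk>a \<in> carrier A; u \<in> carrier AtR\<rbrakk> \<Longrightarrow> multR (a \<triangleright>\<^bsub>AtR\<^esub> u) = a \<otimes> multR u"
proof -
  assume a: "a \<in> carrier A" and u: "u \<in> carrier AtR"
  have "\<forall>u\<in>carrier AtR. multR (a \<triangleright>\<^bsub>AtR\<^esub> u) = a \<otimes> multR u"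
    by (rule AtR_eqI[OF is_abelian_group])
      (use a AS.addhom_lact[of a multR AtR] in
        \<open>auto simp: multR_props tnsR_lact m_assoc intro: addhom_comp[OF multR_props(1) AtR.lact_addhom]\<close>)
  with u show ?thesis by blast
qed

lemma multR_ract: "\<lbrakk>a \<in> carrier A; u \<in> carrier AtR\<rbrakk> \<Longrightarrow> multR (u \<triangleleft>\<^bsub>AtR\<^esub> a) = multR u \<otimes> a"
proof -
  assume a: "a \<in> carrier A" and u: "u \<in> carrier AtR"
  have "\<forall>u\<in>carrier AtR. multR (u \<triangleleft>\<^bsub>AtR\<^esub> a) = multR u \<otimes> a"
    by (rule AtR_eqI[OF is_abelian_group])
      (use a AS.addhom_ract[of a multR AtR] in
        \<open>auto simp: multR_props tnsR_ract m_assoc intro: addhom_comp[OF multR_props(1) AtR.ract_addhom]\<close>)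
  with u show ?thesis by blast
qed

lemma Omega1_simps:
  "u \<in> carrier Omega1 \<longleftrightarrow> u \<in> carrier AtR \<and> multR u = \<zero>"
  "u \<oplus>\<^bsub>Omega1\<^esub> v = u \<oplus>\<^bsub>AtR\<^esub> v" "\<zero>\<^bsub>Omega1\<^esub> = \<zero>\<^bsub>AtR\<^esub>"
  "a \<triangleright>\<^bsub>Omega1\<^esub> u = a \<triangleright>\<^bsub>AtR\<^esub> u" "u \<triangleleft>\<^bsub>Omega1\<^esub> a = u \<triangleleft>\<^bsub>AtR\<^esub> a"
  by (auto simp: Omega1_def)

lemma multR_hom [simp]:
  "u \<in> carrier AtR \<Longrightarrow> multR u \<in> carrier A"
  "\<lbrakk>u \<in> carrier AtR; v \<in> carrier AtR\<rbrakk> \<Longrightarrow> multR (u \<oplus>\<^bsub>AtR\<^esub> v) = multR u \<oplus> multR v"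
  "\<lbrakk>u \<in> carrier AtR; v \<in> carrier AtR\<rbrakk> \<Longrightarrow> multR (u \<ominus>\<^bsub>AtR\<^esub> v) = multR u \<ominus> multR v"
  "u \<in> carrier AtR \<Longrightarrow> multR (\<ominus>\<^bsub>AtR\<^esub> u) = \<ominus> multR u"
  "multR \<zero>\<^bsub>AtR\<^esub> = \<zero>"
  by (simp_all add: addhom_closed[OF multR_props(1)] addhom_add[OF multR_props(1)]
      addhom_minus[OF multR_props(1) AtR.abelian_group is_abelian_group]
      addhom_inv[OF multR_props(1) AtR.abelian_group is_abelian_group]
      addhom_zero[OF multR_props(1) AtR.abelian_group is_abelian_group])

lemma abelian_group_Omega1: "abelian_group Omega1"
proof (rule abelian_groupI)
  show "\<exists>y\<in>carrier Omega1. y \<oplus>\<^bsub>Omega1\<^esub> x = \<zero>\<^bsub>Omega1\<^esub>" if "x \<in> carrier Omega1" for x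
    using that by (intro bexI[of _ "\<ominus>\<^bsub>AtR\<^esub> x"]) (auto simp: Omega1_simps AtR.l_neg)
qed (auto simp: Omega1_simps AtR.a_ac)

lemma bimod_Omega1: "bimod A Omega1 A"
proof -
  interpret O: abelian_group Omega1 by (rule abelian_group_Omega1)
  show ?thesis
    by unfold_locales (auto simp: Omega1_simps multR_lact multR_ract AtR.act_simps)
qed

sublocale O1: bimod A Omega1 A
  by (rule bimod_Omega1)

text \<open>Inverses are described relative to the carrier, so passing from \<open>AtR\<close> to
  the smaller carrier of \<open>Omega1\<close> has to be justified.\<close>

lemma Omega1_minus: "u \<in> carrier Omega1 \<Longrightarrow> \<ominus>\<^bsub>Omega1\<^esub> u = \<ominus>\<^bsub>AtR\<^esub> u"
  by (rule O1.minus_equality) (auto simp: Omega1_simps AtR.l_neg)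

lemma Omega1_diff: "\<lbrakk>u \<in> carrier Omega1; v \<in> carrier Omega1\<rbrakk> \<Longrightarrow> u \<ominus>\<^bsub>Omega1\<^esub> v = u \<ominus>\<^bsub>AtR\<^esub> v"
  by (simp add: a_minus_def Omega1_simps(2) Omega1_minus)

lemma d0_closed [simp]: "a \<in> carrier A \<Longrightarrow> d0 a \<in> carrier Omega1"
  by (simp add: Omega1_simps d0_def multR_props diff_self)

lemma d0_addhom: "d0 \<in> addhom A Omega1"
proof (rule addhomI)
  show "d0 (x \<oplus> y) = d0 x \<oplus>\<^bsub>Omega1\<^esub> d0 y" if "x \<in> carrier A" "y \<in> carrier A" for x y
    using that by (simp add: Omega1_simps d0_def tnsR_add_left tnsR_add_right AtR.diff_simps)
qed simp

lemma d0_mult: "\<lbrakk>x \<in> carrier A; y \<in> carrier A\<rbrakk> \<Longrightarrow>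
    d0 (x \<otimes> y) = x \<triangleright>\<^bsub>Omega1\<^esub> d0 y \<oplus>\<^bsub>Omega1\<^esub> d0 x \<triangleleft>\<^bsub>Omega1\<^esub> y"
  by (simp add: Omega1_simps d0_def AtR.act_simps tnsR_lact tnsR_ract AtR.diff_simps)

lemma d0_eta [simp]: "r \<in> carrier R \<Longrightarrow> d0 (\<eta> r) = \<zero>\<^bsub>Omega1\<^esub>"
  using tnsR_balanced[of \<one> r \<one>] by (simp add: Omega1_simps d0_def AtR.diff_self)

lemma d0_one [simp]: "d0 \<one> = \<zero>\<^bsub>Omega1\<^esub>"
  using d0_eta[of "\<one>\<^bsub>R\<^esub>"] by simp

lemma udv: "\<lbrakk>u \<in> carrier A; v \<in> carrier A\<rbrakk> \<Longrightarrow>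
    u \<triangleright>\<^bsub>Omega1\<^esub> d0 v = tnsR (u \<otimes> v) \<one> \<ominus>\<^bsub>AtR\<^esub> tnsR u v"
  by (simp add: Omega1_simps d0_def AtR.act_simps tnsR_lact)

abbreviation udv_set where "udv_set \<equiv> {u \<triangleright>\<^bsub>Omega1\<^esub> d0 v | u v. u \<in> carrier A \<and> v \<in> carrier A}"

lemma udv_set_sub: "udv_set \<subseteq> carrier Omega1"
  by auto

text \<open>The map sending w to \<open>multR w\<close> \<otimes> 1 - w takes x \<otimes> y to x dy,
  so it maps everything into the span of the forms u dv; on the kernel of multiplication it is just
  -w.\<close>

lemma Omega1_span: "carrier Omega1 \<subseteq> add_span Omega1 udv_set"
proof
  fix w assume w: "w \<in> carrier Omega1"
  let ?B = "add_span Omega1 udv_set"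
  note B = O1.subgroupD_add[OF O1.add_span_subgroup[OF udv_set_sub]]
  have sub: "subgroup ?B (add_monoid AtR)"
  proof (rule AtR.subgroupI_add)
    show "x \<ominus>\<^bsub>AtR\<^esub> y \<in> ?B" if "x \<in> ?B" "y \<in> ?B" for x y
      using B(5)[OF that] Omega1_diff[of x y] subsetD[OF B(1) that(1)] subsetD[OF B(1) that(2)] by simp
  qed (use B in \<open>auto simp: Omega1_simps\<close>)
  let ?f = "\<lambda>u. tnsR (multR u) \<one> \<ominus>\<^bsub>AtR\<^esub> u"
  have f: "?f \<in> addhom AtR AtR"
    using AtR.tens_addhom_left[of \<one>]
    by (intro AtR.addhom_diff addhom_id addhom_comp[OF _ multR_props(1)]) simp
  have "?f w \<in> ?B"
  proof (rule addhom_span_into[where f = ?f, OF AtR.abelian_group AtR.abelian_group f sub])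
    show "w \<in> add_span AtR {tnsR x y |x y. x \<in> carrier AL \<and> y \<in> carrier AR}"
      using AtR.tens_span w Omega1_simps(1) by blast
  qed (auto simp: multR_props udv[symmetric] intro!: O1.add_span_incl, blast)
  moreover have "tnsR \<zero> \<one> = \<zero>\<^bsub>AtR\<^esub>"
    using addhom_zero[OF AtR.tens_addhom_left AtR.M.abelian_group AtR.abelian_group, of \<one>] by simp
  ultimately have "\<zero>\<^bsub>AtR\<^esub> \<ominus>\<^bsub>AtR\<^esub> w \<in> ?B"
    using w by (simp add: Omega1_simps)
  then have "\<ominus>\<^bsub>Omega1\<^esub> w \<in> ?B"
    using w by (simp add: Omega1_minus a_minus_def) (simp add: Omega1_simps)
  from B(4)[OF this] show "w \<in> ?B"
    using w by simp
qed

lemma Omega1_eqI: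
  assumes "abelian_group P" "f \<in> addhom Omega1 P" "g \<in> addhom Omega1 P"
    and "\<And>u v. \<lbrakk>u \<in> carrier A; v \<in> carrier A\<rbrakk> \<Longrightarrow> f (u \<triangleright>\<^bsub>Omega1\<^esub> d0 v) = g (u \<triangleright>\<^bsub>Omega1\<^esub> d0 v)"
  shows "\<forall>\<alpha>\<in>carrier Omega1. f \<alpha> = g \<alpha>"
  by (rule addhom_eq_on_span[OF O1.abelian_group assms(1-3) Omega1_span udv_set_sub]) (use assms(4) in auto)

text \<open>Since u dv = uv \<otimes> 1 - u \<otimes> v, a balanced f with f(u, 1) = 0 is recovered
  on one-forms as the negative of its extension to the tensor product over R. The condition at v = 1
  reflects d(1) = 0.\<close>

lemma Omega1_hom:
  assumes P: "abelian_group P"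
    and "\<And>u. u \<in> carrier A \<Longrightarrow> (\<lambda>v. f u v) \<in> addhom A P"
    and "\<And>v. v \<in> carrier A \<Longrightarrow> (\<lambda>u. f u v) \<in> addhom A P"
    and "\<And>u v r. \<lbrakk>u \<in> carrier A; v \<in> carrier A; r \<in> carrier R\<rbrakk> \<Longrightarrow> f (u \<otimes> \<eta> r) v = f u (\<eta> r \<otimes> v)"
    and "\<And>u. u \<in> carrier A \<Longrightarrow> f u \<one> = \<zero>\<^bsub>P\<^esub>"
  defines "h \<equiv> the_add_hom Omega1 P (\<lambda>h. \<forall>u\<in>carrier A. \<forall>v\<in>carrier A. h (u \<triangleright>\<^bsub>Omega1\<^esub> d0 v) = f u v)"
  shows "h \<in> addhom Omega1 P" and "\<And>u v. \<lbrakk>u \<in> carrier A; v \<in> carrier A\<rbrakk> \<Longrightarrow> h (u \<triangleright>\<^bsub>Omega1\<^esub> d0 v) = f u v"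
proof -
  interpret P: abelian_group P by fact
  have "AtR.balanced P f"
    by (rule AtR.balancedI) (use assms in simp_all)
  note k = AtR.tensor_hom[OF P this]
  define k where "k = the_add_hom AtR P (\<lambda>h. \<forall>x\<in>carrier AL. \<forall>y\<in>carrier AR. h (tnsR x y) = f x y)"
  note k = k[folded k_def]
  have k': "(\<lambda>u. \<ominus>\<^bsub>P\<^esub> k u) \<in> addhom Omega1 P"
    using P.addhom_neg[OF k(1)] by (auto simp: addhom_iff Omega1_simps)
  have fc: "f x y \<in> carrier P" if "x \<in> carrier A" "y \<in> carrier A" for x y
    using addhom_closed[OF assms(2)] that by blast
  have "\<ominus>\<^bsub>P\<^esub> k (u \<triangleright>\<^bsub>Omega1\<^esub> d0 v) = f u v" if "u \<in> carrier A" "v \<in> carrier A" for u v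
    using that k(2)[of u v] k(2)[of "u \<otimes> v" \<one>] fc[OF that] assms(5)
    by (simp add: udv addhom_minus[OF k(1) AtR.abelian_group P] P.diff_simps)
  note W = the_add_hom_works[where g = "\<lambda>u v. u \<triangleright>\<^bsub>Omega1\<^esub> d0 v" and X = "carrier A" and Y = "carrier A",
      OF O1.abelian_group P _ Omega1_span k' this, folded h_def]
  show "h \<in> addhom Omega1 P" and "\<And>u v. \<lbrakk>u \<in> carrier A; v \<in> carrier A\<rbrakk> \<Longrightarrow> h (u \<triangleright>\<^bsub>Omega1\<^esub> d0 v) = f u v"
    by (rule W; simp)+
qed

sublocale O1: central_bimod K A Omega1
proof
  fix c m assume c: "c \<in> carrier K" and m: "m \<in> carrier Omega1"
  \<comment> \<open>The scalar c1 of A is the image of the scalar c1 of R, so it moves across the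
    tensor sign over R.\<close>
  have "\<forall>u\<in>carrier AtR. scal A c \<triangleright>\<^bsub>AtR\<^esub> u = u \<triangleleft>\<^bsub>AtR\<^esub> scal A c"
  proof (rule AtR_eqI[OF AtR.abelian_group])
    show "scal A c \<triangleright>\<^bsub>AtR\<^esub> tnsR x y = tnsR x y \<triangleleft>\<^bsub>AtR\<^esub> scal A c" if "x \<in> carrier A" "y \<in> carrier A" for x y
      using tnsR_balanced[of x "scal R c" y] that c
      by (simp add: tnsR_lact tnsR_ract eta_scal scal_mult mult_scal)
  qed (use c in \<open>auto intro: AtR.lact_addhom AtR.ract_addhom\<close>)
  then show "scal A c \<triangleright>\<^bsub>Omega1\<^esub> m = m \<triangleleft>\<^bsub>Omega1\<^esub> scal A c"
    using m by (simp add: Omega1_simps)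
qed

subsection \<open>Derivations into bimodules\<close>

definition deriv :: "('a, 'm, 'a) bimodule \<Rightarrow> ('a \<Rightarrow> 'm) \<Rightarrow> bool" where
  "deriv M D \<longleftrightarrow> D \<in> addhom A M \<and>
     (\<forall>x\<in>carrier A. \<forall>y\<in>carrier A. D (x \<otimes> y) = (x \<triangleright>\<^bsub>M\<^esub> D y) \<oplus>\<^bsub>M\<^esub> (D x \<triangleleft>\<^bsub>M\<^esub> y)) \<and>
     (\<forall>r\<in>carrier R. D (\<eta> r) = \<zero>\<^bsub>M\<^esub>)"

text \<open>The bimodule map on one-forms that corresponds to D under the universal property of d.
  With M the tensor square of A it is the contraction \<open>i1\<close>, with M = A it is the
  contraction \<open>j1\<close> by a derivation of A.\<close>

definition ext_deriv :: "('a, 'm, 'a) bimodule \<Rightarrow> ('a \<Rightarrow> 'm) \<Rightarrow> ('a \<times> 'a) frag set \<Rightarrow> 'm" where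
  "ext_deriv M D = the_add_hom Omega1 M
     (\<lambda>h. \<forall>u\<in>carrier A. \<forall>v\<in>carrier A. h (u \<triangleright>\<^bsub>Omega1\<^esub> d0 v) = u \<triangleright>\<^bsub>M\<^esub> D v)"

lemma derivD:
  assumes "deriv M D"
  shows "D \<in> addhom A M" "\<And>x. x \<in> carrier A \<Longrightarrow> D x \<in> carrier M"
    "\<And>x y. \<lbrakk>x \<in> carrier A; y \<in> carrier A\<rbrakk> \<Longrightarrow> D (x \<oplus> y) = D x \<oplus>\<^bsub>M\<^esub> D y"
    "\<And>x y. \<lbrakk>x \<in> carrier A; y \<in> carrier A\<rbrakk> \<Longrightarrow> D (x \<otimes> y) = (x \<triangleright>\<^bsub>M\<^esub> D y) \<oplus>\<^bsub>M\<^esub> (D x \<triangleleft>\<^bsub>M\<^esub> y)"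
    "\<And>r. r \<in> carrier R \<Longrightarrow> D (\<eta> r) = \<zero>\<^bsub>M\<^esub>"
  using assms by (auto simp: deriv_def addhom_iff)

context
  fixes M :: "('a, 'm, 'a) bimodule" and D
  assumes M: "bimod A M A" and D: "deriv M D"
begin

interpretation M: bimod A M A by (rule M)

lemma ext_deriv_props:
  shows "ext_deriv M D \<in> addhom Omega1 M"
    and "\<And>u v. \<lbrakk>u \<in> carrier A; v \<in> carrier A\<rbrakk> \<Longrightarrow> ext_deriv M D (u \<triangleright>\<^bsub>Omega1\<^esub> d0 v) = u \<triangleright>\<^bsub>M\<^esub> D v"
proof -
  note Dp = derivD[OF D]
  have one: "D \<one> = \<zero>\<^bsub>M\<^esub>"
    using Dp(5)[of "\<one>\<^bsub>R\<^esub>"] by simp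
  have "\<And>u. u \<in> carrier A \<Longrightarrow> (\<lambda>v. u \<triangleright>\<^bsub>M\<^esub> D v) \<in> addhom A M"
    and "\<And>v. v \<in> carrier A \<Longrightarrow> (\<lambda>u. u \<triangleright>\<^bsub>M\<^esub> D v) \<in> addhom A M"
    and "\<And>u v r. \<lbrakk>u \<in> carrier A; v \<in> carrier A; r \<in> carrier R\<rbrakk> \<Longrightarrow> (u \<otimes> \<eta> r) \<triangleright>\<^bsub>M\<^esub> D v = u \<triangleright>\<^bsub>M\<^esub> D (\<eta> r \<otimes> v)"
    and "\<And>u. u \<in> carrier A \<Longrightarrow> u \<triangleright>\<^bsub>M\<^esub> D \<one> = \<zero>\<^bsub>M\<^esub>"
    using Dp one by (auto intro: M.addhom_lact M.lact_addhom_left simp: M.act_simps)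
  from Omega1_hom[OF M.abelian_group this]
  show "ext_deriv M D \<in> addhom Omega1 M"
    and "\<And>u v. \<lbrakk>u \<in> carrier A; v \<in> carrier A\<rbrakk> \<Longrightarrow> ext_deriv M D (u \<triangleright>\<^bsub>Omega1\<^esub> d0 v) = u \<triangleright>\<^bsub>M\<^esub> D v"
    by (simp_all add: ext_deriv_def)
qed

lemma ext_deriv_closed: "\<alpha> \<in> carrier Omega1 \<Longrightarrow> ext_deriv M D \<alpha> \<in> carrier M"
  by (rule addhom_closed[OF ext_deriv_props(1)])

lemma ext_deriv_d0: "a \<in> carrier A \<Longrightarrow> ext_deriv M D (d0 a) = D a"
  using ext_deriv_props(2)[of \<one> a] derivD(2)[OF D] by simp

lemma ext_deriv_lact: "\<lbrakk>a \<in> carrier A; \<alpha> \<in> carrier Omega1\<rbrakk> \<Longrightarrow>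
    ext_deriv M D (a \<triangleright>\<^bsub>Omega1\<^esub> \<alpha>) = a \<triangleright>\<^bsub>M\<^esub> ext_deriv M D \<alpha>"
proof -
  assume a: "a \<in> carrier A" and \<alpha>: "\<alpha> \<in> carrier Omega1"
  have "\<forall>\<alpha>\<in>carrier Omega1. ext_deriv M D (a \<triangleright>\<^bsub>Omega1\<^esub> \<alpha>) = a \<triangleright>\<^bsub>M\<^esub> ext_deriv M D \<alpha>"
  proof (rule Omega1_eqI[OF M.abelian_group])
    show "ext_deriv M D (a \<triangleright>\<^bsub>Omega1\<^esub> u \<triangleright>\<^bsub>Omega1\<^esub> d0 v) = a \<triangleright>\<^bsub>M\<^esub> ext_deriv M D (u \<triangleright>\<^bsub>Omega1\<^esub> d0 v)"
      if "u \<in> carrier A" "v \<in> carrier A" for u v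
      using that a derivD(2)[OF D] by (simp add: O1.lact_assoc[symmetric] ext_deriv_props(2) M.lact_assoc)
  qed (use a in \<open>auto intro: addhom_comp[OF ext_deriv_props(1) O1.lact_addhom] M.addhom_lact ext_deriv_props(1)\<close>)
  with \<alpha> show ?thesis by blast
qed

text \<open>Left linearity is immediate from the formula on u dv; right linearity is where the
  Leibniz rule of D enters, through (u dv) a = u d(va) - uv da.\<close>

lemma ext_deriv_ract: "\<lbrakk>a \<in> carrier A; \<alpha> \<in> carrier Omega1\<rbrakk> \<Longrightarrow>
    ext_deriv M D (\<alpha> \<triangleleft>\<^bsub>Omega1\<^esub> a) = ext_deriv M D \<alpha> \<triangleleft>\<^bsub>M\<^esub> a"
proof -
  assume a: "a \<in> carrier A" and \<alpha>: "\<alpha> \<in> carrier Omega1"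
  have "\<forall>\<alpha>\<in>carrier Omega1. ext_deriv M D (\<alpha> \<triangleleft>\<^bsub>Omega1\<^esub> a) = ext_deriv M D \<alpha> \<triangleleft>\<^bsub>M\<^esub> a"
  proof (rule Omega1_eqI[OF M.abelian_group])
    show "ext_deriv M D ((u \<triangleright>\<^bsub>Omega1\<^esub> d0 v) \<triangleleft>\<^bsub>Omega1\<^esub> a) = ext_deriv M D (u \<triangleright>\<^bsub>Omega1\<^esub> d0 v) \<triangleleft>\<^bsub>M\<^esub> a"
      if uv: "u \<in> carrier A" "v \<in> carrier A" for u v
    proof -
      have "(u \<triangleright>\<^bsub>Omega1\<^esub> d0 v) \<triangleleft>\<^bsub>Omega1\<^esub> a = u \<triangleright>\<^bsub>Omega1\<^esub> d0 (v \<otimes> a) \<ominus>\<^bsub>Omega1\<^esub> (u \<otimes> v) \<triangleright>\<^bsub>Omega1\<^esub> d0 a"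
        using uv a by (simp add: d0_mult O1.act_simps O1.diff_simps)
      then show ?thesis
        using uv a derivD[OF D]
        by (simp add: addhom_minus[OF ext_deriv_props(1) O1.abelian_group M.abelian_group]
            ext_deriv_props(2) M.act_simps M.diff_simps)
    qed
  qed (use a in \<open>auto intro: addhom_comp[OF ext_deriv_props(1) O1.ract_addhom] M.addhom_ract ext_deriv_props(1)\<close>)
  with \<alpha> show ?thesis by blast
qed

end

end

section \<open>Contractions\<close>

context kalgebra
begin

interpretation A2: bimod A A2 A by (rule bimod_A2)

lemma mult2_props:
  shows "mult2 K A \<in> addhom A2 A"
    and "\<And>x y. \<lbrakk>x \<in> carrier A; y \<in> carrier A\<rbrakk> \<Longrightarrow> mult2 K A (tns2 K A x y) = x \<otimes> y"
proof -
  have "\<And>x. x \<in> carrier A \<Longrightarrow> (\<lambda>y. x \<otimes> y) \<in> addhom A A"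
    "\<And>y. y \<in> carrier A \<Longrightarrow> (\<lambda>x. x \<otimes> y) \<in> addhom A A"
    "\<And>x y c. \<lbrakk>x \<in> carrier A; y \<in> carrier A; c \<in> carrier K\<rbrakk> \<Longrightarrow> (c \<odot> x) \<otimes> y = x \<otimes> (c \<odot> y)"
    by (auto intro!: addhomI simp: l_distr r_distr smult_mult_left smult_mult_right)
  from A2_hom[OF is_abelian_group this] show "mult2 K A \<in> addhom A2 A"
    and "\<And>x y. \<lbrakk>x \<in> carrier A; y \<in> carrier A\<rbrakk> \<Longrightarrow> mult2 K A (tns2 K A x y) = x \<otimes> y"
    by (simp_all add: mult2_def)
qed

lemma mult2_closed [simp]: "t \<in> carrier A2 \<Longrightarrow> mult2 K A t \<in> carrier A"
  by (rule addhom_closed[OF mult2_props(1)])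

lemma mult_addhoms:
  "a \<in> carrier A \<Longrightarrow> f \<in> addhom M A \<Longrightarrow> (\<lambda>x. a \<otimes> f x) \<in> addhom M A"
  "a \<in> carrier A \<Longrightarrow> f \<in> addhom M A \<Longrightarrow> (\<lambda>x. f x \<otimes> a) \<in> addhom M A"
  by (auto simp: addhom_iff l_distr r_distr)

lemma mult2_lact: "\<lbrakk>a \<in> carrier A; t \<in> carrier A2\<rbrakk> \<Longrightarrow> mult2 K A (a \<triangleright>\<^bsub>A2\<^esub> t) = a \<otimes> mult2 K A t"
proof -
  assume a: "a \<in> carrier A" and t: "t \<in> carrier A2"
  have "\<forall>t\<in>carrier A2. mult2 K A (a \<triangleright>\<^bsub>A2\<^esub> t) = a \<otimes> mult2 K A t"
    by (rule A2_eqI[OF is_abelian_group])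
      (use a in \<open>auto intro: mult_addhoms mult2_props addhom_comp[OF mult2_props(1) A2.lact_addhom]
        simp: mult2_props tns2_lact m_assoc\<close>)
  with t show ?thesis by blast
qed

lemma mult2_ract: "\<lbrakk>a \<in> carrier A; t \<in> carrier A2\<rbrakk> \<Longrightarrow> mult2 K A (t \<triangleleft>\<^bsub>A2\<^esub> a) = mult2 K A t \<otimes> a"
proof -
  assume a: "a \<in> carrier A" and t: "t \<in> carrier A2"
  have "\<forall>t\<in>carrier A2. mult2 K A (t \<triangleleft>\<^bsub>A2\<^esub> a) = mult2 K A t \<otimes> a"
    by (rule A2_eqI[OF is_abelian_group])
      (use a in \<open>auto intro: mult_addhoms mult2_props addhom_comp[OF mult2_props(1) A2.ract_addhom]
        simp: mult2_props tns2_ract m_assoc\<close>)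
  with t show ?thesis by blast
qed

abbreviation inner where "inner \<equiv> algebra_over_data.inner_act K A"

context
  fixes b c assumes bc: "b \<in> carrier A" "c \<in> carrier A"
begin

lemma inner_props:
  shows "inner b c \<in> addhom A2 A2"
    and "\<And>x y. \<lbrakk>x \<in> carrier A; y \<in> carrier A\<rbrakk> \<Longrightarrow> inner b c (tns2 K A x y) = tns2 K A (x \<otimes> c) (b \<otimes> y)"
proof -
  have "\<And>x. x \<in> carrier A \<Longrightarrow> (\<lambda>y. tns2 K A (x \<otimes> c) (b \<otimes> y)) \<in> addhom A A2"
    "\<And>y. y \<in> carrier A \<Longrightarrow> (\<lambda>x. tns2 K A (x \<otimes> c) (b \<otimes> y)) \<in> addhom A A2"
    "\<And>x y k. \<lbrakk>x \<in> carrier A; y \<in> carrier A; k \<in> carrier K\<rbrakk> \<Longrightarrow>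
      tns2 K A ((k \<odot> x) \<otimes> c) (b \<otimes> y) = tns2 K A (x \<otimes> c) (b \<otimes> (k \<odot> y))"
    using bc addhom_comp[OF tns2_addhom_right mult_addhoms(1)[OF bc(1) addhom_id]]
      addhom_comp[OF tns2_addhom_left mult_addhoms(2)[OF bc(2) addhom_id]]
    by (simp_all add: smult_mult_left smult_mult_right tns2_smult)
  from A2_hom[OF A2.abelian_group this] show "inner b c \<in> addhom A2 A2"
    and "\<And>x y. \<lbrakk>x \<in> carrier A; y \<in> carrier A\<rbrakk> \<Longrightarrow> inner b c (tns2 K A x y) = tns2 K A (x \<otimes> c) (b \<otimes> y)"
    by (simp_all add: algebra_over_data.inner_act_def)
qed

lemma inner_closed: "t \<in> carrier A2 \<Longrightarrow> inner b c t \<in> carrier A2"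
  by (rule addhom_closed[OF inner_props(1)])

lemma inner_lact: "\<lbrakk>a \<in> carrier A; t \<in> carrier A2\<rbrakk> \<Longrightarrow> inner b c (a \<triangleright>\<^bsub>A2\<^esub> t) = a \<triangleright>\<^bsub>A2\<^esub> inner b c t"
proof -
  assume a: "a \<in> carrier A" and t: "t \<in> carrier A2"
  have "\<forall>t\<in>carrier A2. inner b c (a \<triangleright>\<^bsub>A2\<^esub> t) = a \<triangleright>\<^bsub>A2\<^esub> inner b c t"
    by (rule A2_eqI[OF A2.abelian_group])
      (use a bc in \<open>auto intro: inner_props A2.addhom_lact addhom_comp[OF inner_props(1) A2.lact_addhom]
        simp: inner_props tns2_lact m_assoc\<close>)
  with t show ?thesis by blast
qed

lemma inner_ract: "\<lbrakk>a \<in> carrier A; t \<in> carrier A2\<rbrakk> \<Longrightarrow> inner b c (t \<triangleleft>\<^bsub>A2\<^esub> a) = inner b c t \<triangleleft>\<^bsub>A2\<^esub> a"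
proof -
  assume a: "a \<in> carrier A" and t: "t \<in> carrier A2"
  have "\<forall>t\<in>carrier A2. inner b c (t \<triangleleft>\<^bsub>A2\<^esub> a) = inner b c t \<triangleleft>\<^bsub>A2\<^esub> a"
    by (rule A2_eqI[OF A2.abelian_group])
      (use a bc in \<open>auto intro: inner_props A2.addhom_ract addhom_comp[OF inner_props(1) A2.ract_addhom]
        simp: inner_props tns2_ract m_assoc\<close>)
  with t show ?thesis by blast
qed

end

text \<open>Both sides send x \<otimes> y to x b y. Multiplication therefore does not distinguish
  the two inner actions, and the derivation attached to a double derivation depends only on its
  class modulo commutators.\<close>

lemma mult2_inner: "\<lbrakk>b \<in> carrier A; t \<in> carrier A2\<rbrakk> \<Longrightarrow> mult2 K A (inner b \<one> t) = mult2 K A (inner \<one> b t)"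
proof -
  assume b: "b \<in> carrier A" and t: "t \<in> carrier A2"
  have "\<forall>t\<in>carrier A2. mult2 K A (inner b \<one> t) = mult2 K A (inner \<one> b t)"
    by (rule A2_eqI[OF is_abelian_group])
      (use b in \<open>auto intro: addhom_comp[OF mult2_props(1) inner_props(1)] simp: inner_props mult2_props m_assoc\<close>)
  with t show ?thesis by blast
qed

end

context central_bimod
begin

interpretation A2: bimod A A2 A by (rule bimod_A2)

text \<open>Set up for an arbitrary central bimodule because two cases occur: on one-forms it is
  \<open>sandwich\<close>, and on A with m = 1 it is the reversed multiplication that contracts
  one-forms.\<close>

definition sand :: "'m \<Rightarrow> ('a \<times> 'a) frag set \<Rightarrow> 'm" where
  "sand m = the_add_hom (tensor2 K A) M
     (\<lambda>h. \<forall>x\<in>carrier A. \<forall>y\<in>carrier A. h (tns2 K A x y) = (y \<triangleright> m) \<triangleleft> x)"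

lemma sand_props:
  assumes "m \<in> carrier M"
  shows "sand m \<in> addhom A2 M"
    and "\<And>x y. \<lbrakk>x \<in> carrier A; y \<in> carrier A\<rbrakk> \<Longrightarrow> sand m (tns2 K A x y) = (y \<triangleright> m) \<triangleleft> x"
proof -
  have "(y \<triangleright> m) \<triangleleft> (c \<odot>\<^bsub>A\<^esub> x) = ((c \<odot>\<^bsub>A\<^esub> y) \<triangleright> m) \<triangleleft> x"
    if "x \<in> carrier A" "y \<in> carrier A" "c \<in> carrier K" for x y c
  proof -
    have "(y \<triangleright> m) \<triangleleft> (c \<odot>\<^bsub>A\<^esub> x) = (y \<triangleright> (m \<triangleleft> scal A c)) \<triangleleft> x"
      using that assms by (simp add: scal_mult[symmetric] ract_assoc lact_ract)
    also have "\<dots> = ((c \<odot>\<^bsub>A\<^esub> y) \<triangleright> m) \<triangleleft> x"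
      using that assms by (simp add: central[symmetric] lact_assoc[symmetric] mult_scal)
    finally show ?thesis .
  qed
  moreover have "\<And>x. x \<in> carrier A \<Longrightarrow> (\<lambda>y. (y \<triangleright> m) \<triangleleft> x) \<in> addhom A M"
    "\<And>y. y \<in> carrier A \<Longrightarrow> (\<lambda>x. (y \<triangleright> m) \<triangleleft> x) \<in> addhom A M"
    using assms by (auto intro: addhom_ract lact_addhom_left ract_addhom_right)
  ultimately show "sand m \<in> addhom A2 M"
    and "\<And>x y. \<lbrakk>x \<in> carrier A; y \<in> carrier A\<rbrakk> \<Longrightarrow> sand m (tns2 K A x y) = (y \<triangleright> m) \<triangleleft> x"
    using A2_hom[OF abelian_group, of "\<lambda>x y. (y \<triangleright> m) \<triangleleft> x"] by (simp_all add: sand_def)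
qed

lemma sand_closed [simp]: "\<lbrakk>m \<in> carrier M; t \<in> carrier A2\<rbrakk> \<Longrightarrow> sand m t \<in> carrier M"
  by (rule addhom_closed[OF sand_props(1)])

lemma sand_addhom_left: "t \<in> carrier A2 \<Longrightarrow> (\<lambda>m. sand m t) \<in> addhom M M"
proof (rule addhomI)
  fix m n assume t: "t \<in> carrier A2" and mn: "m \<in> carrier M" "n \<in> carrier M"
  have "\<forall>t\<in>carrier A2. sand (m \<oplus> n) t = sand m t \<oplus> sand n t"
    by (rule A2_eqI[OF abelian_group]) (use mn in \<open>auto intro: addhom_plus sand_props simp: sand_props act_simps\<close>)
  with t show "sand (m \<oplus> n) t = sand m t \<oplus> sand n t" by blast
qed simp

lemma sand_lact: "\<lbrakk>a \<in> carrier A; m \<in> carrier M; t \<in> carrier A2\<rbrakk> \<Longrightarrow>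
    sand (a \<triangleright> m) t = sand m (t \<triangleleft>\<^bsub>A2\<^esub> a)"
proof -
  assume a: "a \<in> carrier A" "m \<in> carrier M" and t: "t \<in> carrier A2"
  have "\<forall>t\<in>carrier A2. sand (a \<triangleright> m) t = sand m (t \<triangleleft>\<^bsub>A2\<^esub> a)"
    by (rule A2_eqI[OF abelian_group])
      (use a in \<open>auto intro: sand_props addhom_comp[OF sand_props(1) A2.ract_addhom] simp: sand_props tns2_ract lact_assoc\<close>)
  with t show ?thesis by blast
qed

lemma sand_ract: "\<lbrakk>a \<in> carrier A; m \<in> carrier M; t \<in> carrier A2\<rbrakk> \<Longrightarrow>
    sand (m \<triangleleft> a) t = sand m (a \<triangleright>\<^bsub>A2\<^esub> t)"
proof -
  assume a: "a \<in> carrier A" "m \<in> carrier M" and t: "t \<in> carrier A2"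
  have "\<forall>t\<in>carrier A2. sand (m \<triangleleft> a) t = sand m (a \<triangleright>\<^bsub>A2\<^esub> t)"
    by (rule A2_eqI[OF abelian_group])
      (use a in \<open>auto intro: sand_props addhom_comp[OF sand_props(1) A2.lact_addhom] simp: sand_props tns2_lact act_simps\<close>)
  with t show ?thesis by blast
qed

text \<open>The inner action turns x \<otimes> y into xc \<otimes> by, and the order reversal in y m
  x brings b and c to the outside. This makes contraction linear over the inner structure on double
  derivations.\<close>

lemma sand_inner: "\<lbrakk>b \<in> carrier A; c \<in> carrier A; m \<in> carrier M; t \<in> carrier A2\<rbrakk> \<Longrightarrow>
    sand m (inner b c t) = b \<triangleright> (sand m t \<triangleleft> c)"
proof -
  assume a: "b \<in> carrier A" "c \<in> carrier A" "m \<in> carrier M" and t: "t \<in> carrier A2"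
  have "\<forall>t\<in>carrier A2. sand m (inner b c t) = b \<triangleright> (sand m t \<triangleleft> c)"
  proof (rule A2_eqI[OF abelian_group])
    show "(\<lambda>t. b \<triangleright> (sand m t \<triangleleft> c)) \<in> addhom A2 M"
      by (intro addhom_lact addhom_ract sand_props a)
  qed (use a in \<open>auto intro: addhom_comp[OF sand_props(1) inner_props(1)] simp: sand_props inner_props act_simps\<close>)
  with t show ?thesis by blast
qed

lemma commutators_span:
  "commutators A M = add_span M {a \<triangleright> m \<ominus> m \<triangleleft> a | a m. a \<in> carrier A \<and> m \<in> carrier M}"
  by (simp add: commutators_def add_span_def)

lemma commutators_subgroup: "subgroup (commutators A M) (add_monoid M)"
  unfolding commutators_span by (rule add_span_subgroup) auto

lemma commutatorsI: "\<lbrakk>a \<in> carrier A; m \<in> carrier M\<rbrakk> \<Longrightarrow> a \<triangleright> m \<ominus> m \<triangleleft> a \<in> commutators A M"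
  unfolding commutators_span by (rule add_span_incl) blast

lemma commutatorsI': "\<lbrakk>a \<in> carrier A; m \<in> carrier M\<rbrakk> \<Longrightarrow> m \<triangleleft> a \<ominus> a \<triangleright> m \<in> commutators A M"
  using subgroupD_add(4)[OF commutators_subgroup commutatorsI[of a m]] by (simp add: neg_of_diff)

lemma commutators_into:
  assumes "abelian_group P" "f \<in> addhom M P" "subgroup B (add_monoid P)"
    and "\<And>a m. \<lbrakk>a \<in> carrier A; m \<in> carrier M\<rbrakk> \<Longrightarrow> f (a \<triangleright> m \<ominus> m \<triangleleft> a) \<in> B" "x \<in> commutators A M"
  shows "f x \<in> B"
  by (rule addhom_span_into[OF abelian_group assms(1-3) _ _ assms(5)[unfolded commutators_span]])
    (use assms(4) in auto)

lemma commutators_kernel: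
  assumes P: "abelian_group P" "f \<in> addhom M P"
    and f: "\<And>a m. \<lbrakk>a \<in> carrier A; m \<in> carrier M\<rbrakk> \<Longrightarrow> f (a \<triangleright> m) = f (m \<triangleleft> a)" and x: "x \<in> commutators A M"
  shows "f x = \<zero>\<^bsub>P\<^esub>"
proof -
  interpret P: abelian_group P by (rule P(1))
  have "subgroup {\<zero>\<^bsub>P\<^esub>} (add_monoid P)"
    by (rule P.subgroupI_add) (auto simp: P.diff_self)
  then have "f x \<in> {\<zero>\<^bsub>P\<^esub>}"
    by (rule commutators_into[OF P _ _ x])
      (auto simp: P.diff_self addhom_minus[OF P(2) abelian_group P(1)] f addhom_closed[OF P(2)])
  then show ?thesis by simp
qed

text \<open>Modulo [A, M] the factor x of y m x rotates to the front, giving xy m; in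
  \<open>sand_right\<close> the factor y rotates to the end, giving m xy. Together they compare
  contraction by a double derivation with contraction by its associated derivation.\<close>

lemma sand_left: "\<lbrakk>m \<in> carrier M; t \<in> carrier A2\<rbrakk> \<Longrightarrow> sand m t \<ominus> mult2 K A t \<triangleright> m \<in> commutators A M"
proof (rule A2_into[where f = "\<lambda>t. sand m t \<ominus> mult2 K A t \<triangleright> m", OF abelian_group _ commutators_subgroup])
  assume m: "m \<in> carrier M"
  then show "(\<lambda>t. sand m t \<ominus> mult2 K A t \<triangleright> m) \<in> addhom A2 M"
    by (intro addhom_diff addhom_lact_left sand_props mult2_props)
  show "sand m (tns2 K A x y) \<ominus> mult2 K A (tns2 K A x y) \<triangleright> m \<in> commutators A M"
    if "x \<in> carrier A" "y \<in> carrier A" for x y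
    using commutatorsI'[of x "y \<triangleright> m"] that m by (simp add: sand_props mult2_props lact_assoc)
qed

lemma sand_right: "\<lbrakk>m \<in> carrier M; t \<in> carrier A2\<rbrakk> \<Longrightarrow> sand m t \<ominus> m \<triangleleft> mult2 K A t \<in> commutators A M"
proof (rule A2_into[where f = "\<lambda>t. sand m t \<ominus> m \<triangleleft> mult2 K A t", OF abelian_group _ commutators_subgroup])
  assume m: "m \<in> carrier M"
  then show "(\<lambda>t. sand m t \<ominus> m \<triangleleft> mult2 K A t) \<in> addhom A2 M"
    by (intro addhom_diff addhom_ract_right sand_props mult2_props)
  show "sand m (tns2 K A x y) \<ominus> m \<triangleleft> mult2 K A (tns2 K A x y) \<in> commutators A M"
    if "x \<in> carrier A" "y \<in> carrier A" for x y
    using commutatorsI[of y "m \<triangleleft> x"] that m by (simp add: sand_props mult2_props act_simps)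
qed

end

context nc_forms
begin

lemma A_comm_commutators: "A_comm = commutators A AS"
  by (simp add: A_comm_def)

lemma sandwich_eq: "sandwich = O1.sand"
  by (simp add: sandwich_def O1.sand_def fun_eq_iff)

lemma i1_eq: "i1 \<Theta> = ext_deriv AA \<Theta>"
  by (simp add: i1_def ext_deriv_def)

text \<open>The map attached to D is linear on both sides, so it passes through y \<beta> x to the
  middle factor.\<close>

lemma ext_deriv_sand:
  assumes D: "deriv AS D" and \<beta>: "\<beta> \<in> carrier Omega1" and t: "t \<in> carrier AA"
  shows "ext_deriv AS D (O1.sand \<beta> t) = AS.sand (ext_deriv AS D \<beta>) t"
proof -
  note E = ext_deriv_props[OF AS.bimod D] ext_deriv_closed[OF AS.bimod D]
    ext_deriv_lact[OF AS.bimod D] ext_deriv_ract[OF AS.bimod D]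
  have "\<forall>t\<in>carrier AA. ext_deriv AS D (O1.sand \<beta> t) = AS.sand (ext_deriv AS D \<beta>) t"
    by (rule A2_eqI[OF AS.abelian_group])
      (use \<beta> AS.sand_props E O1.sand_props addhom_comp[OF E(1) O1.sand_props(1)[OF \<beta>]] in auto)
  with t show ?thesis by blast
qed

end

section \<open>Forms of degree two and three, their products and differentials\<close>

context nc_forms
begin

sublocale W2: tensor_bimod A Omega1 A Omega1 A
  unfolding tensor_bimod_def by (intro conjI bimod_Omega1)

lemmas wedge11_closed [simp] = W2.tens_closed[folded Omega2_def wedge11_def]
lemmas wedge11_addhom_left = W2.tens_addhom_left[folded Omega2_def wedge11_def]
lemmas wedge11_addhom_right = W2.tens_addhom_right[folded Omega2_def wedge11_def]
lemmas wedge11_balanced = W2.tens_balanced[folded Omega2_def wedge11_def]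
lemmas wedge11_lact = W2.lact_works(2)[folded Omega2_def wedge11_def]
lemmas wedge11_ract = W2.ract_works(2)[folded Omega2_def wedge11_def]
lemmas Omega2_hom = W2.tensor_hom[folded Omega2_def wedge11_def]
lemmas Omega2_eqI = W2.tensor_eqI[folded Omega2_def wedge11_def]
lemmas bimod_Omega2 = W2.tensor_bimod[folded Omega2_def]

sublocale O2: bimod A Omega2 A
  by (rule bimod_Omega2)

sublocale W3: tensor_bimod A Omega2 A Omega1 A
  unfolding tensor_bimod_def by (intro conjI bimod_Omega1 bimod_Omega2)

lemmas wedge21_closed [simp] = W3.tens_closed[folded Omega3_def wedge21_def]
lemmas wedge21_addhom_left = W3.tens_addhom_left[folded Omega3_def wedge21_def]
lemmas wedge21_addhom_right = W3.tens_addhom_right[folded Omega3_def wedge21_def]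
lemmas wedge21_balanced = W3.tens_balanced[folded Omega3_def wedge21_def]
lemmas wedge21_lact = W3.lact_works(2)[folded Omega3_def wedge21_def]
lemmas wedge21_ract = W3.ract_works(2)[folded Omega3_def wedge21_def]
lemmas Omega3_hom = W3.tensor_hom[folded Omega3_def wedge21_def]
lemmas Omega3_eqI = W3.tensor_eqI[folded Omega3_def wedge21_def]
lemmas bimod_Omega3 = W3.tensor_bimod[folded Omega3_def]

sublocale O3: bimod A Omega3 A
  by (rule bimod_Omega3)

lemma wedge11_simps:
  "\<lbrakk>\<alpha> \<in> carrier Omega1; \<alpha>' \<in> carrier Omega1; \<beta> \<in> carrier Omega1\<rbrakk> \<Longrightarrow>
    wedge11 (\<alpha> \<oplus>\<^bsub>Omega1\<^esub> \<alpha>') \<beta> = wedge11 \<alpha> \<beta> \<oplus>\<^bsub>Omega2\<^esub> wedge11 \<alpha>' \<beta>"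
  "\<lbrakk>\<alpha> \<in> carrier Omega1; \<beta> \<in> carrier Omega1; \<beta>' \<in> carrier Omega1\<rbrakk> \<Longrightarrow>
    wedge11 \<alpha> (\<beta> \<oplus>\<^bsub>Omega1\<^esub> \<beta>') = wedge11 \<alpha> \<beta> \<oplus>\<^bsub>Omega2\<^esub> wedge11 \<alpha> \<beta>'"
  "\<lbrakk>\<alpha> \<in> carrier Omega1; \<alpha>' \<in> carrier Omega1; \<beta> \<in> carrier Omega1\<rbrakk> \<Longrightarrow>
    wedge11 (\<alpha> \<ominus>\<^bsub>Omega1\<^esub> \<alpha>') \<beta> = wedge11 \<alpha> \<beta> \<ominus>\<^bsub>Omega2\<^esub> wedge11 \<alpha>' \<beta>"
  "\<lbrakk>\<alpha> \<in> carrier Omega1; \<beta> \<in> carrier Omega1; \<beta>' \<in> carrier Omega1\<rbrakk> \<Longrightarrow>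
    wedge11 \<alpha> (\<beta> \<ominus>\<^bsub>Omega1\<^esub> \<beta>') = wedge11 \<alpha> \<beta> \<ominus>\<^bsub>Omega2\<^esub> wedge11 \<alpha> \<beta>'"
  "\<beta> \<in> carrier Omega1 \<Longrightarrow> wedge11 \<zero>\<^bsub>Omega1\<^esub> \<beta> = \<zero>\<^bsub>Omega2\<^esub>"
  "\<alpha> \<in> carrier Omega1 \<Longrightarrow> wedge11 \<alpha> \<zero>\<^bsub>Omega1\<^esub> = \<zero>\<^bsub>Omega2\<^esub>"
  by (simp_all add: addhom_add[OF wedge11_addhom_left] addhom_add[OF wedge11_addhom_right]
      addhom_minus[OF wedge11_addhom_left O1.abelian_group O2.abelian_group]
      addhom_minus[OF wedge11_addhom_right O1.abelian_group O2.abelian_group]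
      addhom_zero[OF wedge11_addhom_left O1.abelian_group O2.abelian_group]
      addhom_zero[OF wedge11_addhom_right O1.abelian_group O2.abelian_group])

lemma wedge21_simps:
  "\<lbrakk>\<xi> \<in> carrier Omega2; \<xi>' \<in> carrier Omega2; \<beta> \<in> carrier Omega1\<rbrakk> \<Longrightarrow>
    wedge21 (\<xi> \<oplus>\<^bsub>Omega2\<^esub> \<xi>') \<beta> = wedge21 \<xi> \<beta> \<oplus>\<^bsub>Omega3\<^esub> wedge21 \<xi>' \<beta>"
  "\<lbrakk>\<xi> \<in> carrier Omega2; \<beta> \<in> carrier Omega1; \<beta>' \<in> carrier Omega1\<rbrakk> \<Longrightarrow>
    wedge21 \<xi> (\<beta> \<oplus>\<^bsub>Omega1\<^esub> \<beta>') = wedge21 \<xi> \<beta> \<oplus>\<^bsub>Omega3\<^esub> wedge21 \<xi> \<beta>'"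
  "\<lbrakk>\<xi> \<in> carrier Omega2; \<xi>' \<in> carrier Omega2; \<beta> \<in> carrier Omega1\<rbrakk> \<Longrightarrow>
    wedge21 (\<xi> \<ominus>\<^bsub>Omega2\<^esub> \<xi>') \<beta> = wedge21 \<xi> \<beta> \<ominus>\<^bsub>Omega3\<^esub> wedge21 \<xi>' \<beta>"
  "\<lbrakk>\<xi> \<in> carrier Omega2; \<beta> \<in> carrier Omega1; \<beta>' \<in> carrier Omega1\<rbrakk> \<Longrightarrow>
    wedge21 \<xi> (\<beta> \<ominus>\<^bsub>Omega1\<^esub> \<beta>') = wedge21 \<xi> \<beta> \<ominus>\<^bsub>Omega3\<^esub> wedge21 \<xi> \<beta>'"
  by (simp_all add: addhom_add[OF wedge21_addhom_left] addhom_add[OF wedge21_addhom_right]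
      addhom_minus[OF wedge21_addhom_left O2.abelian_group O3.abelian_group]
      addhom_minus[OF wedge21_addhom_right O1.abelian_group O3.abelian_group])

text \<open>Balancing over R holds because d vanishes on R: d(ur) dv = du r dv = du d(rv).\<close>

lemma d1_props:
  shows "d1 \<in> addhom Omega1 Omega2"
    and "\<And>u v. \<lbrakk>u \<in> carrier A; v \<in> carrier A\<rbrakk> \<Longrightarrow> d1 (u \<triangleright>\<^bsub>Omega1\<^esub> d0 v) = wedge11 (d0 u) (d0 v)"
proof -
  have "\<And>u. u \<in> carrier A \<Longrightarrow> (\<lambda>v. wedge11 (d0 u) (d0 v)) \<in> addhom A Omega2"
    "\<And>v. v \<in> carrier A \<Longrightarrow> (\<lambda>u. wedge11 (d0 u) (d0 v)) \<in> addhom A Omega2"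
    "\<And>u v r. \<lbrakk>u \<in> carrier A; v \<in> carrier A; r \<in> carrier R\<rbrakk> \<Longrightarrow>
      wedge11 (d0 (u \<otimes> \<eta> r)) (d0 v) = wedge11 (d0 u) (d0 (\<eta> r \<otimes> v))"
    "\<And>u. u \<in> carrier A \<Longrightarrow> wedge11 (d0 u) (d0 \<one>) = \<zero>\<^bsub>Omega2\<^esub>"
    using addhom_comp[OF wedge11_addhom_right d0_addhom] addhom_comp[OF wedge11_addhom_left d0_addhom]
    by (simp_all add: d0_mult wedge11_simps wedge11_balanced)
  from Omega1_hom[OF O2.abelian_group this]
  show "d1 \<in> addhom Omega1 Omega2"
    and "\<And>u v. \<lbrakk>u \<in> carrier A; v \<in> carrier A\<rbrakk> \<Longrightarrow> d1 (u \<triangleright>\<^bsub>Omega1\<^esub> d0 v) = wedge11 (d0 u) (d0 v)"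
    by (simp_all add: d1_def)
qed

lemma d1_closed [simp]: "\<alpha> \<in> carrier Omega1 \<Longrightarrow> d1 \<alpha> \<in> carrier Omega2"
  by (rule addhom_closed[OF d1_props(1)])

lemma d1_diff: "\<lbrakk>\<alpha> \<in> carrier Omega1; \<beta> \<in> carrier Omega1\<rbrakk> \<Longrightarrow> d1 (\<alpha> \<ominus>\<^bsub>Omega1\<^esub> \<beta>) = d1 \<alpha> \<ominus>\<^bsub>Omega2\<^esub> d1 \<beta>"
  by (rule addhom_minus[OF d1_props(1) O1.abelian_group O2.abelian_group])

lemma d1_add: "\<lbrakk>\<alpha> \<in> carrier Omega1; \<beta> \<in> carrier Omega1\<rbrakk> \<Longrightarrow> d1 (\<alpha> \<oplus>\<^bsub>Omega1\<^esub> \<beta>) = d1 \<alpha> \<oplus>\<^bsub>Omega2\<^esub> d1 \<beta>"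
  by (rule addhom_add[OF d1_props(1)])

lemma d1_d0 [simp]: "a \<in> carrier A \<Longrightarrow> d1 (d0 a) = \<zero>\<^bsub>Omega2\<^esub>"
  using d1_props(2)[of \<one> a] by (simp add: wedge11_simps)

lemma d1_lact: "\<lbrakk>a \<in> carrier A; \<alpha> \<in> carrier Omega1\<rbrakk> \<Longrightarrow>
    d1 (a \<triangleright>\<^bsub>Omega1\<^esub> \<alpha>) = wedge11 (d0 a) \<alpha> \<oplus>\<^bsub>Omega2\<^esub> a \<triangleright>\<^bsub>Omega2\<^esub> d1 \<alpha>"
proof -
  assume a: "a \<in> carrier A" and \<alpha>: "\<alpha> \<in> carrier Omega1"
  have "\<forall>\<alpha>\<in>carrier Omega1. d1 (a \<triangleright>\<^bsub>Omega1\<^esub> \<alpha>) = wedge11 (d0 a) \<alpha> \<oplus>\<^bsub>Omega2\<^esub> a \<triangleright>\<^bsub>Omega2\<^esub> d1 \<alpha>"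
  proof (rule Omega1_eqI[OF O2.abelian_group])
    show "d1 (a \<triangleright>\<^bsub>Omega1\<^esub> u \<triangleright>\<^bsub>Omega1\<^esub> d0 v) =
        wedge11 (d0 a) (u \<triangleright>\<^bsub>Omega1\<^esub> d0 v) \<oplus>\<^bsub>Omega2\<^esub> a \<triangleright>\<^bsub>Omega2\<^esub> d1 (u \<triangleright>\<^bsub>Omega1\<^esub> d0 v)"
      if "u \<in> carrier A" "v \<in> carrier A" for u v
      using a that
      by (simp add: O1.lact_assoc[symmetric] d1_props(2) d0_mult wedge11_simps wedge11_balanced wedge11_lact O2.a_comm)
  qed (use a in \<open>auto intro!: O2.addhom_plus O2.addhom_lact d1_props wedge11_addhom_right
      addhom_comp[OF d1_props(1) O1.lact_addhom]\<close>)
  with \<alpha> show ?thesis by blast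
qed

lemma d1_ract: "\<lbrakk>a \<in> carrier A; \<alpha> \<in> carrier Omega1\<rbrakk> \<Longrightarrow>
    d1 (\<alpha> \<triangleleft>\<^bsub>Omega1\<^esub> a) = d1 \<alpha> \<triangleleft>\<^bsub>Omega2\<^esub> a \<ominus>\<^bsub>Omega2\<^esub> wedge11 \<alpha> (d0 a)"
proof -
  assume a: "a \<in> carrier A" and \<alpha>: "\<alpha> \<in> carrier Omega1"
  have "\<forall>\<alpha>\<in>carrier Omega1. d1 (\<alpha> \<triangleleft>\<^bsub>Omega1\<^esub> a) = d1 \<alpha> \<triangleleft>\<^bsub>Omega2\<^esub> a \<ominus>\<^bsub>Omega2\<^esub> wedge11 \<alpha> (d0 a)"
  proof (rule Omega1_eqI[OF O2.abelian_group])
    show "d1 ((u \<triangleright>\<^bsub>Omega1\<^esub> d0 v) \<triangleleft>\<^bsub>Omega1\<^esub> a) =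
        d1 (u \<triangleright>\<^bsub>Omega1\<^esub> d0 v) \<triangleleft>\<^bsub>Omega2\<^esub> a \<ominus>\<^bsub>Omega2\<^esub> wedge11 (u \<triangleright>\<^bsub>Omega1\<^esub> d0 v) (d0 a)"
      if uv: "u \<in> carrier A" "v \<in> carrier A" for u v
    proof -
      have "(u \<triangleright>\<^bsub>Omega1\<^esub> d0 v) \<triangleleft>\<^bsub>Omega1\<^esub> a = u \<triangleright>\<^bsub>Omega1\<^esub> d0 (v \<otimes> a) \<ominus>\<^bsub>Omega1\<^esub> (u \<otimes> v) \<triangleright>\<^bsub>Omega1\<^esub> d0 a"
        using uv a by (simp add: d0_mult O1.act_simps O1.diff_simps)
      \<comment> \<open>Each of the two expansions contains the term du v da, and it cancels in the
        difference.\<close>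
      moreover have "wedge11 (d0 (u \<otimes> v)) (d0 a) = wedge11 (u \<triangleright>\<^bsub>Omega1\<^esub> d0 v) (d0 a) \<oplus>\<^bsub>Omega2\<^esub> wedge11 (d0 u) (v \<triangleright>\<^bsub>Omega1\<^esub> d0 a)"
        "wedge11 (d0 u) (d0 (v \<otimes> a)) = wedge11 (d0 u) (v \<triangleright>\<^bsub>Omega1\<^esub> d0 a) \<oplus>\<^bsub>Omega2\<^esub> wedge11 (d0 u) (d0 v) \<triangleleft>\<^bsub>Omega2\<^esub> a"
        using uv a by (simp_all add: d0_mult wedge11_simps wedge11_balanced wedge11_ract)
      ultimately show ?thesis
        using uv a by (simp add: d1_diff d1_props(2) O2.diff_simps)
    qed
  qed (use a in \<open>auto intro!: O2.addhom_diff O2.addhom_ract d1_props wedge11_addhom_left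
      addhom_comp[OF d1_props(1) O1.ract_addhom]\<close>)
  with \<alpha> show ?thesis by blast
qed

text \<open>Three-forms are bracketed as Omega^2 times Omega^1, so the product with a one-form in
  front is transported by associativity; it is well defined because both products are balanced over
  A.\<close>

lemma wedge12_props:
  assumes \<alpha>: "\<alpha> \<in> carrier Omega1"
  shows "wedge12 \<alpha> \<in> addhom Omega2 Omega3"
    and "\<And>\<beta> \<gamma>. \<lbrakk>\<beta> \<in> carrier Omega1; \<gamma> \<in> carrier Omega1\<rbrakk> \<Longrightarrow>
      wedge12 \<alpha> (wedge11 \<beta> \<gamma>) = wedge21 (wedge11 \<alpha> \<beta>) \<gamma>"
proof -
  have "W2.balanced Omega3 (\<lambda>\<beta> \<gamma>. wedge21 (wedge11 \<alpha> \<beta>) \<gamma>)"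
    by (rule W2.balancedI)
      (use \<alpha> in \<open>auto intro: wedge21_addhom_right addhom_comp[OF wedge21_addhom_left wedge11_addhom_right]
        simp: wedge21_balanced[symmetric] wedge11_ract\<close>)
  from Omega2_hom[OF O3.abelian_group this]
  show "wedge12 \<alpha> \<in> addhom Omega2 Omega3"
    and "\<And>\<beta> \<gamma>. \<lbrakk>\<beta> \<in> carrier Omega1; \<gamma> \<in> carrier Omega1\<rbrakk> \<Longrightarrow>
      wedge12 \<alpha> (wedge11 \<beta> \<gamma>) = wedge21 (wedge11 \<alpha> \<beta>) \<gamma>"
    by (simp_all add: wedge12_def)
qed

lemma wedge12_closed [simp]: "\<lbrakk>\<alpha> \<in> carrier Omega1; \<xi> \<in> carrier Omega2\<rbrakk> \<Longrightarrow> wedge12 \<alpha> \<xi> \<in> carrier Omega3"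
  by (rule addhom_closed[OF wedge12_props(1)])

lemma wedge12_addhom_left: "\<xi> \<in> carrier Omega2 \<Longrightarrow> (\<lambda>\<alpha>. wedge12 \<alpha> \<xi>) \<in> addhom Omega1 Omega3"
proof (rule addhomI)
  fix \<alpha> \<beta> assume \<xi>: "\<xi> \<in> carrier Omega2" and ab: "\<alpha> \<in> carrier Omega1" "\<beta> \<in> carrier Omega1"
  have "\<forall>\<xi>\<in>carrier Omega2. wedge12 (\<alpha> \<oplus>\<^bsub>Omega1\<^esub> \<beta>) \<xi> = wedge12 \<alpha> \<xi> \<oplus>\<^bsub>Omega3\<^esub> wedge12 \<beta> \<xi>"
    by (rule Omega2_eqI[OF O3.abelian_group])
      (use ab in \<open>auto intro: O3.addhom_plus wedge12_props simp: wedge12_props wedge11_simps wedge21_simps\<close>)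
  with \<xi> show "wedge12 (\<alpha> \<oplus>\<^bsub>Omega1\<^esub> \<beta>) \<xi> = wedge12 \<alpha> \<xi> \<oplus>\<^bsub>Omega3\<^esub> wedge12 \<beta> \<xi>" by blast
qed simp

lemma wedge12_act: "\<lbrakk>a \<in> carrier A; \<alpha> \<in> carrier Omega1; \<xi> \<in> carrier Omega2\<rbrakk> \<Longrightarrow>
    wedge12 \<alpha> (a \<triangleright>\<^bsub>Omega2\<^esub> \<xi>) = wedge12 (\<alpha> \<triangleleft>\<^bsub>Omega1\<^esub> a) \<xi>"
proof -
  assume a: "a \<in> carrier A" "\<alpha> \<in> carrier Omega1" and \<xi>: "\<xi> \<in> carrier Omega2"
  have "\<forall>\<xi>\<in>carrier Omega2. wedge12 \<alpha> (a \<triangleright>\<^bsub>Omega2\<^esub> \<xi>) = wedge12 (\<alpha> \<triangleleft>\<^bsub>Omega1\<^esub> a) \<xi>"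
    by (rule Omega2_eqI[OF O3.abelian_group])
      (use a in \<open>auto intro: wedge12_props addhom_comp[OF wedge12_props(1) O2.lact_addhom]
        simp: wedge12_props wedge11_lact wedge11_balanced\<close>)
  with \<xi> show ?thesis by blast
qed

text \<open>Both d(\<alpha>a) \<beta> - \<alpha>a d\<beta> and d\<alpha> a\<beta> - \<alpha>
  d(a\<beta>) contain the same extra term -\<alpha> da \<beta>, so the formula is balanced over
  A.\<close>

lemma d2_props:
  shows "d2 \<in> addhom Omega2 Omega3"
    and "\<And>\<alpha> \<beta>. \<lbrakk>\<alpha> \<in> carrier Omega1; \<beta> \<in> carrier Omega1\<rbrakk> \<Longrightarrow>
      d2 (wedge11 \<alpha> \<beta>) = wedge21 (d1 \<alpha>) \<beta> \<ominus>\<^bsub>Omega3\<^esub> wedge12 \<alpha> (d1 \<beta>)"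
proof -
  have "W2.balanced Omega3 (\<lambda>\<alpha> \<beta>. wedge21 (d1 \<alpha>) \<beta> \<ominus>\<^bsub>Omega3\<^esub> wedge12 \<alpha> (d1 \<beta>))"
  proof (rule W2.balancedI)
    show "wedge21 (d1 (\<alpha> \<triangleleft>\<^bsub>Omega1\<^esub> a)) \<beta> \<ominus>\<^bsub>Omega3\<^esub> wedge12 (\<alpha> \<triangleleft>\<^bsub>Omega1\<^esub> a) (d1 \<beta>) =
        wedge21 (d1 \<alpha>) (a \<triangleright>\<^bsub>Omega1\<^esub> \<beta>) \<ominus>\<^bsub>Omega3\<^esub> wedge12 \<alpha> (d1 (a \<triangleright>\<^bsub>Omega1\<^esub> \<beta>))"
      if "\<alpha> \<in> carrier Omega1" "a \<in> carrier A" "\<beta> \<in> carrier Omega1" for \<alpha> a \<beta>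
      using that
      by (simp add: d1_ract d1_lact wedge21_simps wedge21_balanced addhom_add[OF wedge12_props(1)]
          wedge12_props(2) wedge12_act O3.diff_simps)
  qed (auto intro!: O3.addhom_diff wedge21_addhom_right addhom_comp[OF wedge21_addhom_left d1_props(1)]
      wedge12_addhom_left addhom_comp[OF wedge12_props(1) d1_props(1)])
  from Omega2_hom[OF O3.abelian_group this]
  show "d2 \<in> addhom Omega2 Omega3"
    and "\<And>\<alpha> \<beta>. \<lbrakk>\<alpha> \<in> carrier Omega1; \<beta> \<in> carrier Omega1\<rbrakk> \<Longrightarrow>
      d2 (wedge11 \<alpha> \<beta>) = wedge21 (d1 \<alpha>) \<beta> \<ominus>\<^bsub>Omega3\<^esub> wedge12 \<alpha> (d1 \<beta>)"
    by (simp_all add: d2_def)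
qed

lemma d2_closed [simp]: "\<xi> \<in> carrier Omega2 \<Longrightarrow> d2 \<xi> \<in> carrier Omega3"
  by (rule addhom_closed[OF d2_props(1)])

text \<open>\<open>jn D\<close> is the contraction \<open>\<Omega>\<^sup>n \<rightarrow> \<Omega>\<^sup>n\<^sup>-\<^sup>1\<close> with a derivation \<open>D\<close> of \<open>A\<close>.\<close>

definition j1 :: "('a \<Rightarrow> 'a) \<Rightarrow> ('a \<times> 'a) frag set \<Rightarrow> 'a" where
  "j1 D = ext_deriv AS D"

definition j2 where
  "j2 D = the_add_hom Omega2 Omega1
     (\<lambda>h. \<forall>\<alpha>\<in>carrier Omega1. \<forall>\<beta>\<in>carrier Omega1.
        h (wedge11 \<alpha> \<beta>) = (j1 D \<alpha> \<triangleright>\<^bsub>Omega1\<^esub> \<beta>) \<ominus>\<^bsub>Omega1\<^esub> (\<alpha> \<triangleleft>\<^bsub>Omega1\<^esub> j1 D \<beta>))"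

definition j3 where
  "j3 D = the_add_hom Omega3 Omega2
     (\<lambda>h. \<forall>\<xi>\<in>carrier Omega2. \<forall>\<beta>\<in>carrier Omega1.
        h (wedge21 \<xi> \<beta>) = wedge11 (j2 D \<xi>) \<beta> \<oplus>\<^bsub>Omega2\<^esub> (\<xi> \<triangleleft>\<^bsub>Omega2\<^esub> j1 D \<beta>))"

context
  fixes D assumes D: "deriv AS D"
begin

lemma D_closed [simp]: "x \<in> carrier A \<Longrightarrow> D x \<in> carrier A"
  using derivD(2)[OF D] by simp

lemma j1_addhom: "j1 D \<in> addhom Omega1 A"
  using ext_deriv_props(1)[OF AS.bimod D] by (simp add: j1_def)

lemma j1_udv: "\<lbrakk>u \<in> carrier A; v \<in> carrier A\<rbrakk> \<Longrightarrow> j1 D (u \<triangleright>\<^bsub>Omega1\<^esub> d0 v) = u \<otimes> D v"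
  using ext_deriv_props(2)[OF AS.bimod D] by (simp add: j1_def)

lemma j1_d0 [simp]: "v \<in> carrier A \<Longrightarrow> j1 D (d0 v) = D v"
  using ext_deriv_d0[OF AS.bimod D] by (simp add: j1_def)

lemma j1_closed [simp]: "\<alpha> \<in> carrier Omega1 \<Longrightarrow> j1 D \<alpha> \<in> carrier A"
  by (rule addhom_closed[OF j1_addhom])

lemma j1_lact: "\<lbrakk>a \<in> carrier A; \<alpha> \<in> carrier Omega1\<rbrakk> \<Longrightarrow> j1 D (a \<triangleright>\<^bsub>Omega1\<^esub> \<alpha>) = a \<otimes> j1 D \<alpha>"
  using ext_deriv_lact[OF AS.bimod D] by (simp add: j1_def)

lemma j1_ract: "\<lbrakk>a \<in> carrier A; \<alpha> \<in> carrier Omega1\<rbrakk> \<Longrightarrow> j1 D (\<alpha> \<triangleleft>\<^bsub>Omega1\<^esub> a) = j1 D \<alpha> \<otimes> a"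
  using ext_deriv_ract[OF AS.bimod D] by (simp add: j1_def)

lemma j1_diff: "\<lbrakk>\<alpha> \<in> carrier Omega1; \<beta> \<in> carrier Omega1\<rbrakk> \<Longrightarrow> j1 D (\<alpha> \<ominus>\<^bsub>Omega1\<^esub> \<beta>) = j1 D \<alpha> \<ominus> j1 D \<beta>"
  by (rule addhom_minus[OF j1_addhom O1.abelian_group is_abelian_group])

lemma j2_props:
  shows "j2 D \<in> addhom Omega2 Omega1"
    and "\<And>\<alpha> \<beta>. \<lbrakk>\<alpha> \<in> carrier Omega1; \<beta> \<in> carrier Omega1\<rbrakk> \<Longrightarrow>
      j2 D (wedge11 \<alpha> \<beta>) = (j1 D \<alpha> \<triangleright>\<^bsub>Omega1\<^esub> \<beta>) \<ominus>\<^bsub>Omega1\<^esub> (\<alpha> \<triangleleft>\<^bsub>Omega1\<^esub> j1 D \<beta>)"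
proof -
  have "W2.balanced Omega1 (\<lambda>\<alpha> \<beta>. (j1 D \<alpha> \<triangleright>\<^bsub>Omega1\<^esub> \<beta>) \<ominus>\<^bsub>Omega1\<^esub> (\<alpha> \<triangleleft>\<^bsub>Omega1\<^esub> j1 D \<beta>))"
    by (rule W2.balancedI)
      (auto intro!: O1.addhom_diff O1.lact_addhom O1.ract_addhom O1.addhom_lact_left O1.addhom_ract_right j1_addhom
        simp: j1_lact j1_ract O1.act_simps)
  from Omega2_hom[OF O1.abelian_group this]
  show "j2 D \<in> addhom Omega2 Omega1"
    and "\<And>\<alpha> \<beta>. \<lbrakk>\<alpha> \<in> carrier Omega1; \<beta> \<in> carrier Omega1\<rbrakk> \<Longrightarrow>
      j2 D (wedge11 \<alpha> \<beta>) = (j1 D \<alpha> \<triangleright>\<^bsub>Omega1\<^esub> \<beta>) \<ominus>\<^bsub>Omega1\<^esub> (\<alpha> \<triangleleft>\<^bsub>Omega1\<^esub> j1 D \<beta>)"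
    by (simp_all add: j2_def)
qed

lemma j2_closed [simp]: "\<xi> \<in> carrier Omega2 \<Longrightarrow> j2 D \<xi> \<in> carrier Omega1"
  by (rule addhom_closed[OF j2_props(1)])

lemma j2_diff: "\<lbrakk>\<xi> \<in> carrier Omega2; \<zeta> \<in> carrier Omega2\<rbrakk> \<Longrightarrow> j2 D (\<xi> \<ominus>\<^bsub>Omega2\<^esub> \<zeta>) = j2 D \<xi> \<ominus>\<^bsub>Omega1\<^esub> j2 D \<zeta>"
  by (rule addhom_minus[OF j2_props(1) O2.abelian_group O1.abelian_group])

lemma j2_add: "\<lbrakk>\<xi> \<in> carrier Omega2; \<zeta> \<in> carrier Omega2\<rbrakk> \<Longrightarrow> j2 D (\<xi> \<oplus>\<^bsub>Omega2\<^esub> \<zeta>) = j2 D \<xi> \<oplus>\<^bsub>Omega1\<^esub> j2 D \<zeta>"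
  by (rule addhom_add[OF j2_props(1)])

lemma j2_lact: "\<lbrakk>a \<in> carrier A; \<xi> \<in> carrier Omega2\<rbrakk> \<Longrightarrow> j2 D (a \<triangleright>\<^bsub>Omega2\<^esub> \<xi>) = a \<triangleright>\<^bsub>Omega1\<^esub> j2 D \<xi>"
proof -
  assume a: "a \<in> carrier A" and \<xi>: "\<xi> \<in> carrier Omega2"
  have "\<forall>\<xi>\<in>carrier Omega2. j2 D (a \<triangleright>\<^bsub>Omega2\<^esub> \<xi>) = a \<triangleright>\<^bsub>Omega1\<^esub> j2 D \<xi>"
    by (rule Omega2_eqI[OF O1.abelian_group])
      (use a in \<open>auto intro: O1.addhom_lact j2_props addhom_comp[OF j2_props(1) O2.lact_addhom]
        simp: j2_props wedge11_lact j1_lact O1.act_simps\<close>)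
  with \<xi> show ?thesis by blast
qed

lemma j2_ract: "\<lbrakk>a \<in> carrier A; \<xi> \<in> carrier Omega2\<rbrakk> \<Longrightarrow> j2 D (\<xi> \<triangleleft>\<^bsub>Omega2\<^esub> a) = j2 D \<xi> \<triangleleft>\<^bsub>Omega1\<^esub> a"
proof -
  assume a: "a \<in> carrier A" and \<xi>: "\<xi> \<in> carrier Omega2"
  have "\<forall>\<xi>\<in>carrier Omega2. j2 D (\<xi> \<triangleleft>\<^bsub>Omega2\<^esub> a) = j2 D \<xi> \<triangleleft>\<^bsub>Omega1\<^esub> a"
    by (rule Omega2_eqI[OF O1.abelian_group])
      (use a in \<open>auto intro: O1.addhom_ract j2_props addhom_comp[OF j2_props(1) O2.ract_addhom]
        simp: j2_props wedge11_ract j1_ract O1.act_simps\<close>)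
  with \<xi> show ?thesis by blast
qed

lemma j3_props:
  shows "j3 D \<in> addhom Omega3 Omega2"
    and "\<And>\<xi> \<beta>. \<lbrakk>\<xi> \<in> carrier Omega2; \<beta> \<in> carrier Omega1\<rbrakk> \<Longrightarrow>
      j3 D (wedge21 \<xi> \<beta>) = wedge11 (j2 D \<xi>) \<beta> \<oplus>\<^bsub>Omega2\<^esub> (\<xi> \<triangleleft>\<^bsub>Omega2\<^esub> j1 D \<beta>)"
proof -
  have "W3.balanced Omega2 (\<lambda>\<xi> \<beta>. wedge11 (j2 D \<xi>) \<beta> \<oplus>\<^bsub>Omega2\<^esub> (\<xi> \<triangleleft>\<^bsub>Omega2\<^esub> j1 D \<beta>))"
    by (rule W3.balancedI)
      (auto intro!: O2.addhom_plus wedge11_addhom_right O2.ract_addhom O2.addhom_ract_right j1_addhom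
        addhom_comp[OF wedge11_addhom_left j2_props(1)]
        simp: j1_lact j2_ract wedge11_balanced O2.act_simps)
  from Omega3_hom[OF O2.abelian_group this]
  show "j3 D \<in> addhom Omega3 Omega2"
    and "\<And>\<xi> \<beta>. \<lbrakk>\<xi> \<in> carrier Omega2; \<beta> \<in> carrier Omega1\<rbrakk> \<Longrightarrow>
      j3 D (wedge21 \<xi> \<beta>) = wedge11 (j2 D \<xi>) \<beta> \<oplus>\<^bsub>Omega2\<^esub> (\<xi> \<triangleleft>\<^bsub>Omega2\<^esub> j1 D \<beta>)"
    by (simp_all add: j3_def)
qed

lemma j3_closed [simp]: "\<zeta> \<in> carrier Omega3 \<Longrightarrow> j3 D \<zeta> \<in> carrier Omega2"
  by (rule addhom_closed[OF j3_props(1)])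

lemma j3_lact: "\<lbrakk>a \<in> carrier A; \<zeta> \<in> carrier Omega3\<rbrakk> \<Longrightarrow> j3 D (a \<triangleright>\<^bsub>Omega3\<^esub> \<zeta>) = a \<triangleright>\<^bsub>Omega2\<^esub> j3 D \<zeta>"
proof -
  assume a: "a \<in> carrier A" and \<zeta>: "\<zeta> \<in> carrier Omega3"
  have "\<forall>\<zeta>\<in>carrier Omega3. j3 D (a \<triangleright>\<^bsub>Omega3\<^esub> \<zeta>) = a \<triangleright>\<^bsub>Omega2\<^esub> j3 D \<zeta>"
    by (rule Omega3_eqI[OF O2.abelian_group])
      (use a in \<open>auto intro: O2.addhom_lact j3_props addhom_comp[OF j3_props(1) O3.lact_addhom]
        simp: j3_props wedge21_lact wedge11_lact j2_lact O2.act_simps\<close>)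
  with \<zeta> show ?thesis by blast
qed

lemma j3_ract: "\<lbrakk>a \<in> carrier A; \<zeta> \<in> carrier Omega3\<rbrakk> \<Longrightarrow> j3 D (\<zeta> \<triangleleft>\<^bsub>Omega3\<^esub> a) = j3 D \<zeta> \<triangleleft>\<^bsub>Omega2\<^esub> a"
proof -
  assume a: "a \<in> carrier A" and \<zeta>: "\<zeta> \<in> carrier Omega3"
  have "\<forall>\<zeta>\<in>carrier Omega3. j3 D (\<zeta> \<triangleleft>\<^bsub>Omega3\<^esub> a) = j3 D \<zeta> \<triangleleft>\<^bsub>Omega2\<^esub> a"
    by (rule Omega3_eqI[OF O2.abelian_group])
      (use a in \<open>auto intro: O2.addhom_ract j3_props addhom_comp[OF j3_props(1) O3.ract_addhom]
        simp: j3_props wedge21_ract wedge11_ract j1_ract O2.act_simps\<close>)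
  with \<zeta> show ?thesis by blast
qed

text \<open>\<open>j3\<close> is prescribed on products with the one-form at the end. The
  super-Leibniz rule with the one-form in front is needed because \<open>d2\<close> and the
  supercommutators of degree three mix both bracketings.\<close>

lemma j3_wedge12: "\<lbrakk>\<alpha> \<in> carrier Omega1; \<xi> \<in> carrier Omega2\<rbrakk> \<Longrightarrow>
    j3 D (wedge12 \<alpha> \<xi>) = j1 D \<alpha> \<triangleright>\<^bsub>Omega2\<^esub> \<xi> \<ominus>\<^bsub>Omega2\<^esub> wedge11 \<alpha> (j2 D \<xi>)"
proof -
  assume \<alpha>: "\<alpha> \<in> carrier Omega1" and \<xi>: "\<xi> \<in> carrier Omega2"
  have "\<forall>\<xi>\<in>carrier Omega2. j3 D (wedge12 \<alpha> \<xi>) = j1 D \<alpha> \<triangleright>\<^bsub>Omega2\<^esub> \<xi> \<ominus>\<^bsub>Omega2\<^esub> wedge11 \<alpha> (j2 D \<xi>)"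
  proof (rule Omega2_eqI[OF O2.abelian_group])
    show "j3 D (wedge12 \<alpha> (wedge11 \<beta> \<gamma>)) =
        j1 D \<alpha> \<triangleright>\<^bsub>Omega2\<^esub> wedge11 \<beta> \<gamma> \<ominus>\<^bsub>Omega2\<^esub> wedge11 \<alpha> (j2 D (wedge11 \<beta> \<gamma>))"
      if "\<beta> \<in> carrier Omega1" "\<gamma> \<in> carrier Omega1" for \<beta> \<gamma>
      using that \<alpha>
      by (simp add: wedge12_props j3_props j2_props wedge11_simps wedge11_lact wedge11_ract
          wedge11_balanced[symmetric] O2.diff_simps)
  qed (use \<alpha> in \<open>auto intro!: O2.addhom_diff O2.lact_addhom addhom_comp[OF j3_props(1) wedge12_props(1)]
      addhom_comp[OF wedge11_addhom_right j2_props(1)]\<close>)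
  with \<xi> show ?thesis by blast
qed

end

end

section \<open>Cartan calculus\<close>

context nc_forms
begin

lemma comm1_subgroup: "subgroup comm1 (add_monoid Omega1)"
  unfolding comm1_def by (rule O1.commutators_subgroup)

lemmas comm1_rules = O1.subgroupD_add[OF comm1_subgroup]

lemma comm1I: "\<lbrakk>a \<in> carrier A; \<alpha> \<in> carrier Omega1\<rbrakk> \<Longrightarrow> a \<triangleright>\<^bsub>Omega1\<^esub> \<alpha> \<ominus>\<^bsub>Omega1\<^esub> \<alpha> \<triangleleft>\<^bsub>Omega1\<^esub> a \<in> comm1"
  unfolding comm1_def by (rule O1.commutatorsI)

lemma A_comm_subgroup: "subgroup A_comm (add_monoid A)"
proof -
  have "subgroup A_comm (add_monoid AS)"
    unfolding A_comm_commutators by (rule AS.commutators_subgroup)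
  then show ?thesis
    by (intro subgroupI_add) (use AS.subgroupD_add[of A_comm] in auto)
qed

lemmas A_comm_rules = subgroupD_add[OF A_comm_subgroup]

lemma A_commI: "\<lbrakk>a \<in> carrier A; b \<in> carrier A\<rbrakk> \<Longrightarrow> a \<otimes> b \<ominus> b \<otimes> a \<in> A_comm"
  unfolding A_comm_commutators using AS.commutatorsI[of a b] by simp

lemma A_comm_into:
  assumes "abelian_group P" "f \<in> addhom A P" "subgroup B (add_monoid P)"
    and "\<And>a b. \<lbrakk>a \<in> carrier A; b \<in> carrier A\<rbrakk> \<Longrightarrow> f (a \<otimes> b \<ominus> b \<otimes> a) \<in> B" "x \<in> A_comm"
  shows "f x \<in> B"
  by (rule AS.commutators_into[OF assms(1) _ assms(3) _ assms(5)[unfolded A_comm_commutators]])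
    (use assms(2,4) in auto)

abbreviation comm2_gens where
  "comm2_gens \<equiv> {(a \<triangleright>\<^bsub>Omega2\<^esub> \<xi>) \<ominus>\<^bsub>Omega2\<^esub> (\<xi> \<triangleleft>\<^bsub>Omega2\<^esub> a) | a \<xi>. a \<in> carrier A \<and> \<xi> \<in> carrier Omega2} \<union>
      {wedge11 \<alpha> \<beta> \<oplus>\<^bsub>Omega2\<^esub> wedge11 \<beta> \<alpha> | \<alpha> \<beta>. \<alpha> \<in> carrier Omega1 \<and> \<beta> \<in> carrier Omega1}"

abbreviation comm3_gens where
  "comm3_gens \<equiv> {(a \<triangleright>\<^bsub>Omega3\<^esub> \<zeta>) \<ominus>\<^bsub>Omega3\<^esub> (\<zeta> \<triangleleft>\<^bsub>Omega3\<^esub> a) | a \<zeta>. a \<in> carrier A \<and> \<zeta> \<in> carrier Omega3} \<union>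
      {wedge12 \<alpha> \<xi> \<ominus>\<^bsub>Omega3\<^esub> wedge21 \<xi> \<alpha> | \<alpha> \<xi>. \<alpha> \<in> carrier Omega1 \<and> \<xi> \<in> carrier Omega2}"

lemma comm2_span: "comm2 = add_span Omega2 comm2_gens"
  by (simp add: comm2_def add_span_def)

lemma comm3_span: "comm3 = add_span Omega3 comm3_gens"
  by (simp add: comm3_def add_span_def)

lemma comm2_subgroup: "subgroup comm2 (add_monoid Omega2)"
  unfolding comm2_span by (rule O2.add_span_subgroup) auto

lemmas comm2_rules = O2.subgroupD_add[OF comm2_subgroup]

lemma comm2I:
  "\<lbrakk>a \<in> carrier A; \<xi> \<in> carrier Omega2\<rbrakk> \<Longrightarrow> (a \<triangleright>\<^bsub>Omega2\<^esub> \<xi>) \<ominus>\<^bsub>Omega2\<^esub> (\<xi> \<triangleleft>\<^bsub>Omega2\<^esub> a) \<in> comm2"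
  "\<lbrakk>\<alpha> \<in> carrier Omega1; \<beta> \<in> carrier Omega1\<rbrakk> \<Longrightarrow> wedge11 \<alpha> \<beta> \<oplus>\<^bsub>Omega2\<^esub> wedge11 \<beta> \<alpha> \<in> comm2"
  unfolding comm2_span by (rule O2.add_span_incl; blast)+

lemma comm2_into:
  assumes "abelian_group P" "f \<in> addhom Omega2 P" "subgroup B (add_monoid P)"
    and "\<And>a \<xi>. \<lbrakk>a \<in> carrier A; \<xi> \<in> carrier Omega2\<rbrakk> \<Longrightarrow> f ((a \<triangleright>\<^bsub>Omega2\<^esub> \<xi>) \<ominus>\<^bsub>Omega2\<^esub> (\<xi> \<triangleleft>\<^bsub>Omega2\<^esub> a)) \<in> B"
    and "\<And>\<alpha> \<beta>. \<lbrakk>\<alpha> \<in> carrier Omega1; \<beta> \<in> carrier Omega1\<rbrakk> \<Longrightarrow> f (wedge11 \<alpha> \<beta> \<oplus>\<^bsub>Omega2\<^esub> wedge11 \<beta> \<alpha>) \<in> B"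
    and "x \<in> comm2"
  shows "f x \<in> B"
  by (rule addhom_span_into[OF O2.abelian_group assms(1-3) _ _ assms(6)[unfolded comm2_span]])
    (use assms(4,5) in auto)

lemma comm3_into:
  assumes "abelian_group P" "f \<in> addhom Omega3 P" "subgroup B (add_monoid P)"
    and "\<And>a \<zeta>. \<lbrakk>a \<in> carrier A; \<zeta> \<in> carrier Omega3\<rbrakk> \<Longrightarrow> f ((a \<triangleright>\<^bsub>Omega3\<^esub> \<zeta>) \<ominus>\<^bsub>Omega3\<^esub> (\<zeta> \<triangleleft>\<^bsub>Omega3\<^esub> a)) \<in> B"
    and "\<And>\<alpha> \<xi>. \<lbrakk>\<alpha> \<in> carrier Omega1; \<xi> \<in> carrier Omega2\<rbrakk> \<Longrightarrow> f (wedge12 \<alpha> \<xi> \<ominus>\<^bsub>Omega3\<^esub> wedge21 \<xi> \<alpha>) \<in> B"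
    and "x \<in> comm3"
  shows "f x \<in> B"
  by (rule addhom_span_into[OF O3.abelian_group assms(1-3) _ _ assms(6)[unfolded comm3_span]])
    (use assms(4,5) in auto)

text \<open>The sign in d(\<alpha>a) = d\<alpha> a - \<alpha> da produces da \<alpha> + \<alpha> da,
  a supercommutator of one-forms, beside a commutator with a two-form. With the analogous facts for
  contractions, d and i_D act on DR while all computations stay in Omega.\<close>

lemma d1_comm1: "\<alpha> \<in> comm1 \<Longrightarrow> d1 \<alpha> \<in> comm2"
proof -
  assume "\<alpha> \<in> comm1"
  then have "\<alpha> \<in> commutators A Omega1" by (simp add: comm1_def)
  then show ?thesis
  proof (rule O1.commutators_into[OF O2.abelian_group d1_props(1) comm2_subgroup, rotated])
    fix a \<alpha> assume a: "a \<in> carrier A" "\<alpha> \<in> carrier Omega1"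
    have "d1 (a \<triangleright>\<^bsub>Omega1\<^esub> \<alpha> \<ominus>\<^bsub>Omega1\<^esub> \<alpha> \<triangleleft>\<^bsub>Omega1\<^esub> a) =
      (wedge11 (d0 a) \<alpha> \<oplus>\<^bsub>Omega2\<^esub> wedge11 \<alpha> (d0 a)) \<oplus>\<^bsub>Omega2\<^esub> ((a \<triangleright>\<^bsub>Omega2\<^esub> d1 \<alpha>) \<ominus>\<^bsub>Omega2\<^esub> (d1 \<alpha> \<triangleleft>\<^bsub>Omega2\<^esub> a))"
      using a by (simp add: d1_diff d1_lact d1_ract O2.diff_simps)
    also have "\<dots> \<in> comm2"
      using a by (intro comm2_rules(3) comm2I) auto
    finally show "d1 (a \<triangleright>\<^bsub>Omega1\<^esub> \<alpha> \<ominus>\<^bsub>Omega1\<^esub> \<alpha> \<triangleleft>\<^bsub>Omega1\<^esub> a) \<in> comm2" .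
  qed
qed

context
  fixes D assumes D: "deriv AS D"
begin

lemmas [simp] = D_closed[OF D] j1_closed[OF D] j2_closed[OF D] j3_closed[OF D] j1_d0[OF D]

lemma j1_comm1: "\<alpha> \<in> comm1 \<Longrightarrow> j1 D \<alpha> \<in> A_comm"
proof -
  assume "\<alpha> \<in> comm1"
  then have "\<alpha> \<in> commutators A Omega1" by (simp add: comm1_def)
  then show ?thesis
    by (rule O1.commutators_into[OF is_abelian_group j1_addhom[OF D] A_comm_subgroup, rotated])
      (simp add: j1_diff[OF D] j1_lact[OF D] j1_ract[OF D] A_commI)
qed

lemma j2_comm2: "\<xi> \<in> comm2 \<Longrightarrow> j2 D \<xi> \<in> comm1"
proof (rule comm2_into[OF O1.abelian_group j2_props(1)[OF D] comm1_subgroup])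
  fix \<alpha> \<beta> assume ab: "\<alpha> \<in> carrier Omega1" "\<beta> \<in> carrier Omega1"
  have "j2 D (wedge11 \<alpha> \<beta> \<oplus>\<^bsub>Omega2\<^esub> wedge11 \<beta> \<alpha>) =
    (j1 D \<alpha> \<triangleright>\<^bsub>Omega1\<^esub> \<beta> \<ominus>\<^bsub>Omega1\<^esub> \<beta> \<triangleleft>\<^bsub>Omega1\<^esub> j1 D \<alpha>) \<oplus>\<^bsub>Omega1\<^esub> (j1 D \<beta> \<triangleright>\<^bsub>Omega1\<^esub> \<alpha> \<ominus>\<^bsub>Omega1\<^esub> \<alpha> \<triangleleft>\<^bsub>Omega1\<^esub> j1 D \<beta>)"
    using ab by (simp add: j2_add[OF D] j2_props[OF D] O1.diff_simps)
  also have "\<dots> \<in> comm1"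
    using ab by (intro comm1_rules(3) comm1I) auto
  finally show "j2 D (wedge11 \<alpha> \<beta> \<oplus>\<^bsub>Omega2\<^esub> wedge11 \<beta> \<alpha>) \<in> comm1" .
qed (simp add: j2_diff[OF D] j2_lact[OF D] j2_ract[OF D] comm1I)

lemma j3_comm3: "\<zeta> \<in> comm3 \<Longrightarrow> j3 D \<zeta> \<in> comm2"
proof (rule comm3_into[OF O2.abelian_group j3_props(1)[OF D] comm2_subgroup])
  note diff = addhom_minus[OF j3_props(1)[OF D] O3.abelian_group O2.abelian_group]
  show "j3 D (a \<triangleright>\<^bsub>Omega3\<^esub> \<zeta> \<ominus>\<^bsub>Omega3\<^esub> \<zeta> \<triangleleft>\<^bsub>Omega3\<^esub> a) \<in> comm2" if "a \<in> carrier A" "\<zeta> \<in> carrier Omega3" for a \<zeta>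
    using that by (simp add: diff j3_lact[OF D] j3_ract[OF D] comm2I)
  fix \<alpha> \<xi> assume ax: "\<alpha> \<in> carrier Omega1" "\<xi> \<in> carrier Omega2"
  have "j3 D (wedge12 \<alpha> \<xi> \<ominus>\<^bsub>Omega3\<^esub> wedge21 \<xi> \<alpha>) =
    (j1 D \<alpha> \<triangleright>\<^bsub>Omega2\<^esub> \<xi> \<ominus>\<^bsub>Omega2\<^esub> \<xi> \<triangleleft>\<^bsub>Omega2\<^esub> j1 D \<alpha>) \<ominus>\<^bsub>Omega2\<^esub> (wedge11 \<alpha> (j2 D \<xi>) \<oplus>\<^bsub>Omega2\<^esub> wedge11 (j2 D \<xi>) \<alpha>)"
    using ax by (simp add: diff j3_props[OF D] j3_wedge12[OF D] O2.diff_simps)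
  also have "\<dots> \<in> comm2"
    using ax by (intro comm2_rules(5) comm2I) auto
  finally show "j3 D (wedge12 \<alpha> \<xi> \<ominus>\<^bsub>Omega3\<^esub> wedge21 \<xi> \<alpha>) \<in> comm2" .
qed

definition lie_deriv :: "('a \<times> 'a) frag set \<Rightarrow> ('a \<times> 'a) frag set" where
  "lie_deriv \<alpha> = d0 (j1 D \<alpha>) \<oplus>\<^bsub>Omega1\<^esub> j2 D (d1 \<alpha>)"

lemma lie_deriv_closed [simp]: "\<alpha> \<in> carrier Omega1 \<Longrightarrow> lie_deriv \<alpha> \<in> carrier Omega1"
  by (simp add: lie_deriv_def)

lemma lie_deriv_addhom: "lie_deriv \<in> addhom Omega1 Omega1"
  unfolding lie_deriv_def
  by (intro O1.addhom_plus addhom_comp[OF d0_addhom j1_addhom[OF D]] addhom_comp[OF j2_props(1)[OF D] d1_props(1)])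

text \<open>In d i_D + i_D d applied to a\<alpha> the two occurrences of da i_D(\<alpha>) cancel,
  and what remains is the rule of a derivation extending D.\<close>

lemma lie_deriv_lact: "\<lbrakk>a \<in> carrier A; \<alpha> \<in> carrier Omega1\<rbrakk> \<Longrightarrow>
    lie_deriv (a \<triangleright>\<^bsub>Omega1\<^esub> \<alpha>) = D a \<triangleright>\<^bsub>Omega1\<^esub> \<alpha> \<oplus>\<^bsub>Omega1\<^esub> a \<triangleright>\<^bsub>Omega1\<^esub> lie_deriv \<alpha>"
  by (simp add: lie_deriv_def j1_lact[OF D] d1_lact d0_mult j2_add[OF D] j2_props[OF D] j2_lact[OF D] O1.lact_add
      O1.diff_simps)

lemma lie_deriv_ract: "\<lbrakk>a \<in> carrier A; \<alpha> \<in> carrier Omega1\<rbrakk> \<Longrightarrow>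
    lie_deriv (\<alpha> \<triangleleft>\<^bsub>Omega1\<^esub> a) = lie_deriv \<alpha> \<triangleleft>\<^bsub>Omega1\<^esub> a \<oplus>\<^bsub>Omega1\<^esub> \<alpha> \<triangleleft>\<^bsub>Omega1\<^esub> D a"
  by (simp add: lie_deriv_def j1_ract[OF D] d1_ract d0_mult j2_diff[OF D] j2_props[OF D] j2_ract[OF D] O1.ract_add
      O1.diff_simps)

lemma lie_deriv_d0: "a \<in> carrier A \<Longrightarrow> lie_deriv (d0 a) = d0 (D a)"
  by (simp add: lie_deriv_def addhom_zero[OF j2_props(1)[OF D] O2.abelian_group O1.abelian_group])

text \<open>Cartan's formula in degree two. No separate Lie derivative on two-forms is introduced: d
  i_D + i_D d stands for it, and the right-hand side is the extension of \<open>lie_deriv\<close> to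
  products as a derivation.\<close>

lemma cartan2: "\<lbrakk>\<alpha> \<in> carrier Omega1; \<beta> \<in> carrier Omega1\<rbrakk> \<Longrightarrow>
    d1 (j2 D (wedge11 \<alpha> \<beta>)) \<oplus>\<^bsub>Omega2\<^esub> j3 D (d2 (wedge11 \<alpha> \<beta>)) =
    wedge11 (lie_deriv \<alpha>) \<beta> \<oplus>\<^bsub>Omega2\<^esub> wedge11 \<alpha> (lie_deriv \<beta>)"
  by (simp add: lie_deriv_def j2_props[OF D] d2_props d1_diff d1_lact d1_ract
      addhom_minus[OF j3_props(1)[OF D] O3.abelian_group O2.abelian_group]
      j3_props[OF D] j3_wedge12[OF D] wedge11_simps O2.diff_simps)

end

lemma mult_diff: "\<lbrakk>x \<in> carrier A; y \<in> carrier A; z \<in> carrier A\<rbrakk> \<Longrightarrow> x \<otimes> (y \<ominus> z) = x \<otimes> y \<ominus> x \<otimes> z"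
  by (simp add: a_minus_def r_distr r_minus)

lemma diff_mult: "\<lbrakk>x \<in> carrier A; y \<in> carrier A; z \<in> carrier A\<rbrakk> \<Longrightarrow> (y \<ominus> z) \<otimes> x = y \<otimes> x \<ominus> z \<otimes> x"
  by (simp add: a_minus_def l_distr l_minus)

lemma deriv_bracket:
  assumes D: "deriv AS D" and E: "deriv AS E"
  shows "deriv AS (\<lambda>x\<in>carrier A. D (E x) \<ominus> E (D x))"
proof -
  note d = derivD[OF D] derivD[OF E]
  have z: "D \<zero> = \<zero>" "E \<zero> = \<zero>"
    using addhom_zero[of D A A] addhom_zero[of E A A] d is_abelian_group by auto
  show ?thesis
    unfolding deriv_def
  proof (intro conjI ballI)
    show "(\<lambda>x\<in>carrier A. D (E x) \<ominus> E (D x)) \<in> addhom A AS"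
      using d by (simp add: addhom_iff diff_simps)
    show "(\<lambda>x\<in>carrier A. D (E x) \<ominus> E (D x)) (x \<otimes> y) =
        x \<triangleright>\<^bsub>AS\<^esub> (\<lambda>x\<in>carrier A. D (E x) \<ominus> E (D x)) y \<oplus>\<^bsub>AS\<^esub> (\<lambda>x\<in>carrier A. D (E x) \<ominus> E (D x)) x \<triangleleft>\<^bsub>AS\<^esub> y"
      if "x \<in> carrier A" "y \<in> carrier A" for x y
      using d that by (simp add: mult_diff diff_mult diff_simps)
  qed (use d z in \<open>simp_all add: diff_self\<close>)
qed

text \<open>The degree-one case of the commutation rule between Lie derivative and contraction,
  where the Lie derivative on A is D itself. On u dv it comes down to L_D(u dv) = D(u) dv + u
  d(Dv).\<close>

lemma j1_bracket:
  assumes D: "deriv AS D" and E: "deriv AS E" and \<alpha>: "\<alpha> \<in> carrier Omega1"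
  shows "j1 (\<lambda>x\<in>carrier A. D (E x) \<ominus> E (D x)) \<alpha> = D (j1 E \<alpha>) \<ominus> j1 E (lie_deriv D \<alpha>)" (is "j1 ?B \<alpha> = _")
proof -
  note B = deriv_bracket[OF D E]
  note [simp] = D_closed[OF D] D_closed[OF E] j1_closed[OF D] j1_closed[OF E]
  have "\<forall>\<alpha>\<in>carrier Omega1. j1 ?B \<alpha> = D (j1 E \<alpha>) \<ominus> j1 E (lie_deriv D \<alpha>)"
  proof (rule Omega1_eqI[OF is_abelian_group j1_addhom[OF B]])
    show "(\<lambda>\<alpha>. D (j1 E \<alpha>) \<ominus> j1 E (lie_deriv D \<alpha>)) \<in> addhom Omega1 A"
      using derivD(1)[OF D]
      by (intro addhom_diff addhom_comp[OF _ j1_addhom[OF E]] addhom_comp[OF j1_addhom[OF E] lie_deriv_addhom[OF D]]) simp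
    show "j1 ?B (u \<triangleright>\<^bsub>Omega1\<^esub> d0 v) =
        D (j1 E (u \<triangleright>\<^bsub>Omega1\<^esub> d0 v)) \<ominus> j1 E (lie_deriv D (u \<triangleright>\<^bsub>Omega1\<^esub> d0 v))"
      if "u \<in> carrier A" "v \<in> carrier A" for u v
      using that derivD(4)[OF D, of u "E v"]
      by (simp add: j1_udv[OF B] j1_udv[OF E] lie_deriv_lact[OF D] lie_deriv_d0[OF D] addhom_add[OF j1_addhom[OF E]]
          mult_diff diff_simps)
  qed
  with \<alpha> show ?thesis by blast
qed

text \<open>The commutation rule one degree up, with the Lie derivative on two-forms written out as
  d i_D + i_D d. It holds in Omega^1 without a quotient, because on \<alpha>\<beta> everything
  reduces by \<open>cartan2\<close> to the case of one-forms.\<close>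

lemma j2_bracket:
  assumes D: "deriv AS D" and E: "deriv AS E" and \<xi>: "\<xi> \<in> carrier Omega2"
  shows "j2 (\<lambda>x\<in>carrier A. D (E x) \<ominus> E (D x)) \<xi> =
    lie_deriv D (j2 E \<xi>) \<ominus>\<^bsub>Omega1\<^esub> j2 E (d1 (j2 D \<xi>) \<oplus>\<^bsub>Omega2\<^esub> j3 D (d2 \<xi>))" (is "j2 ?B \<xi> = _")
proof -
  note B = deriv_bracket[OF D E]
  note [simp] = D_closed[OF D] D_closed[OF E] j1_closed[OF D] j1_closed[OF E] j2_closed[OF D] j2_closed[OF E]
    j3_closed[OF D] lie_deriv_closed[OF D]
  have "\<forall>\<xi>\<in>carrier Omega2. j2 ?B \<xi> =
    lie_deriv D (j2 E \<xi>) \<ominus>\<^bsub>Omega1\<^esub> j2 E (d1 (j2 D \<xi>) \<oplus>\<^bsub>Omega2\<^esub> j3 D (d2 \<xi>))"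
  proof (rule Omega2_eqI[OF O1.abelian_group j2_props(1)[OF B]])
    show "(\<lambda>\<xi>. lie_deriv D (j2 E \<xi>) \<ominus>\<^bsub>Omega1\<^esub> j2 E (d1 (j2 D \<xi>) \<oplus>\<^bsub>Omega2\<^esub> j3 D (d2 \<xi>))) \<in> addhom Omega2 Omega1"
      by (intro O1.addhom_diff addhom_comp[OF lie_deriv_addhom[OF D] j2_props(1)[OF E]] addhom_comp[OF j2_props(1)[OF E]]
          O2.addhom_plus addhom_comp[OF d1_props(1) j2_props(1)[OF D]] addhom_comp[OF j3_props(1)[OF D] d2_props(1)])
    fix \<alpha> \<beta> assume ab: "\<alpha> \<in> carrier Omega1" "\<beta> \<in> carrier Omega1"
    show "j2 ?B (wedge11 \<alpha> \<beta>) = lie_deriv D (j2 E (wedge11 \<alpha> \<beta>)) \<ominus>\<^bsub>Omega1\<^esub>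
        j2 E (d1 (j2 D (wedge11 \<alpha> \<beta>)) \<oplus>\<^bsub>Omega2\<^esub> j3 D (d2 (wedge11 \<alpha> \<beta>)))"
      unfolding cartan2[OF D ab] using ab
      by (simp add: j2_add[OF E] j2_props[OF B] j2_props[OF E] j1_bracket[OF D E]
          addhom_minus[OF lie_deriv_addhom[OF D] O1.abelian_group O1.abelian_group] lie_deriv_lact[OF D] lie_deriv_ract[OF D]
          O1.lact_diff_left O1.ract_diff_right O1.diff_simps)
  qed
  with \<xi> show ?thesis by blast
qed

text \<open>On \<alpha>\<beta> the two terms i_D(\<alpha>) i_D(\<beta>) cancel. This is the source
  of the skew-symmetry of the bracket.\<close>

lemma j1_j2_self:
  assumes D: "deriv AS D" and \<xi>: "\<xi> \<in> carrier Omega2"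
  shows "j1 D (j2 D \<xi>) = \<zero>"
proof -
  note [simp] = j1_closed[OF D]
  have "\<forall>\<xi>\<in>carrier Omega2. j1 D (j2 D \<xi>) = \<zero>"
    by (rule Omega2_eqI[OF is_abelian_group addhom_comp[OF j1_addhom[OF D] j2_props(1)[OF D]] addhom_const_zero])
      (simp add: j2_props[OF D] j1_diff[OF D] j1_lact[OF D] j1_ract[OF D] diff_self)
  with \<xi> show ?thesis by blast
qed

subsection \<open>Double derivations\<close>

text \<open>The contraction of one-forms by \<Theta>: sandwiching the unit sends x \<otimes> y to
  yx, which is the diamond operation in degree zero.\<close>

definition kap :: "('a \<Rightarrow> ('a \<times> 'a) frag set) \<Rightarrow> ('a \<times> 'a) frag set \<Rightarrow> 'a" where
  "kap \<Theta> \<alpha> = AS.sand \<one> (i1 \<Theta> \<alpha>)"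

context
  fixes \<Theta> assumes \<Theta>: "deriv AA \<Theta>"
begin

lemma i1_addhom: "i1 \<Theta> \<in> addhom Omega1 AA"
  and i1_udv: "\<And>u v. \<lbrakk>u \<in> carrier A; v \<in> carrier A\<rbrakk> \<Longrightarrow> i1 \<Theta> (u \<triangleright>\<^bsub>Omega1\<^esub> d0 v) = u \<triangleright>\<^bsub>AA\<^esub> \<Theta> v"
  and i1_closed [simp]: "\<And>\<alpha>. \<alpha> \<in> carrier Omega1 \<Longrightarrow> i1 \<Theta> \<alpha> \<in> carrier AA"
  and i1_d0 [simp]: "\<And>a. a \<in> carrier A \<Longrightarrow> i1 \<Theta> (d0 a) = \<Theta> a"
  and i1_lact: "\<And>a \<alpha>. \<lbrakk>a \<in> carrier A; \<alpha> \<in> carrier Omega1\<rbrakk> \<Longrightarrow> i1 \<Theta> (a \<triangleright>\<^bsub>Omega1\<^esub> \<alpha>) = a \<triangleright>\<^bsub>AA\<^esub> i1 \<Theta> \<alpha>"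
  and i1_ract: "\<And>a \<alpha>. \<lbrakk>a \<in> carrier A; \<alpha> \<in> carrier Omega1\<rbrakk> \<Longrightarrow> i1 \<Theta> (\<alpha> \<triangleleft>\<^bsub>Omega1\<^esub> a) = i1 \<Theta> \<alpha> \<triangleleft>\<^bsub>AA\<^esub> a"
  using ext_deriv_props[OF AA.bimod \<Theta>] ext_deriv_closed[OF AA.bimod \<Theta>] ext_deriv_d0[OF AA.bimod \<Theta>]
    ext_deriv_lact[OF AA.bimod \<Theta>] ext_deriv_ract[OF AA.bimod \<Theta>]
  by (simp_all add: i1_eq)

lemma Theta_closed [simp]: "x \<in> carrier A \<Longrightarrow> \<Theta> x \<in> carrier AA"
  by (rule derivD(2)[OF \<Theta>])

lemma iota2_props:
  shows "iota2 \<Theta> \<in> addhom Omega2 Omega1"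
    and "\<And>\<alpha> \<beta>. \<lbrakk>\<alpha> \<in> carrier Omega1; \<beta> \<in> carrier Omega1\<rbrakk> \<Longrightarrow>
      iota2 \<Theta> (wedge11 \<alpha> \<beta>) = O1.sand \<beta> (i1 \<Theta> \<alpha>) \<ominus>\<^bsub>Omega1\<^esub> O1.sand \<alpha> (i1 \<Theta> \<beta>)"
proof -
  have "W2.balanced Omega1 (\<lambda>\<alpha> \<beta>. O1.sand \<beta> (i1 \<Theta> \<alpha>) \<ominus>\<^bsub>Omega1\<^esub> O1.sand \<alpha> (i1 \<Theta> \<beta>))"
    by (rule W2.balancedI)
      (auto intro!: O1.addhom_diff O1.sand_addhom_left addhom_comp[OF O1.sand_props(1) i1_addhom]
        simp: i1_lact i1_ract O1.sand_lact O1.sand_ract)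
  from Omega2_hom[OF O1.abelian_group this]
  show "iota2 \<Theta> \<in> addhom Omega2 Omega1"
    and "\<And>\<alpha> \<beta>. \<lbrakk>\<alpha> \<in> carrier Omega1; \<beta> \<in> carrier Omega1\<rbrakk> \<Longrightarrow>
      iota2 \<Theta> (wedge11 \<alpha> \<beta>) = O1.sand \<beta> (i1 \<Theta> \<alpha>) \<ominus>\<^bsub>Omega1\<^esub> O1.sand \<alpha> (i1 \<Theta> \<beta>)"
    by (simp_all add: iota2_def sandwich_eq)
qed

lemma iota2_closed [simp]: "\<xi> \<in> carrier Omega2 \<Longrightarrow> iota2 \<Theta> \<xi> \<in> carrier Omega1"
  by (rule addhom_closed[OF iota2_props(1)])

text \<open>In the sandwich an outer factor a of a two-form ends up in the middle from either side,
  so a\<xi> and \<xi>a have equal contractions; on \<alpha>\<beta> + \<beta>\<alpha> the terms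
  cancel in pairs. The value is zero and not just a commutator, so contraction is a map from DR^2 to
  Omega^1 itself.\<close>

lemma iota2_comm2: "\<xi> \<in> comm2 \<Longrightarrow> iota2 \<Theta> \<xi> = \<zero>\<^bsub>Omega1\<^esub>"
proof -
  assume \<xi>: "\<xi> \<in> comm2"
  note add = addhom_add[OF iota2_props(1)] addhom_minus[OF iota2_props(1) O2.abelian_group O1.abelian_group]
  have sub: "subgroup {\<zero>\<^bsub>Omega1\<^esub>} (add_monoid Omega1)"
    by (rule O1.subgroupI_add) (auto simp: O1.diff_self)
  have "iota2 \<Theta> \<xi> \<in> {\<zero>\<^bsub>Omega1\<^esub>}"
  proof (rule comm2_into[OF O1.abelian_group iota2_props(1) sub _ _ \<xi>])
    show "iota2 \<Theta> (a \<triangleright>\<^bsub>Omega2\<^esub> \<xi> \<ominus>\<^bsub>Omega2\<^esub> \<xi> \<triangleleft>\<^bsub>Omega2\<^esub> a) \<in> {\<zero>\<^bsub>Omega1\<^esub>}"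
      if a: "a \<in> carrier A" and \<xi>: "\<xi> \<in> carrier Omega2" for a \<xi>
    proof -
      have "\<forall>\<xi>\<in>carrier Omega2. iota2 \<Theta> (a \<triangleright>\<^bsub>Omega2\<^esub> \<xi>) = iota2 \<Theta> (\<xi> \<triangleleft>\<^bsub>Omega2\<^esub> a)"
        by (rule Omega2_eqI[OF O1.abelian_group addhom_comp[OF iota2_props(1) O2.lact_addhom]
              addhom_comp[OF iota2_props(1) O2.ract_addhom]])
          (use a in \<open>auto simp: iota2_props wedge11_lact wedge11_ract i1_lact i1_ract O1.sand_lact O1.sand_ract\<close>)
      with a \<xi> show ?thesis by (simp add: add O1.diff_self)
    qed
  qed (simp add: add iota2_props O1.diff_simps)
  then show ?thesis by simp
qed

lemma der_of_deriv: "deriv AS (der_of \<Theta>)"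
proof -
  note d = derivD[OF \<Theta>]
  show ?thesis
    unfolding deriv_def
    using d addhom_add[OF mult2_props(1)] addhom_zero[OF mult2_props(1) AA.abelian_group is_abelian_group]
    by (auto simp: addhom_iff der_of_def mult2_lact mult2_ract)
qed

lemma j1_der_of: "\<alpha> \<in> carrier Omega1 \<Longrightarrow> j1 (der_of \<Theta>) \<alpha> = mult2 K A (i1 \<Theta> \<alpha>)"
proof -
  assume \<alpha>: "\<alpha> \<in> carrier Omega1"
  have "\<forall>\<alpha>\<in>carrier Omega1. j1 (der_of \<Theta>) \<alpha> = mult2 K A (i1 \<Theta> \<alpha>)"
    by (rule Omega1_eqI[OF is_abelian_group j1_addhom[OF der_of_deriv] addhom_comp[OF mult2_props(1) i1_addhom]])
      (simp add: j1_udv[OF der_of_deriv] i1_udv mult2_lact, simp add: der_of_def)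
  with \<alpha> show ?thesis by blast
qed

text \<open>On \<alpha>\<beta> the two sandwiches rotate by \<open>sand_left\<close> and
  \<open>sand_right\<close> into i_D(\<alpha>) \<beta> and \<alpha> i_D(\<beta>), where D is the
  derivation attached to \<Theta>.\<close>

lemma iota2_j2: "\<xi> \<in> carrier Omega2 \<Longrightarrow> iota2 \<Theta> \<xi> \<ominus>\<^bsub>Omega1\<^esub> j2 (der_of \<Theta>) \<xi> \<in> comm1"
proof -
  note D = der_of_deriv
  note [simp] = j1_closed[OF D] j2_closed[OF D]
  let ?f = "\<lambda>\<xi>. iota2 \<Theta> \<xi> \<ominus>\<^bsub>Omega1\<^esub> j2 (der_of \<Theta>) \<xi>"
  have f: "?f \<in> addhom Omega2 Omega1"
    by (intro O1.addhom_diff iota2_props j2_props D)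
  assume "\<xi> \<in> carrier Omega2"
  then have \<xi>: "\<xi> \<in> add_span Omega2 {wedge11 \<alpha> \<beta> | \<alpha> \<beta>. \<alpha> \<in> carrier Omega1 \<and> \<beta> \<in> carrier Omega1}"
    using W2.tens_span by (auto simp: Omega2_def wedge11_def)
  show ?thesis
  proof (rule addhom_span_into[where f = ?f, OF O2.abelian_group O1.abelian_group f comm1_subgroup _ _ \<xi>])
    fix x assume "x \<in> {wedge11 \<alpha> \<beta> | \<alpha> \<beta>. \<alpha> \<in> carrier Omega1 \<and> \<beta> \<in> carrier Omega1}"
    then obtain \<alpha> \<beta> where x: "x = wedge11 \<alpha> \<beta>" and ab: "\<alpha> \<in> carrier Omega1" "\<beta> \<in> carrier Omega1"
      by blast
    have "?f x = (O1.sand \<beta> (i1 \<Theta> \<alpha>) \<ominus>\<^bsub>Omega1\<^esub> mult2 K A (i1 \<Theta> \<alpha>) \<triangleright>\<^bsub>Omega1\<^esub> \<beta>) \<ominus>\<^bsub>Omega1\<^esub>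
        (O1.sand \<alpha> (i1 \<Theta> \<beta>) \<ominus>\<^bsub>Omega1\<^esub> \<alpha> \<triangleleft>\<^bsub>Omega1\<^esub> mult2 K A (i1 \<Theta> \<beta>))"
      using ab by (simp add: x iota2_props j2_props[OF D] j1_der_of O1.diff_simps)
    also have "\<dots> \<in> comm1"
      using ab comm1_rules(5)[OF O1.sand_left[folded comm1_def] O1.sand_right[folded comm1_def]] by simp
    finally show "?f x \<in> comm1" .
  qed auto
qed

lemma kap_addhom: "kap \<Theta> \<in> addhom Omega1 A"
  using addhom_comp[OF AS.sand_props(1) i1_addhom, of \<one>] by (simp add: kap_def[abs_def])

text \<open>If \<alpha> contracts to x \<otimes> y, then a\<alpha> and \<alpha>a both give y a x.
  Hence this contraction kills [A, Omega^1] and can test equations that are known only in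
  DR^1.\<close>

lemma kap_act:
  "\<lbrakk>a \<in> carrier A; \<alpha> \<in> carrier Omega1\<rbrakk> \<Longrightarrow> kap \<Theta> (a \<triangleright>\<^bsub>Omega1\<^esub> \<alpha>) = AS.sand a (i1 \<Theta> \<alpha>)"
  "\<lbrakk>a \<in> carrier A; \<alpha> \<in> carrier Omega1\<rbrakk> \<Longrightarrow> kap \<Theta> (\<alpha> \<triangleleft>\<^bsub>Omega1\<^esub> a) = AS.sand a (i1 \<Theta> \<alpha>)"
  using AS.sand_ract[of a \<one>] AS.sand_lact[of a \<one>] by (simp_all add: kap_def i1_lact i1_ract)

lemma kap_diff: "\<lbrakk>\<alpha> \<in> carrier Omega1; \<beta> \<in> carrier Omega1\<rbrakk> \<Longrightarrow> kap \<Theta> (\<alpha> \<ominus>\<^bsub>Omega1\<^esub> \<beta>) = kap \<Theta> \<alpha> \<ominus> kap \<Theta> \<beta>"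
  by (rule addhom_minus[OF kap_addhom O1.abelian_group is_abelian_group])

lemma kap_comm1: "\<alpha> \<in> comm1 \<Longrightarrow> kap \<Theta> \<alpha> = \<zero>"
  using O1.commutators_kernel[OF is_abelian_group kap_addhom] by (simp add: comm1_def kap_act)

text \<open>i_D is a bimodule map on one-forms and so passes through sandwiches; on \<alpha>\<beta>
  both compositions are then built from the same two terms, i_D(\<alpha>) sandwiched by the
  contraction of \<beta> and vice versa, with exchanged signs. The equality is exact in A.\<close>

lemma j1_iota2:
  assumes D: "deriv AS D" and \<xi>: "\<xi> \<in> carrier Omega2"
  shows "j1 D (iota2 \<Theta> \<xi>) = \<ominus> kap \<Theta> (j2 D \<xi>)"
proof -
  note [simp] = j1_closed[OF D] j2_closed[OF D]
  have js: "j1 D (O1.sand \<beta> t) = AS.sand (j1 D \<beta>) t" if "\<beta> \<in> carrier Omega1" "t \<in> carrier AA" for \<beta> t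
    using ext_deriv_sand[OF D that] by (simp add: j1_def)
  have sc: "AS.sand a t \<in> carrier A" if "a \<in> carrier A" "t \<in> carrier AA" for a t
    using AS.sand_closed[of a t] that by simp
  have "\<forall>\<xi>\<in>carrier Omega2. j1 D (iota2 \<Theta> \<xi>) = \<ominus> kap \<Theta> (j2 D \<xi>)"
    by (rule Omega2_eqI[OF is_abelian_group addhom_comp[OF j1_addhom[OF D] iota2_props(1)]
          addhom_neg[OF addhom_comp[OF kap_addhom j2_props(1)[OF D]]]])
      (simp add: iota2_props j2_props[OF D] j1_diff[OF D] kap_diff js kap_act sc diff_simps)
  with \<xi> show ?thesis by blast
qed

end

end

section \<open>Hamiltonian derivations\<close>

context abelian_group
begin

lemma coset_mem:
  assumes "subgroup H (add_monoid G)" "a \<in> carrier G"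
  shows "x \<in> H +> a \<longleftrightarrow> x \<in> carrier G \<and> x \<ominus> a \<in> H"
proof -
  note H = subgroupD_add[OF assms(1)]
  have "x = (x \<ominus> a) \<oplus> a" if "x \<in> carrier G"
    using that assms(2) by (simp add: diff_simps)
  moreover have "(h \<oplus> a) \<ominus> a = h" if "h \<in> H" for h
    using that assms(2) H(1) by (auto simp: diff_simps)
  ultimately show ?thesis
    using assms(2) H(1) by (auto simp: a_r_coset_def')
qed

lemma coset_self: "\<lbrakk>subgroup H (add_monoid G); a \<in> carrier G\<rbrakk> \<Longrightarrow> a \<in> H +> a"
  by (simp add: coset_mem diff_self subgroupD_add(2))

lemma coset_eq_iff:
  assumes H: "subgroup H (add_monoid G)" and ab: "a \<in> carrier G" "b \<in> carrier G"
  shows "H +> a = H +> b \<longleftrightarrow> a \<ominus> b \<in> H"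
proof
  assume "H +> a = H +> b"
  then show "a \<ominus> b \<in> H"
    using coset_self[OF H ab(1)] coset_mem[OF H ab(2)] by simp
next
  assume "a \<ominus> b \<in> H"
  then have "b \<ominus> a \<in> H"
    using subgroupD_add(4)[OF H] ab neg_of_diff by metis
  then have "b \<in> H +> a"
    using ab by (simp add: coset_mem[OF H])
  then show "H +> a = H +> b"
    by (rule a_repr_independence[OF _ ab(1) H])
qed

end

text \<open>Maps on quotients are encoded as the single element of an image; this evaluates them at
  a representative.\<close>

lemma the_elem_constant: "\<lbrakk>x \<in> X; \<And>x. x \<in> X \<Longrightarrow> f x = c\<rbrakk> \<Longrightarrow> the_elem (f ` X) = c"
proof -
  assume "x \<in> X" "\<And>x. x \<in> X \<Longrightarrow> f x = c"
  then have "f ` X = {c}" by auto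
  then show ?thesis by simp
qed

lemma carrier_A_Mod: "carrier (M A_Mod H) = {H +>\<^bsub>M\<^esub> a | a. a \<in> carrier M}"
  by (auto simp: A_FactGroup_def FactGroup_def RCOSETS_def a_r_coset_def)

section \<open>Derivations and double derivations as modules\<close>

context nc_forms
begin

context
  fixes M :: "('a, 'm, 'a) bimodule"
  assumes M: "central_bimod K A M"
begin

interpretation M: central_bimod K A M by (rule M)

lemma deriv_zero: "deriv M (\<lambda>x\<in>carrier A. \<zero>\<^bsub>M\<^esub>)"
  by (simp add: deriv_def addhom_iff)

lemma deriv_plus:
  assumes "deriv M D" "deriv M E"
  shows "deriv M (\<lambda>x\<in>carrier A. D x \<oplus>\<^bsub>M\<^esub> E x)"
  using derivD[OF assms(1)] derivD[OF assms(2)]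
  by (simp add: deriv_def addhom_iff M.act_simps M.a_ac)

lemma deriv_neg:
  assumes "deriv M D"
  shows "deriv M (\<lambda>x\<in>carrier A. \<ominus>\<^bsub>M\<^esub> D x)"
  using derivD[OF assms] by (simp add: deriv_def addhom_iff M.act_simps M.minus_add M.a_ac)

lemma deriv_smult:
  assumes "deriv M D" "c \<in> carrier K"
  shows "deriv M (\<lambda>x\<in>carrier A. scal A c \<triangleright>\<^bsub>M\<^esub> D x)"
proof -
  note d = derivD[OF assms(1)]
  have "scal A c \<triangleright>\<^bsub>M\<^esub> (x \<triangleright>\<^bsub>M\<^esub> D y) = x \<triangleright>\<^bsub>M\<^esub> (scal A c \<triangleright>\<^bsub>M\<^esub> D y)" if "x \<in> carrier A" "y \<in> carrier A" for x y
    using that d assms(2) by (simp add: M.lact_assoc[symmetric] scal_mult mult_scal)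
  then show ?thesis
    using d assms(2) by (simp add: deriv_def addhom_iff M.act_simps)
qed

text \<open>Linearity over K comes from R: c x = (c1) x, and c1 lies in the image of R, where D
  vanishes.\<close>

lemma deriv_smult_apply:
  assumes "deriv M D" "c \<in> carrier K" "x \<in> carrier A"
  shows "D (c \<odot> x) = scal A c \<triangleright>\<^bsub>M\<^esub> D x"
  using derivD(4)[OF assms(1), of "scal A c" x] derivD(5)[OF assms(1), of "scal R c"] derivD(2)[OF assms(1)] assms(2,3)
  by (simp add: scal_mult eta_scal)

end

lemma Der_iff: "D \<in> carrier Der \<longleftrightarrow> D \<in> extensional (carrier A) \<and> deriv AS D"
proof -
  have "deriv AS D \<Longrightarrow> c \<in> carrier K \<Longrightarrow> x \<in> carrier A \<Longrightarrow> D (c \<odot> x) = c \<odot> D x" for c x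
    using deriv_smult_apply[OF central_self] derivD(2)[of AS D] by (simp add: scal_mult)
  then show ?thesis
    by (auto simp: Der_def deriv_def addhom_def[of A A])
qed

lemma DDer_iff: "\<Theta> \<in> carrier DDer \<longleftrightarrow> \<Theta> \<in> extensional (carrier A) \<and> deriv AA \<Theta>"
  using deriv_smult_apply[OF central_A2]
  by (auto simp: DDer_def deriv_def addhom_def)

lemma Der_simps:
  "add Der = (\<lambda>D E. \<lambda>x\<in>carrier A. D x \<oplus> E x)"
  "\<zero>\<^bsub>Der\<^esub> = (\<lambda>x\<in>carrier A. \<zero>)"
  "smult Der = (\<lambda>c D. \<lambda>x\<in>carrier A. c \<odot> D x)"
  "bracket Der = (\<lambda>D E. \<lambda>x\<in>carrier A. D (E x) \<ominus> E (D x))"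
  by (simp_all add: Der_def)

lemma DDer_simps:
  "add DDer = (\<lambda>D E. \<lambda>x\<in>carrier A. D x \<oplus>\<^bsub>AA\<^esub> E x)"
  "\<zero>\<^bsub>DDer\<^esub> = (\<lambda>x\<in>carrier A. \<zero>\<^bsub>AA\<^esub>)"
  "lact DDer = (\<lambda>b \<Theta>. \<lambda>x\<in>carrier A. inner b \<one> (\<Theta> x))"
  "ract DDer = (\<lambda>\<Theta> c. \<lambda>x\<in>carrier A. inner \<one> c (\<Theta> x))"
  by (simp_all add: DDer_def)

lemma Der_deriv: "D \<in> carrier Der \<Longrightarrow> deriv AS D"
  by (simp add: Der_iff)

lemma DDer_deriv: "\<Theta> \<in> carrier DDer \<Longrightarrow> deriv AA \<Theta>"
  by (simp add: DDer_iff)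

lemma Der_closed: "\<lbrakk>D \<in> carrier Der; x \<in> carrier A\<rbrakk> \<Longrightarrow> D x \<in> carrier A"
  using D_closed[OF Der_deriv] .

lemma DDer_closed: "\<lbrakk>\<Theta> \<in> carrier DDer; x \<in> carrier A\<rbrakk> \<Longrightarrow> \<Theta> x \<in> carrier AA"
  using derivD(2)[OF DDer_deriv] .

lemma abelian_group_Der: "abelian_group Der"
proof (rule abelian_groupI)
  fix D E F assume d: "D \<in> carrier Der" "E \<in> carrier Der" "F \<in> carrier Der"
  show "D \<oplus>\<^bsub>Der\<^esub> E \<in> carrier Der"
    using d deriv_plus[OF central_self] by (simp add: Der_iff Der_simps)
  show "\<exists>E\<in>carrier Der. E \<oplus>\<^bsub>Der\<^esub> D = \<zero>\<^bsub>Der\<^esub>"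
    using d deriv_neg[OF central_self, of D] Der_closed
    by (intro bexI[of _ "\<lambda>x\<in>carrier A. \<ominus> D x"]) (auto simp: Der_iff Der_simps l_neg)
  show "\<zero>\<^bsub>Der\<^esub> \<oplus>\<^bsub>Der\<^esub> D = D"
    using d(1) Der_closed[OF d(1)] by (auto simp: Der_iff Der_simps extensional_def fun_eq_iff restrict_def)
  show "D \<oplus>\<^bsub>Der\<^esub> E \<oplus>\<^bsub>Der\<^esub> F = D \<oplus>\<^bsub>Der\<^esub> (E \<oplus>\<^bsub>Der\<^esub> F)" "D \<oplus>\<^bsub>Der\<^esub> E = E \<oplus>\<^bsub>Der\<^esub> D"
    using d Der_closed by (auto simp: Der_simps a_ac)
qed (use deriv_zero[OF central_self] in \<open>simp add: Der_iff Der_simps\<close>)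

lemma abelian_group_DDer: "abelian_group DDer"
proof (rule abelian_groupI)
  fix D E F assume d: "D \<in> carrier DDer" "E \<in> carrier DDer" "F \<in> carrier DDer"
  show "D \<oplus>\<^bsub>DDer\<^esub> E \<in> carrier DDer"
    using d deriv_plus[OF central_A2] by (simp add: DDer_iff DDer_simps)
  show "\<exists>E\<in>carrier DDer. E \<oplus>\<^bsub>DDer\<^esub> D = \<zero>\<^bsub>DDer\<^esub>"
    using deriv_neg[OF central_A2 DDer_deriv[OF d(1)]] DDer_closed[OF d(1)]
    by (intro bexI[of _ "\<lambda>x\<in>carrier A. \<ominus>\<^bsub>AA\<^esub> D x"]) (auto simp: DDer_iff DDer_simps AA.l_neg intro!: restrict_ext)
  show "\<zero>\<^bsub>DDer\<^esub> \<oplus>\<^bsub>DDer\<^esub> D = D"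
    using d(1) DDer_closed[OF d(1)] by (auto simp: DDer_iff DDer_simps extensional_def fun_eq_iff restrict_def)
  show "D \<oplus>\<^bsub>DDer\<^esub> E \<oplus>\<^bsub>DDer\<^esub> F = D \<oplus>\<^bsub>DDer\<^esub> (E \<oplus>\<^bsub>DDer\<^esub> F)"
    using d by (auto simp: DDer_simps DDer_closed AA.a_assoc intro!: restrict_ext)
  show "D \<oplus>\<^bsub>DDer\<^esub> E = E \<oplus>\<^bsub>DDer\<^esub> D"
    using d by (auto simp: DDer_simps DDer_closed intro!: restrict_ext AA.a_comm)
qed (use deriv_zero[OF central_A2] in \<open>simp add: DDer_iff DDer_simps\<close>)

sublocale Der: abelian_group Der by (rule abelian_group_Der)
sublocale DDer: abelian_group DDer by (rule abelian_group_DDer)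

lemma Der_smult_closed: "\<lbrakk>c \<in> carrier K; D \<in> carrier Der\<rbrakk> \<Longrightarrow> c \<odot>\<^bsub>Der\<^esub> D \<in> carrier Der"
  using deriv_smult[OF central_self, of D c] Der_closed[of D]
  by (simp add: Der_iff Der_simps scal_mult cong: restrict_cong)

lemma Der_bracket_closed: "\<lbrakk>D \<in> carrier Der; E \<in> carrier Der\<rbrakk> \<Longrightarrow> bracket Der D E \<in> carrier Der"
  using deriv_bracket[of D E] by (simp add: Der_iff Der_simps)

text \<open>The inner actions commute with the outer ones, and the Leibniz rule is formulated with
  the outer ones.\<close>

lemma DDer_act_closed:
  assumes "b \<in> carrier A" "c \<in> carrier A" "\<Theta> \<in> carrier DDer"
  shows "(\<lambda>x\<in>carrier A. inner b c (\<Theta> x)) \<in> carrier DDer"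
  using derivD[OF DDer_deriv[OF assms(3)]] assms
  by (simp add: DDer_iff deriv_def addhom_iff inner_closed inner_lact inner_ract addhom_add[OF inner_props(1)]
      addhom_zero[OF inner_props(1) AA.abelian_group AA.abelian_group])

lemma der_of_closed: "\<Theta> \<in> carrier DDer \<Longrightarrow> der_of \<Theta> \<in> carrier Der"
  using der_of_deriv[of \<Theta>] by (simp add: Der_iff DDer_iff der_of_def)

lemma der_of_addhom: "der_of \<in> addhom DDer Der"
proof (rule addhomI)
  show "der_of (\<Theta> \<oplus>\<^bsub>DDer\<^esub> \<Phi>) = der_of \<Theta> \<oplus>\<^bsub>Der\<^esub> der_of \<Phi>" if "\<Theta> \<in> carrier DDer" "\<Phi> \<in> carrier DDer" for \<Theta> \<Phi>
    using that by (auto simp: Der_simps der_of_def DDer_simps addhom_add[OF mult2_props(1)] DDer_closed)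
qed (rule der_of_closed)

lemma i1_plus:
  assumes "\<Theta> \<in> carrier DDer" "\<Phi> \<in> carrier DDer" "\<alpha> \<in> carrier Omega1"
  shows "i1 (\<Theta> \<oplus>\<^bsub>DDer\<^esub> \<Phi>) \<alpha> = i1 \<Theta> \<alpha> \<oplus>\<^bsub>AA\<^esub> i1 \<Phi> \<alpha>"
proof -
  note d = assms(1,2)[THEN DDer_deriv] and s = DDer_deriv[OF DDer.a_closed[OF assms(1,2)]]
  have "\<forall>\<alpha>\<in>carrier Omega1. i1 (\<Theta> \<oplus>\<^bsub>DDer\<^esub> \<Phi>) \<alpha> = i1 \<Theta> \<alpha> \<oplus>\<^bsub>AA\<^esub> i1 \<Phi> \<alpha>"
    by (rule Omega1_eqI[OF AA.abelian_group i1_addhom[OF s] AA.addhom_plus[OF d[THEN i1_addhom]]])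
      (use assms(1,2) in \<open>simp add: i1_udv[OF s] i1_udv[OF d(1)] i1_udv[OF d(2)] DDer_closed AA.lact_add[symmetric],
        simp add: DDer_simps\<close>)
  with assms(3) show ?thesis by blast
qed

lemma iota2_addhom_left:
  assumes "\<xi> \<in> carrier Omega2"
  shows "(\<lambda>\<Theta>. iota2 \<Theta> \<xi>) \<in> addhom DDer Omega1"
proof (rule addhomI)
  fix \<Theta> \<Phi> assume a: "\<Theta> \<in> carrier DDer" "\<Phi> \<in> carrier DDer"
  note d = a[THEN DDer_deriv] and s = DDer_deriv[OF DDer.a_closed[OF a]]
  note [simp] = i1_closed[OF d(1)] i1_closed[OF d(2)]
  have "\<forall>\<xi>\<in>carrier Omega2. iota2 (\<Theta> \<oplus>\<^bsub>DDer\<^esub> \<Phi>) \<xi> = iota2 \<Theta> \<xi> \<oplus>\<^bsub>Omega1\<^esub> iota2 \<Phi> \<xi>"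
    by (rule Omega2_eqI[OF O1.abelian_group iota2_props(1)[OF s] O1.addhom_plus[OF d[THEN iota2_props(1)]]])
      (simp add: iota2_props[OF s] iota2_props[OF d(1)] iota2_props[OF d(2)] i1_plus[OF a]
        addhom_add[OF O1.sand_props(1)] O1.diff_simps)
  with assms show "iota2 (\<Theta> \<oplus>\<^bsub>DDer\<^esub> \<Phi>) \<xi> = iota2 \<Theta> \<xi> \<oplus>\<^bsub>Omega1\<^esub> iota2 \<Phi> \<xi>" by blast
qed (use assms iota2_closed[OF DDer_deriv] in auto)

text \<open>The inner factors b and c pass through i_\<Theta> and come out of the sandwich, by
  \<open>sand_inner\<close>, as outer factors of the one-form.\<close>

lemma iota2_act:
  assumes bc: "b \<in> carrier A" "c \<in> carrier A" and \<Theta>: "\<Theta> \<in> carrier DDer" and \<xi>: "\<xi> \<in> carrier Omega2"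
  shows "iota2 (\<lambda>x\<in>carrier A. inner b c (\<Theta> x)) \<xi> = b \<triangleright>\<^bsub>Omega1\<^esub> (iota2 \<Theta> \<xi> \<triangleleft>\<^bsub>Omega1\<^esub> c)"
proof -
  let ?\<Phi> = "\<lambda>x\<in>carrier A. inner b c (\<Theta> x)"
  note d = DDer_deriv[OF \<Theta>] and s = DDer_deriv[OF DDer_act_closed[OF bc \<Theta>]]
  note [simp] = i1_closed[OF d]
  have "\<forall>\<alpha>\<in>carrier Omega1. i1 ?\<Phi> \<alpha> = inner b c (i1 \<Theta> \<alpha>)"
    by (rule Omega1_eqI[OF AA.abelian_group i1_addhom[OF s] addhom_comp[OF inner_props(1)[OF bc] i1_addhom[OF d]]])
      (use \<Theta> bc in \<open>simp add: i1_udv[OF s] i1_udv[OF d] inner_lact DDer_closed\<close>)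
  then have i: "i1 ?\<Phi> \<alpha> = inner b c (i1 \<Theta> \<alpha>)" if "\<alpha> \<in> carrier Omega1" for \<alpha>
    using that by blast
  have "\<forall>\<xi>\<in>carrier Omega2. iota2 ?\<Phi> \<xi> = b \<triangleright>\<^bsub>Omega1\<^esub> (iota2 \<Theta> \<xi> \<triangleleft>\<^bsub>Omega1\<^esub> c)"
    by (rule Omega2_eqI[OF O1.abelian_group iota2_props(1)[OF s]
          O1.addhom_lact[OF bc(1) O1.addhom_ract[OF bc(2) iota2_props(1)[OF d]]]])
      (use bc in \<open>simp add: iota2_props[OF s] iota2_props[OF d] i O1.sand_inner O1.lact_diff O1.ract_diff\<close>)
  with \<xi> show ?thesis by blast
qed

abbreviation DDer_comm where "DDer_comm \<equiv> commutators A DDer"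

lemma DDer_comm_span: "DDer_comm = add_span DDer
    {(a \<triangleright>\<^bsub>DDer\<^esub> m) \<ominus>\<^bsub>DDer\<^esub> (m \<triangleleft>\<^bsub>DDer\<^esub> a) | a m. a \<in> carrier A \<and> m \<in> carrier DDer}"
  by (simp add: commutators_def add_span_def)

lemma DDer_acts:
  assumes "b \<in> carrier A" "\<Theta> \<in> carrier DDer"
  shows "b \<triangleright>\<^bsub>DDer\<^esub> \<Theta> \<in> carrier DDer" "\<Theta> \<triangleleft>\<^bsub>DDer\<^esub> b \<in> carrier DDer"
  using DDer_act_closed[of b \<one> \<Theta>] DDer_act_closed[of \<one> b \<Theta>] assms by (simp_all add: DDer_simps)

lemma DDer_comm_gens: "{(a \<triangleright>\<^bsub>DDer\<^esub> m) \<ominus>\<^bsub>DDer\<^esub> (m \<triangleleft>\<^bsub>DDer\<^esub> a) | a m. a \<in> carrier A \<and> m \<in> carrier DDer} \<subseteq> carrier DDer"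
  using DDer_acts by auto

lemma DDer_comm_subgroup: "subgroup DDer_comm (add_monoid DDer)"
  unfolding DDer_comm_span by (rule DDer.add_span_subgroup[OF DDer_comm_gens])

lemma DDer_comm_into:
  assumes "abelian_group P" "f \<in> addhom DDer P" "subgroup B (add_monoid P)"
    and "\<And>a m. \<lbrakk>a \<in> carrier A; m \<in> carrier DDer\<rbrakk> \<Longrightarrow> f (a \<triangleright>\<^bsub>DDer\<^esub> m) \<ominus>\<^bsub>P\<^esub> f (m \<triangleleft>\<^bsub>DDer\<^esub> a) \<in> B"
    and "x \<in> DDer_comm"
  shows "f x \<in> B"
  by (rule addhom_span_into[OF DDer.abelian_group_axioms assms(1-3) DDer_comm_gens _ assms(5)[unfolded DDer_comm_span]])
    (use assms(4) DDer_acts in \<open>auto simp: addhom_minus[OF assms(2) DDer.abelian_group_axioms assms(1)]\<close>)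

text \<open>The two inner actions of a become equal after multiplication. Together with
  \<open>iota2_DDer_comm\<close> this lets both maps out of the commutator quotient of double
  derivations be evaluated at representatives.\<close>

lemma der_of_comm: "\<Theta> \<in> DDer_comm \<Longrightarrow> der_of \<Theta> = \<zero>\<^bsub>Der\<^esub>"
proof -
  assume \<Theta>: "\<Theta> \<in> DDer_comm"
  have "subgroup {\<zero>\<^bsub>Der\<^esub>} (add_monoid Der)"
    by (rule Der.subgroupI_add) (auto simp: Der.diff_self)
  moreover have "der_of (a \<triangleright>\<^bsub>DDer\<^esub> m) = der_of (m \<triangleleft>\<^bsub>DDer\<^esub> a)" if "a \<in> carrier A" "m \<in> carrier DDer" for a m
    using that by (auto simp: der_of_def DDer_simps mult2_inner DDer_closed)
  ultimately have "der_of \<Theta> \<in> {\<zero>\<^bsub>Der\<^esub>}"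
    by (intro DDer_comm_into[OF Der.abelian_group_axioms der_of_addhom _ _ \<Theta>])
      (auto simp: Der.diff_self der_of_closed DDer_acts)
  then show ?thesis by simp
qed

lemma iota2_DDer_comm:
  assumes \<xi>: "\<xi> \<in> carrier Omega2" and \<Theta>: "\<Theta> \<in> DDer_comm"
  shows "iota2 \<Theta> \<xi> \<in> comm1"
proof (rule DDer_comm_into[where f = "\<lambda>\<Theta>. iota2 \<Theta> \<xi>", OF O1.abelian_group iota2_addhom_left[OF \<xi>] comm1_subgroup _ \<Theta>])
  fix a \<Theta> assume a: "a \<in> carrier A" "\<Theta> \<in> carrier DDer"
  then show "iota2 (a \<triangleright>\<^bsub>DDer\<^esub> \<Theta>) \<xi> \<ominus>\<^bsub>Omega1\<^esub> iota2 (\<Theta> \<triangleleft>\<^bsub>DDer\<^esub> a) \<xi> \<in> comm1"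
    using iota2_act[of a \<one> \<Theta> \<xi>] iota2_act[of \<one> a \<Theta> \<xi>] \<xi> iota2_closed[OF DDer_deriv, of \<Theta> \<xi>]
    by (simp add: DDer_simps comm1I)
qed

text \<open>By Leibniz d(ab - ba) splits into [a, db] - [b, da], so d is defined on classes in
  A/[A, A].\<close>

lemma d0_A_comm: "a \<in> A_comm \<Longrightarrow> d0 a \<in> comm1"
proof (rule A_comm_into[OF O1.abelian_group d0_addhom comm1_subgroup])
  fix a b assume ab: "a \<in> carrier A" "b \<in> carrier A"
  have "d0 (a \<otimes> b \<ominus> b \<otimes> a) = (a \<triangleright>\<^bsub>Omega1\<^esub> d0 b \<ominus>\<^bsub>Omega1\<^esub> d0 b \<triangleleft>\<^bsub>Omega1\<^esub> a) \<ominus>\<^bsub>Omega1\<^esub>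
      (b \<triangleright>\<^bsub>Omega1\<^esub> d0 a \<ominus>\<^bsub>Omega1\<^esub> d0 a \<triangleleft>\<^bsub>Omega1\<^esub> b)"
    using ab by (simp add: addhom_minus[OF d0_addhom is_abelian_group O1.abelian_group] d0_mult O1.diff_simps)
  also have "\<dots> \<in> comm1"
    using ab by (intro comm1_rules(5) comm1I) auto
  finally show "d0 (a \<otimes> b \<ominus> b \<otimes> a) \<in> comm1" .
qed

lemma j2_addhom_left:
  assumes "\<xi> \<in> carrier Omega2"
  shows "(\<lambda>D. j2 D \<xi>) \<in> addhom Der Omega1"
proof (rule addhomI)
  fix D E assume a: "D \<in> carrier Der" "E \<in> carrier Der"
  note d = a[THEN Der_deriv] and s = Der_deriv[OF Der.a_closed[OF a]]
  note [simp] = j1_closed[OF d(1)] j1_closed[OF d(2)] D_closed[OF d(1)] D_closed[OF d(2)]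
  have "\<forall>\<alpha>\<in>carrier Omega1. j1 (D \<oplus>\<^bsub>Der\<^esub> E) \<alpha> = j1 D \<alpha> \<oplus> j1 E \<alpha>"
    by (rule Omega1_eqI[OF is_abelian_group j1_addhom[OF s] addhom_plus[OF d[THEN j1_addhom]]])
      (simp add: j1_udv[OF s] j1_udv[OF d(1)] j1_udv[OF d(2)], simp add: Der_simps r_distr)
  then have "\<forall>\<xi>\<in>carrier Omega2. j2 (D \<oplus>\<^bsub>Der\<^esub> E) \<xi> = j2 D \<xi> \<oplus>\<^bsub>Omega1\<^esub> j2 E \<xi>"
    by (intro Omega2_eqI[OF O1.abelian_group j2_props(1)[OF s] O1.addhom_plus[OF d[THEN j2_props(1)]]])
      (simp add: j2_props[OF s] j2_props[OF d(1)] j2_props[OF d(2)] O1.act_simps O1.diff_simps)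
  with assms show "j2 (D \<oplus>\<^bsub>Der\<^esub> E) \<xi> = j2 D \<xi> \<oplus>\<^bsub>Omega1\<^esub> j2 E \<xi>" by blast
qed (use assms j2_closed[OF Der_deriv] in auto)

lemma j2_smult_left:
  assumes \<xi>: "\<xi> \<in> carrier Omega2" and c: "c \<in> carrier K" and D: "D \<in> carrier Der"
  shows "j2 (c \<odot>\<^bsub>Der\<^esub> D) \<xi> = scal A c \<triangleright>\<^bsub>Omega1\<^esub> j2 D \<xi>"
proof -
  note d = Der_deriv[OF D] and s = Der_deriv[OF Der_smult_closed[OF c D]]
  note [simp] = j1_closed[OF d] D_closed[OF d]
  have j: "\<forall>\<alpha>\<in>carrier Omega1. j1 (c \<odot>\<^bsub>Der\<^esub> D) \<alpha> = scal A c \<otimes> j1 D \<alpha>"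
    by (rule Omega1_eqI[OF is_abelian_group j1_addhom[OF s] mult_addhoms(1)[OF _ j1_addhom[OF d]]])
      (use c in \<open>simp_all add: j1_udv[OF s] j1_udv[OF d] scal_mult smult_mult_right, simp add: Der_simps smult_mult_right\<close>)
  have "\<forall>\<xi>\<in>carrier Omega2. j2 (c \<odot>\<^bsub>Der\<^esub> D) \<xi> = scal A c \<triangleright>\<^bsub>Omega1\<^esub> j2 D \<xi>"
  proof (rule Omega2_eqI[OF O1.abelian_group j2_props(1)[OF s] O1.addhom_lact[OF _ j2_props(1)[OF d]]])
    fix \<alpha> \<beta> assume ab: "\<alpha> \<in> carrier Omega1" "\<beta> \<in> carrier Omega1"
    have "\<alpha> \<triangleleft>\<^bsub>Omega1\<^esub> (scal A c \<otimes> j1 D \<beta>) = scal A c \<triangleright>\<^bsub>Omega1\<^esub> (\<alpha> \<triangleleft>\<^bsub>Omega1\<^esub> j1 D \<beta>)"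
      using ab c by (simp add: O1.ract_assoc O1.central[symmetric] O1.lact_ract)
    then show "j2 (c \<odot>\<^bsub>Der\<^esub> D) (wedge11 \<alpha> \<beta>) = scal A c \<triangleright>\<^bsub>Omega1\<^esub> j2 D (wedge11 \<alpha> \<beta>)"
      using ab c j by (simp add: j2_props[OF s] j2_props[OF d] O1.lact_diff O1.lact_assoc)
  qed (use c in simp)
  with \<xi> show ?thesis by blast
qed

lemma comm1_scal: "\<lbrakk>c \<in> carrier K; \<alpha> \<in> comm1\<rbrakk> \<Longrightarrow> scal A c \<triangleright>\<^bsub>Omega1\<^esub> \<alpha> \<in> comm1"
proof -
  assume c: "c \<in> carrier K" and "\<alpha> \<in> comm1"
  then have \<alpha>: "\<alpha> \<in> commutators A Omega1" by (simp add: comm1_def)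
  show ?thesis
  proof (rule O1.commutators_into[where f = "\<lambda>\<alpha>. scal A c \<triangleright>\<^bsub>Omega1\<^esub> \<alpha>", OF O1.abelian_group O1.lact_addhom comm1_subgroup _ \<alpha>])
    fix a m assume a: "a \<in> carrier A" "m \<in> carrier Omega1"
    have "scal A c \<triangleright>\<^bsub>Omega1\<^esub> (a \<triangleright>\<^bsub>Omega1\<^esub> m \<ominus>\<^bsub>Omega1\<^esub> m \<triangleleft>\<^bsub>Omega1\<^esub> a) =
        (c \<odot> a) \<triangleright>\<^bsub>Omega1\<^esub> m \<ominus>\<^bsub>Omega1\<^esub> m \<triangleleft>\<^bsub>Omega1\<^esub> (c \<odot> a)"
      using a c by (simp add: O1.lact_diff O1.lact_assoc[symmetric] O1.lact_ract[symmetric] O1.central O1.ract_assoc[symmetric] scal_mult)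
    then show "scal A c \<triangleright>\<^bsub>Omega1\<^esub> (a \<triangleright>\<^bsub>Omega1\<^esub> m \<ominus>\<^bsub>Omega1\<^esub> m \<triangleleft>\<^bsub>Omega1\<^esub> a) \<in> comm1"
      using comm1I[of "c \<odot> a" m] a c by simp
  qed (use c in simp)
qed

lemma d0_smult: "\<lbrakk>c \<in> carrier K; a \<in> carrier A\<rbrakk> \<Longrightarrow> d0 (c \<odot> a) = scal A c \<triangleright>\<^bsub>Omega1\<^esub> d0 a"
  using d0_mult[of "scal A c" a] d0_eta[of "scal R c"] by (simp add: scal_mult eta_scal)

end

section \<open>The differential of two-forms modulo supercommutators\<close>

context nc_forms
begin

lemma wedge12_lact: "\<lbrakk>a \<in> carrier A; \<alpha> \<in> carrier Omega1; \<xi> \<in> carrier Omega2\<rbrakk> \<Longrightarrow>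
    wedge12 (a \<triangleright>\<^bsub>Omega1\<^esub> \<alpha>) \<xi> = a \<triangleright>\<^bsub>Omega3\<^esub> wedge12 \<alpha> \<xi>"
proof -
  assume a: "a \<in> carrier A" "\<alpha> \<in> carrier Omega1" and \<xi>: "\<xi> \<in> carrier Omega2"
  have "\<forall>\<xi>\<in>carrier Omega2. wedge12 (a \<triangleright>\<^bsub>Omega1\<^esub> \<alpha>) \<xi> = a \<triangleright>\<^bsub>Omega3\<^esub> wedge12 \<alpha> \<xi>"
    by (rule Omega2_eqI[OF O3.abelian_group])
      (use a in \<open>auto intro!: O3.addhom_lact wedge12_props simp: wedge12_props wedge11_lact wedge21_lact\<close>)
  with \<xi> show ?thesis by blast
qed

lemma wedge12_ract: "\<lbrakk>a \<in> carrier A; \<alpha> \<in> carrier Omega1; \<xi> \<in> carrier Omega2\<rbrakk> \<Longrightarrow>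
    wedge12 \<alpha> (\<xi> \<triangleleft>\<^bsub>Omega2\<^esub> a) = wedge12 \<alpha> \<xi> \<triangleleft>\<^bsub>Omega3\<^esub> a"
proof -
  assume a: "a \<in> carrier A" "\<alpha> \<in> carrier Omega1" and \<xi>: "\<xi> \<in> carrier Omega2"
  have "\<forall>\<xi>\<in>carrier Omega2. wedge12 \<alpha> (\<xi> \<triangleleft>\<^bsub>Omega2\<^esub> a) = wedge12 \<alpha> \<xi> \<triangleleft>\<^bsub>Omega3\<^esub> a"
    by (rule Omega2_eqI[OF O3.abelian_group addhom_comp[OF wedge12_props(1) O2.ract_addhom]])
      (use a in \<open>auto intro!: O3.addhom_ract wedge12_props simp: wedge12_props wedge11_ract wedge21_ract\<close>)
  with \<xi> show ?thesis by blast
qed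

lemma d2_lact: "\<lbrakk>a \<in> carrier A; \<xi> \<in> carrier Omega2\<rbrakk> \<Longrightarrow>
    d2 (a \<triangleright>\<^bsub>Omega2\<^esub> \<xi>) = wedge12 (d0 a) \<xi> \<oplus>\<^bsub>Omega3\<^esub> a \<triangleright>\<^bsub>Omega3\<^esub> d2 \<xi>"
proof -
  assume a: "a \<in> carrier A" and \<xi>: "\<xi> \<in> carrier Omega2"
  have "\<forall>\<xi>\<in>carrier Omega2. d2 (a \<triangleright>\<^bsub>Omega2\<^esub> \<xi>) = wedge12 (d0 a) \<xi> \<oplus>\<^bsub>Omega3\<^esub> a \<triangleright>\<^bsub>Omega3\<^esub> d2 \<xi>"
    by (rule Omega2_eqI[OF O3.abelian_group addhom_comp[OF d2_props(1) O2.lact_addhom]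
          O3.addhom_plus[OF wedge12_props(1) O3.addhom_lact[OF _ d2_props(1)]]])
      (use a in \<open>auto simp: wedge11_lact d2_props d1_lact wedge21_simps wedge12_props(2) wedge12_lact wedge21_lact
        O3.lact_diff O3.diff_simps\<close>)
  with \<xi> show ?thesis by blast
qed

lemma d2_ract: "\<lbrakk>a \<in> carrier A; \<xi> \<in> carrier Omega2\<rbrakk> \<Longrightarrow>
    d2 (\<xi> \<triangleleft>\<^bsub>Omega2\<^esub> a) = d2 \<xi> \<triangleleft>\<^bsub>Omega3\<^esub> a \<oplus>\<^bsub>Omega3\<^esub> wedge21 \<xi> (d0 a)"
proof -
  assume a: "a \<in> carrier A" and \<xi>: "\<xi> \<in> carrier Omega2"
  have "\<forall>\<xi>\<in>carrier Omega2. d2 (\<xi> \<triangleleft>\<^bsub>Omega2\<^esub> a) = d2 \<xi> \<triangleleft>\<^bsub>Omega3\<^esub> a \<oplus>\<^bsub>Omega3\<^esub> wedge21 \<xi> (d0 a)"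
    by (rule Omega2_eqI[OF O3.abelian_group addhom_comp[OF d2_props(1) O2.ract_addhom]
          O3.addhom_plus[OF O3.addhom_ract[OF _ d2_props(1)] wedge21_addhom_left]])
      (use a in \<open>auto simp: wedge11_ract d2_props d1_ract wedge12_props(2) wedge12_ract wedge21_ract
        addhom_minus[OF wedge12_props(1) O2.abelian_group O3.abelian_group] O3.ract_diff O3.diff_simps\<close>)
  with \<xi> show ?thesis by blast
qed

lemma comm3_subgroup: "subgroup comm3 (add_monoid Omega3)"
  unfolding comm3_span by (rule O3.add_span_subgroup) auto

lemmas comm3_rules = O3.subgroupD_add[OF comm3_subgroup]

lemma comm3I:
  "\<lbrakk>a \<in> carrier A; \<zeta> \<in> carrier Omega3\<rbrakk> \<Longrightarrow> (a \<triangleright>\<^bsub>Omega3\<^esub> \<zeta>) \<ominus>\<^bsub>Omega3\<^esub> (\<zeta> \<triangleleft>\<^bsub>Omega3\<^esub> a) \<in> comm3"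
  "\<lbrakk>\<alpha> \<in> carrier Omega1; \<xi> \<in> carrier Omega2\<rbrakk> \<Longrightarrow> wedge12 \<alpha> \<xi> \<ominus>\<^bsub>Omega3\<^esub> wedge21 \<xi> \<alpha> \<in> comm3"
  unfolding comm3_span by (rule O3.add_span_incl; blast)+

text \<open>The Leibniz rules turn both kinds of generators into supercommutators of degree three,
  so closedness of a class in DR^2 can be read off from any representative.\<close>

lemma d2_comm2: "\<xi> \<in> comm2 \<Longrightarrow> d2 \<xi> \<in> comm3"
proof (rule comm2_into[OF O3.abelian_group d2_props(1) comm3_subgroup])
  note diff = addhom_minus[OF d2_props(1) O2.abelian_group O3.abelian_group]
  fix a \<xi> assume a: "a \<in> carrier A" "\<xi> \<in> carrier Omega2"
  have "d2 (a \<triangleright>\<^bsub>Omega2\<^esub> \<xi> \<ominus>\<^bsub>Omega2\<^esub> \<xi> \<triangleleft>\<^bsub>Omega2\<^esub> a) =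
    (wedge12 (d0 a) \<xi> \<ominus>\<^bsub>Omega3\<^esub> wedge21 \<xi> (d0 a)) \<oplus>\<^bsub>Omega3\<^esub> (a \<triangleright>\<^bsub>Omega3\<^esub> d2 \<xi> \<ominus>\<^bsub>Omega3\<^esub> d2 \<xi> \<triangleleft>\<^bsub>Omega3\<^esub> a)"
    using a by (simp add: diff d2_lact d2_ract O3.diff_simps)
  also have "\<dots> \<in> comm3"
    using a by (intro comm3_rules(3) comm3I) auto
  finally show "d2 (a \<triangleright>\<^bsub>Omega2\<^esub> \<xi> \<ominus>\<^bsub>Omega2\<^esub> \<xi> \<triangleleft>\<^bsub>Omega2\<^esub> a) \<in> comm3" .
next
  fix \<alpha> \<beta> assume ab: "\<alpha> \<in> carrier Omega1" "\<beta> \<in> carrier Omega1"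
  have "d2 (wedge11 \<alpha> \<beta> \<oplus>\<^bsub>Omega2\<^esub> wedge11 \<beta> \<alpha>) =
    \<ominus>\<^bsub>Omega3\<^esub> ((wedge12 \<alpha> (d1 \<beta>) \<ominus>\<^bsub>Omega3\<^esub> wedge21 (d1 \<beta>) \<alpha>) \<oplus>\<^bsub>Omega3\<^esub> (wedge12 \<beta> (d1 \<alpha>) \<ominus>\<^bsub>Omega3\<^esub> wedge21 (d1 \<alpha>) \<beta>))"
    using ab by (simp add: addhom_add[OF d2_props(1)] d2_props(2) O3.diff_simps)
  also have "\<dots> \<in> comm3"
    using ab by (intro comm3_rules(4) comm3_rules(3) comm3I) auto
  finally show "d2 (wedge11 \<alpha> \<beta> \<oplus>\<^bsub>Omega2\<^esub> wedge11 \<beta> \<alpha>) \<in> comm3" .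
qed

lemma Der_A_comm: "\<lbrakk>D \<in> carrier Der; x \<in> A_comm\<rbrakk> \<Longrightarrow> D x \<in> A_comm"
proof -
  assume D: "D \<in> carrier Der" and x: "x \<in> A_comm"
  note d = derivD[OF Der_deriv[OF D]]
  have D': "D \<in> addhom A A" using d(1) by simp
  show ?thesis
  proof (rule A_comm_into[OF is_abelian_group D' A_comm_subgroup _ x])
    fix a b assume ab: "a \<in> carrier A" "b \<in> carrier A"
    have "D (a \<otimes> b \<ominus> b \<otimes> a) = (a \<otimes> D b \<ominus> D b \<otimes> a) \<oplus> (D a \<otimes> b \<ominus> b \<otimes> D a)"
      using ab d by (simp add: addhom_minus[OF D' is_abelian_group is_abelian_group] diff_simps)
    also have "\<dots> \<in> A_comm"
      using ab d by (intro A_comm_rules(3) A_commI) auto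
    finally show "D (a \<otimes> b \<ominus> b \<otimes> a) \<in> A_comm" .
  qed
qed

subsection \<open>The double derivation \<open>\<Delta>\<close>\<close>

definition eta2 :: "('r \<times> 'r) frag set \<Rightarrow> ('a \<times> 'a) frag set" where
  "eta2 = the_add_hom (tensor2 K R) AA
     (\<lambda>h. \<forall>r\<in>carrier R. \<forall>s\<in>carrier R. h (tns2 K R r s) = tns2 K A (\<eta> r) (\<eta> s))"

lemma eta_addhom: "\<eta> \<in> addhom R A"
  by (rule addhomI) simp_all

lemma eta2_props:
  shows "eta2 \<in> addhom (tensor2 K R) AA"
    and "\<And>r s. \<lbrakk>r \<in> carrier R; s \<in> carrier R\<rbrakk> \<Longrightarrow> eta2 (tns2 K R r s) = tns2 K A (\<eta> r) (\<eta> s)"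
proof -
  have "\<And>r. r \<in> carrier R \<Longrightarrow> (\<lambda>s. tns2 K A (\<eta> r) (\<eta> s)) \<in> addhom R AA"
    "\<And>s. s \<in> carrier R \<Longrightarrow> (\<lambda>r. tns2 K A (\<eta> r) (\<eta> s)) \<in> addhom R AA"
    "\<And>r s c. \<lbrakk>r \<in> carrier R; s \<in> carrier R; c \<in> carrier K\<rbrakk> \<Longrightarrow>
      tns2 K A (\<eta> (c \<odot>\<^bsub>R\<^esub> r)) (\<eta> s) = tns2 K A (\<eta> r) (\<eta> (c \<odot>\<^bsub>R\<^esub> s))"
    using addhom_comp[OF tns2_addhom_right eta_addhom] addhom_comp[OF tns2_addhom_left eta_addhom]
    by (simp_all add: eta_smult tns2_smult)
  from R.A2_hom[OF AA.abelian_group this]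
  show "eta2 \<in> addhom (tensor2 K R) AA"
    and "\<And>r s. \<lbrakk>r \<in> carrier R; s \<in> carrier R\<rbrakk> \<Longrightarrow> eta2 (tns2 K R r s) = tns2 K A (\<eta> r) (\<eta> s)"
    by (simp_all add: eta2_def)
qed

context
  fixes e assumes e: "symmetric_separability_element K R e"
begin

interpretation R2: bimod R "tensor2 K R" R by (rule R.bimod_A2)

abbreviation ee where "ee \<equiv> eta2 e"

lemma ee_closed [simp]: "ee \<in> carrier AA"
  using e addhom_closed[OF eta2_props(1)] by (simp add: symmetric_separability_element_def)

lemma ee_central: "r \<in> carrier R \<Longrightarrow> \<eta> r \<triangleright>\<^bsub>AA\<^esub> ee = ee \<triangleleft>\<^bsub>AA\<^esub> \<eta> r"
proof -
  assume r: "r \<in> carrier R"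
  have "\<forall>t\<in>carrier (tensor2 K R). eta2 (r \<triangleright>\<^bsub>tensor2 K R\<^esub> t) = \<eta> r \<triangleright>\<^bsub>AA\<^esub> eta2 t"
    by (rule R.A2_eqI[OF AA.abelian_group addhom_comp[OF eta2_props(1) R2.lact_addhom] AA.addhom_lact[OF _ eta2_props(1)]])
      (use r in \<open>auto simp: eta2_props R.tns2_lact tns2_lact\<close>)
  moreover have "\<forall>t\<in>carrier (tensor2 K R). eta2 (t \<triangleleft>\<^bsub>tensor2 K R\<^esub> r) = eta2 t \<triangleleft>\<^bsub>AA\<^esub> \<eta> r"
    by (rule R.A2_eqI[OF AA.abelian_group addhom_comp[OF eta2_props(1) R2.ract_addhom] AA.addhom_ract[OF _ eta2_props(1)]])
      (use r in \<open>auto simp: eta2_props R.tns2_ract tns2_ract\<close>)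
  ultimately show ?thesis
    using e r unfolding symmetric_separability_element_def by metis
qed

text \<open>With respect to the outer structure \<Delta> is the inner double derivation of the image
  of the separability element; in this form the Leibniz rule and the vanishing on R become
  visible.\<close>

lemma Delta_eq: "a \<in> carrier A \<Longrightarrow> Delta e a = a \<triangleright>\<^bsub>AA\<^esub> ee \<ominus>\<^bsub>AA\<^esub> ee \<triangleleft>\<^bsub>AA\<^esub> a"
proof -
  assume a: "a \<in> carrier A"
  let ?k = "\<lambda>t. a \<triangleright>\<^bsub>AA\<^esub> eta2 t \<ominus>\<^bsub>AA\<^esub> eta2 t \<triangleleft>\<^bsub>AA\<^esub> a"
  let ?f = "\<lambda>r s. tns2 K A (a \<otimes> \<eta> r) (\<eta> s) \<ominus>\<^bsub>AA\<^esub> tns2 K A (\<eta> r) (\<eta> s \<otimes> a)"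
  have k: "?k \<in> addhom (tensor2 K R) AA"
    by (intro AA.addhom_diff AA.addhom_lact AA.addhom_ract eta2_props a)
  have kf: "?k (tns2 K R r s) = ?f r s" if "r \<in> carrier R" "s \<in> carrier R" for r s
    using that a by (simp add: eta2_props tns2_lact tns2_ract)
  \<comment> \<open>Biadditivity and balancing of \<open>?f\<close> are read off from
    \<open>?k\<close>, which is already a map on the tensor square of R and agrees with
    \<open>?f\<close> on elementary tensors.\<close>
  have f: "(\<lambda>s. ?f r s) \<in> addhom R AA" "(\<lambda>s. ?f s r) \<in> addhom R AA" if "r \<in> carrier R" for r
    using that a kf addhom_comp[OF k R.tns2_addhom_right[of r]] addhom_comp[OF k R.tns2_addhom_left[of r]]
    by (auto simp: addhom_iff)
  have c: "?f (c \<odot>\<^bsub>R\<^esub> r) s = ?f r (c \<odot>\<^bsub>R\<^esub> s)" if "r \<in> carrier R" "s \<in> carrier R" "c \<in> carrier K" for r s c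
    using that kf[of "c \<odot>\<^bsub>R\<^esub> r" s] kf[of r "c \<odot>\<^bsub>R\<^esub> s"] R.tns2_smult[of r s c] by simp
  define h where "h = the_add_hom (tensor2 K R) AA (\<lambda>h. \<forall>r\<in>carrier R. \<forall>s\<in>carrier R. h (tns2 K R r s) = ?f r s)"
  note H = R.A2_hom[where f = ?f, OF AA.abelian_group f c, folded h_def]
  have "\<forall>t\<in>carrier (tensor2 K R). h t = ?k t"
    by (rule R.A2_eqI[OF AA.abelian_group H(1) k]) (simp_all add: H(2) kf)
  then show ?thesis
    using e a by (simp add: Delta_def symmetric_separability_element_def h_def)
qed

text \<open>An inner double derivation satisfies the Leibniz rule by telescoping, and this one
  vanishes on R because the separability element commutes with R.\<close>

lemma Delta_DDer: "Delta e \<in> carrier DDer"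
proof -
  have "Delta e \<in> extensional (carrier A)"
    by (simp add: Delta_def)
  moreover have "deriv AA (Delta e)"
    unfolding deriv_def
    by (auto simp: addhom_iff Delta_eq AA.act_simps AA.diff_simps ee_central AA.diff_self)
  ultimately show ?thesis by (simp add: DDer_iff)
qed

text \<open>The halves ae' \<otimes> e'' and e' \<otimes> e''a of \<Delta>(a) are both sent to e'' a
  e' by the reversed multiplication.\<close>

lemma kap_Delta_d0: "a \<in> carrier A \<Longrightarrow> kap (Delta e) (d0 a) = \<zero>"
proof -
  assume a: "a \<in> carrier A"
  have c: "AS.sand a ee \<in> carrier A"
    using AS.sand_closed[of a ee] a by simp
  have "AS.sand \<one> (a \<triangleright>\<^bsub>AA\<^esub> ee) = AS.sand a ee" "AS.sand \<one> (ee \<triangleleft>\<^bsub>AA\<^esub> a) = AS.sand a ee"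
    using AS.sand_ract[of a \<one> ee] AS.sand_lact[of a \<one> ee] a by simp_all
  then show ?thesis
    using a c addhom_minus[OF AS.sand_props(1), of \<one> "a \<triangleright>\<^bsub>AA\<^esub> ee" "ee \<triangleleft>\<^bsub>AA\<^esub> a"] AA.abelian_group AS.abelian_group
    by (simp add: kap_def i1_d0[OF DDer_deriv[OF Delta_DDer]] Delta_eq diff_self)
qed

end

end

section \<open>A representative of the bi-symplectic form and its Hamiltonian derivations\<close>

locale bisymplectic_form = nc_forms K R A \<eta>
  for K :: "'k ring" and R :: "('k, 'r) module" and A :: "('k, 'a) module" (structure) and \<eta> :: "'r \<Rightarrow> 'a" +
  fixes \<omega> :: "(('a \<times> 'a) frag set \<times> ('a \<times> 'a) frag set) frag set set"
  assumes bisymplectic: "bisymplectic \<omega>"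
begin

text \<open>One representative of the class is fixed so that contractions and differentials can be
  computed in Omega; independence of the choice is provided by \<open>iota2_comm2\<close> and
  \<open>d2_comm2\<close>.\<close>

definition lift where
  "lift = (SOME \<xi>. \<xi> \<in> carrier Omega2 \<and> \<omega> = comm2 +>\<^bsub>Omega2\<^esub> \<xi>)"

lemma lift: "lift \<in> carrier Omega2" "\<omega> = comm2 +>\<^bsub>Omega2\<^esub> lift"
proof -
  have "\<exists>\<xi>. \<xi> \<in> carrier Omega2 \<and> \<omega> = comm2 +>\<^bsub>Omega2\<^esub> \<xi>"
    using bisymplectic by (auto simp: bisymplectic_def DR2_def carrier_A_Mod)
  from someI_ex[OF this] show "lift \<in> carrier Omega2" "\<omega> = comm2 +>\<^bsub>Omega2\<^esub> lift"
    by (simp_all add: lift_def)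
qed

lemmas [simp] = lift(1)

lemma mem_form: "\<xi> \<in> \<omega> \<longleftrightarrow> \<xi> \<in> carrier Omega2 \<and> \<xi> \<ominus>\<^bsub>Omega2\<^esub> lift \<in> comm2"
  using O2.coset_mem[OF comm2_subgroup lift(1), folded lift(2)] .

lemma lift_mem: "lift \<in> \<omega>"
  by (simp add: mem_form O2.diff_self comm2_rules(2))

lemma iota_eq:
  assumes \<Theta>: "\<Theta> \<in> carrier DDer"
  shows "iota \<Theta> \<omega> = iota2 \<Theta> lift"
  unfolding iota_def
proof (rule the_elem_constant)
  note d = DDer_deriv[OF \<Theta>]
  show "lift \<in> \<omega>" by (rule lift_mem)
  fix \<xi> assume "\<xi> \<in> \<omega>"
  then have \<xi>: "\<xi> \<in> carrier Omega2" "\<xi> \<ominus>\<^bsub>Omega2\<^esub> lift \<in> comm2"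
    by (simp_all add: mem_form)
  then show "iota2 \<Theta> \<xi> = iota2 \<Theta> lift"
    using iota2_comm2[OF d \<xi>(2)] iota2_closed[OF d]
    by (simp add: addhom_minus[OF iota2_props(1)[OF d] O2.abelian_group O1.abelian_group] O1.diff_simps)
qed

text \<open>Closedness is an equation in DR^3, so the differential of the representative is only a
  sum of supercommutators; the contraction \<open>j3\<close> later carries these into
  supercommutators of degree two.\<close>

lemma d2_lift: "d2 lift \<in> comm3"
proof -
  have "dDR2 \<omega> = comm3 +>\<^bsub>Omega3\<^esub> d2 lift"
    unfolding dDR2_def
  proof (rule the_elem_constant)
    show "lift \<in> \<omega>" by (rule lift_mem)
    fix \<xi> assume "\<xi> \<in> \<omega>"
    then have \<xi>: "\<xi> \<in> carrier Omega2" "\<xi> \<ominus>\<^bsub>Omega2\<^esub> lift \<in> comm2"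
      by (simp_all add: mem_form)
    then show "comm3 +>\<^bsub>Omega3\<^esub> d2 \<xi> = comm3 +>\<^bsub>Omega3\<^esub> d2 lift"
      using d2_comm2[OF \<xi>(2)]
      by (simp add: O3.coset_eq_iff[OF comm3_subgroup] addhom_minus[OF d2_props(1) O2.abelian_group O3.abelian_group])
  qed
  moreover have "dDR2 \<omega> = comm3"
    using bisymplectic by (simp add: bisymplectic_def DR3_def A_FactGroup_def)
  ultimately show ?thesis
    using O3.coset_self[OF comm3_subgroup, of "d2 lift"] by simp
qed

text \<open>Non-degeneracy in the form used below: since da is itself a contraction of the form, a
  derivation can be tested on a by contracting the form twice.\<close>

lemma iota2_surj:
  assumes "\<alpha> \<in> carrier Omega1"
  obtains \<Theta> where "\<Theta> \<in> carrier DDer" "iota2 \<Theta> lift = \<alpha>"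
proof -
  have "\<alpha> \<in> (\<lambda>\<Theta>. iota \<Theta> \<omega>) ` carrier DDer"
    using bisymplectic assms by (auto simp: bisymplectic_def bij_betw_def)
  then show thesis
    using that iota_eq by auto
qed

text \<open>\<open>D\<close> is a Hamiltonian derivation with Hamiltonian \<open>a\<close>: \<open>i\<^sub>D \<omega> = da\<close> in \<open>DR\<^sup>1\<close>.\<close>

definition ham :: "('a \<Rightarrow> 'a) \<Rightarrow> 'a \<Rightarrow> bool" where
  "ham D a \<longleftrightarrow> D \<in> carrier Der \<and> a \<in> carrier A \<and> j2 D lift \<ominus>\<^bsub>Omega1\<^esub> d0 a \<in> comm1"

text \<open>Once da is written as the contraction of the form by \<Theta>, D(a) is minus the
  contraction by \<Theta> of i_D of the form. That contraction annihilates commutators, so a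
  hypothesis in DR^1 gives the exact vanishing of D(a).\<close>

lemma j2_inj:
  assumes D: "D \<in> carrier Der" and c: "j2 D lift \<in> comm1"
  shows "D = \<zero>\<^bsub>Der\<^esub>"
proof -
  note d = Der_deriv[OF D]
  have "D a = \<zero>" if a: "a \<in> carrier A" for a
  proof -
    obtain \<Theta> where \<Theta>: "\<Theta> \<in> carrier DDer" "iota2 \<Theta> lift = d0 a"
      using iota2_surj[OF d0_closed[OF a]] .
    have "D a = j1 D (iota2 \<Theta> lift)"
      using a by (simp add: \<Theta>(2) j1_d0[OF d])
    also have "\<dots> = \<ominus> kap \<Theta> (j2 D lift)"
      by (rule j1_iota2[OF DDer_deriv[OF \<Theta>(1)] d]) simp
    finally show ?thesis
      by (simp add: kap_comm1[OF DDer_deriv[OF \<Theta>(1)] c])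
  qed
  then show ?thesis
    using D by (auto simp: Der_simps Der_iff extensional_def fun_eq_iff restrict_def)
qed

lemma comm1_diff_add:
  assumes "x \<ominus>\<^bsub>Omega1\<^esub> y \<in> comm1" "x' \<ominus>\<^bsub>Omega1\<^esub> y' \<in> comm1"
    "x \<in> carrier Omega1" "y \<in> carrier Omega1" "x' \<in> carrier Omega1" "y' \<in> carrier Omega1"
  shows "(x \<oplus>\<^bsub>Omega1\<^esub> x') \<ominus>\<^bsub>Omega1\<^esub> (y \<oplus>\<^bsub>Omega1\<^esub> y') \<in> comm1"
proof -
  have "(x \<oplus>\<^bsub>Omega1\<^esub> x') \<ominus>\<^bsub>Omega1\<^esub> (y \<oplus>\<^bsub>Omega1\<^esub> y') = (x \<ominus>\<^bsub>Omega1\<^esub> y) \<oplus>\<^bsub>Omega1\<^esub> (x' \<ominus>\<^bsub>Omega1\<^esub> y')"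
    using assms(3-) by (simp add: O1.diff_simps)
  with comm1_rules(3)[OF assms(1,2)] show ?thesis by simp
qed

text \<open>A consequence of \<open>j2_inj\<close> for the difference of the derivations. It turns
  the equation \<open>ham D a\<close> into a characterisation, so later identities for Hamiltonian
  derivations only require a check of that equation.\<close>

lemma ham_unique:
  assumes "ham D a" "ham E a"
  shows "D = E"
proof -
  note DE = assms[unfolded ham_def]
  note [simp] = j2_closed[OF Der_deriv]
  have "j2 (D \<ominus>\<^bsub>Der\<^esub> E) lift = (j2 D lift \<ominus>\<^bsub>Omega1\<^esub> d0 a) \<ominus>\<^bsub>Omega1\<^esub> (j2 E lift \<ominus>\<^bsub>Omega1\<^esub> d0 a)"
    using DE
    by (simp add: addhom_minus[OF j2_addhom_left Der.abelian_group_axioms O1.abelian_group] O1.diff_simps)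
  also have "\<dots> \<in> comm1"
    using DE by (auto intro: comm1_rules(5))
  finally have "D \<ominus>\<^bsub>Der\<^esub> E = \<zero>\<^bsub>Der\<^esub>"
    using DE by (intro j2_inj) auto
  with DE show ?thesis by (simp add: Der.diff_eq)
qed

lemma ham_add: "\<lbrakk>ham D a; ham E b\<rbrakk> \<Longrightarrow> ham (D \<oplus>\<^bsub>Der\<^esub> E) (a \<oplus> b)"
  using comm1_diff_add[of "j2 D lift" "d0 a" "j2 E lift" "d0 b"]
  by (simp add: ham_def addhom_add[OF j2_addhom_left] addhom_add[OF d0_addhom] j2_closed[OF Der_deriv])

lemma ham_smult: "\<lbrakk>ham D a; c \<in> carrier K\<rbrakk> \<Longrightarrow> ham (c \<odot>\<^bsub>Der\<^esub> D) (c \<odot> a)"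
  using comm1_scal[of c "j2 D lift \<ominus>\<^bsub>Omega1\<^esub> d0 a"]
  by (simp add: ham_def j2_smult_left d0_smult O1.lact_diff j2_closed[OF Der_deriv] Der_smult_closed)

lemma ham_der_of:
  assumes \<Theta>: "\<Theta> \<in> carrier DDer" and a: "a \<in> carrier A" and c: "iota2 \<Theta> lift \<ominus>\<^bsub>Omega1\<^esub> d0 a \<in> comm1"
  shows "ham (der_of \<Theta>) a"
proof -
  note d = DDer_deriv[OF \<Theta>]
  have "j2 (der_of \<Theta>) lift \<ominus>\<^bsub>Omega1\<^esub> d0 a =
      (iota2 \<Theta> lift \<ominus>\<^bsub>Omega1\<^esub> d0 a) \<ominus>\<^bsub>Omega1\<^esub> (iota2 \<Theta> lift \<ominus>\<^bsub>Omega1\<^esub> j2 (der_of \<Theta>) lift)"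
    using a by (simp add: O1.diff_simps iota2_closed[OF d] j2_closed[OF der_of_deriv[OF d]])
  also have "\<dots> \<in> comm1"
    by (rule comm1_rules(5)[OF c iota2_j2[OF d]]) simp
  finally show ?thesis
    using \<Theta> a by (simp add: ham_def der_of_closed)
qed

text \<open>Apply the commutation rule to the representative. Up to commutators L_D i_E contributes
  d(D b), while i_E applied to d i_D + i_D d contributes nothing, because dda = 0 and the form is
  closed in DR.\<close>

lemma ham_bracket:
  assumes D: "ham D a" and E: "ham E b"
  shows "ham (bracket Der D E) (D b)"
proof -
  note DE = D[unfolded ham_def] E[unfolded ham_def]
  note d = Der_deriv[of D] Der_deriv[of E]
  have dd: "deriv AS D" "deriv AS E" using d DE by auto
  note [simp] = j2_closed[OF dd(1)] j2_closed[OF dd(2)] j3_closed[OF dd(1)] lie_deriv_closed[OF dd(1)] D_closed[OF dd(1)]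
  have ab: "a \<in> carrier A" "b \<in> carrier A" using DE by auto
  \<comment> \<open>The Hamiltonian equations for D and E hold only up to these error terms in
    [A, Omega^1].\<close>
  define c where "c = j2 D lift \<ominus>\<^bsub>Omega1\<^esub> d0 a"
  define c' where "c' = j2 E lift \<ominus>\<^bsub>Omega1\<^esub> d0 b"
  have c: "c \<in> comm1" "c' \<in> comm1" using DE by (auto simp: c_def c'_def)
  have cc: "c \<in> carrier Omega1" "c' \<in> carrier Omega1" using c comm1_rules(1) by auto
  have j: "j2 D lift = d0 a \<oplus>\<^bsub>Omega1\<^esub> c" "j2 E lift = d0 b \<oplus>\<^bsub>Omega1\<^esub> c'"
    using ab by (simp_all add: c_def c'_def O1.diff_simps)
  have "j2 (bracket Der D E) lift \<ominus>\<^bsub>Omega1\<^esub> d0 (D b) = lie_deriv D c' \<ominus>\<^bsub>Omega1\<^esub> j2 E (d1 c \<oplus>\<^bsub>Omega2\<^esub> j3 D (d2 lift))"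
  proof -
    have "j2 (bracket Der D E) lift = lie_deriv D (d0 b \<oplus>\<^bsub>Omega1\<^esub> c') \<ominus>\<^bsub>Omega1\<^esub> j2 E (d1 (d0 a \<oplus>\<^bsub>Omega1\<^esub> c) \<oplus>\<^bsub>Omega2\<^esub> j3 D (d2 lift))"
      using j2_bracket[OF dd, of lift] by (simp add: Der_simps j)
    then show ?thesis
      using ab cc by (simp add: addhom_add[OF lie_deriv_addhom[OF dd(1)]] lie_deriv_d0[OF dd(1)] d1_add O1.diff_simps)
  qed
  \<comment> \<open>What is left is built from \<open>c\<close>, \<open>c'\<close> and
    \<open>d2 lift\<close>; the differential and the contractions respect supercommutators.\<close>
  also have "\<dots> \<in> comm1"
    unfolding lie_deriv_def[OF dd(1)]
    by (intro comm1_rules(5,3) j2_comm2[OF dd(1)] j2_comm2[OF dd(2)] d1_comm1 comm2_rules(3) j3_comm3[OF dd(1)] d2_lift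
        c d0_A_comm j1_comm1[OF dd(1)])
  finally show ?thesis
    using DE by (simp add: ham_def Der_bracket_closed)
qed

definition th :: "'a \<Rightarrow> 'a \<Rightarrow> 'a" where "th a = theta \<omega> (A_comm +> a)"

text \<open>Theta is defined by choosing a preimage under \<open>iota_nat\<close>. The choice is
  unfolded only here; afterwards \<open>th a\<close> is handled through the equation
  \<open>ham\<close>.\<close>

lemma ham_th:
  assumes a: "a \<in> carrier A"
  shows "ham (th a) a"
proof -
  have d: "dDR0 (A_comm +> a) = comm1 +>\<^bsub>Omega1\<^esub> d0 a"
    unfolding dDR0_def
  proof (rule the_elem_constant)
    show "a \<in> A_comm +> a"
      by (rule coset_self[OF A_comm_subgroup a])
    fix x assume "x \<in> A_comm +> a"
    then have x: "x \<in> carrier A" "x \<ominus> a \<in> A_comm"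
      using coset_mem[OF A_comm_subgroup a] by simp_all
    then show "comm1 +>\<^bsub>Omega1\<^esub> d0 x = comm1 +>\<^bsub>Omega1\<^esub> d0 a"
      using d0_A_comm[OF x(2)] a
      by (simp add: O1.coset_eq_iff[OF comm1_subgroup] addhom_minus[OF d0_addhom is_abelian_group O1.abelian_group])
  qed
  have nat: "iota_nat \<omega> (DDer_comm +>\<^bsub>DDer\<^esub> \<Theta>) = comm1 +>\<^bsub>Omega1\<^esub> iota2 \<Theta> lift" if \<Theta>: "\<Theta> \<in> carrier DDer" for \<Theta>
    unfolding iota_nat_def
  proof (rule the_elem_constant)
    show "\<Theta> \<in> DDer_comm +>\<^bsub>DDer\<^esub> \<Theta>"
      by (rule DDer.coset_self[OF DDer_comm_subgroup \<Theta>])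
    fix \<Phi> assume "\<Phi> \<in> DDer_comm +>\<^bsub>DDer\<^esub> \<Theta>"
    then have \<Phi>: "\<Phi> \<in> carrier DDer" "\<Phi> \<ominus>\<^bsub>DDer\<^esub> \<Theta> \<in> DDer_comm"
      using DDer.coset_mem[OF DDer_comm_subgroup \<Theta>] by simp_all
    then show "comm1 +>\<^bsub>Omega1\<^esub> iota \<Phi> \<omega> = comm1 +>\<^bsub>Omega1\<^esub> iota2 \<Theta> lift"
      using iota2_DDer_comm[OF lift(1) \<Phi>(2)] \<Theta>
      by (simp add: O1.coset_eq_iff[OF comm1_subgroup] iota_eq iota2_closed[OF DDer_deriv]
          addhom_minus[OF iota2_addhom_left DDer.abelian_group_axioms O1.abelian_group])
  qed
  define X where "X = inv_into (carrier DDer_nat) (iota_nat \<omega>) (dDR0 (A_comm +> a))"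
  \<comment> \<open>This double derivation shows that the class of da is in the range of
    \<open>iota_nat\<close>, so that the chosen \<open>X\<close> really is a preimage;
    \<open>X\<close> need not be known to be the class of \<open>\<Theta>0\<close>.\<close>
  obtain \<Theta>0 where \<Theta>0: "\<Theta>0 \<in> carrier DDer" "iota2 \<Theta>0 lift = d0 a"
    using iota2_surj[OF d0_closed[OF a]] .
  have "dDR0 (A_comm +> a) \<in> iota_nat \<omega> ` carrier DDer_nat"
    using nat[OF \<Theta>0(1)] \<Theta>0 d by (force simp: DDer_nat_def carrier_A_Mod)
  then have "X \<in> carrier DDer_nat" and X2: "iota_nat \<omega> X = dDR0 (A_comm +> a)"
    unfolding X_def by (rule inv_into_into, rule f_inv_into_f)
  then obtain \<Theta> where \<Theta>: "\<Theta> \<in> carrier DDer" and X: "X = DDer_comm +>\<^bsub>DDer\<^esub> \<Theta>"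
    by (auto simp: DDer_nat_def carrier_A_Mod)
  have c: "iota2 \<Theta> lift \<ominus>\<^bsub>Omega1\<^esub> d0 a \<in> comm1"
    using X2 \<Theta> a unfolding X nat[OF \<Theta>] d
    by (simp add: O1.coset_eq_iff[OF comm1_subgroup] iota2_closed[OF DDer_deriv])
  have "th a = the_elem (der_of ` X)"
    by (simp add: th_def theta_def Ham_def X_def)
  also have "\<dots> = der_of \<Theta>"
    unfolding X
  proof (rule the_elem_constant)
    show "\<Theta> \<in> DDer_comm +>\<^bsub>DDer\<^esub> \<Theta>"
      by (rule DDer.coset_self[OF DDer_comm_subgroup \<Theta>])
    fix \<Phi> assume "\<Phi> \<in> DDer_comm +>\<^bsub>DDer\<^esub> \<Theta>"
    then have \<Phi>: "\<Phi> \<in> carrier DDer" "\<Phi> \<ominus>\<^bsub>DDer\<^esub> \<Theta> \<in> DDer_comm"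
      using DDer.coset_mem[OF DDer_comm_subgroup \<Theta>] by simp_all
    then show "der_of \<Phi> = der_of \<Theta>"
      using der_of_comm[OF \<Phi>(2)] \<Theta> der_of_closed
      by (simp add: addhom_minus[OF der_of_addhom DDer.abelian_group_axioms Der.abelian_group_axioms] Der.diff_eq)
  qed
  finally show ?thesis
    using ham_der_of[OF \<Theta> a c] by simp
qed

lemma th_eqI: "ham D a \<Longrightarrow> th a = D"
  using ham_unique[OF ham_th, of a D] by (simp add: ham_def)

lemma th_Der: "a \<in> carrier A \<Longrightarrow> th a \<in> carrier Der"
  using ham_th by (simp add: ham_def)

lemma th_closed [simp]: "\<lbrakk>a \<in> carrier A; x \<in> carrier A\<rbrakk> \<Longrightarrow> th a x \<in> carrier A"
  by (rule Der_closed[OF th_Der])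

lemma th_addhom: "a \<in> carrier A \<Longrightarrow> th a \<in> addhom A A"
  using derivD(1)[OF Der_deriv[OF th_Der]] by simp

lemma th_add: "\<lbrakk>a \<in> carrier A; b \<in> carrier A\<rbrakk> \<Longrightarrow> th (a \<oplus> b) = th a \<oplus>\<^bsub>Der\<^esub> th b"
  by (intro th_eqI ham_add ham_th)

lemma th_smult: "\<lbrakk>c \<in> carrier K; a \<in> carrier A\<rbrakk> \<Longrightarrow> th (c \<odot> a) = c \<odot>\<^bsub>Der\<^esub> th a"
  by (intro th_eqI ham_smult ham_th)

lemma th_bracket: "\<lbrakk>a \<in> carrier A; b \<in> carrier A\<rbrakk> \<Longrightarrow> th (th a b) = bracket Der (th a) (th b)"
  by (rule th_eqI[OF ham_bracket[OF ham_th ham_th]])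

text \<open>For D = \<open>th a\<close>, contract the equation "i_D of the form is da plus
  commutators" once more with D: the left side vanishes by \<open>j1_j2_self\<close>, da gives D(a),
  and commutators land in [A, A].\<close>

lemma th_self: "a \<in> carrier A \<Longrightarrow> th a a \<in> A_comm"
proof -
  assume a: "a \<in> carrier A"
  note d = Der_deriv[OF th_Der[OF a]]
  have c: "j2 (th a) lift \<ominus>\<^bsub>Omega1\<^esub> d0 a \<in> comm1"
    using ham_th[OF a] by (simp add: ham_def)
  have "\<ominus> th a a = j1 (th a) (j2 (th a) lift \<ominus>\<^bsub>Omega1\<^esub> d0 a)"
    using a by (simp add: j1_diff[OF d] j2_closed[OF d] j1_j2_self[OF d] j1_d0[OF d]) (simp add: a_minus_def)
  then have "\<ominus> (\<ominus> th a a) \<in> A_comm"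
    using j1_comm1[OF d c] A_comm_rules(4) by metis
  with a show ?thesis by simp
qed

text \<open>Polarisation of \<open>th_self\<close> at a + b.\<close>

lemma th_antisym: "\<lbrakk>a \<in> carrier A; b \<in> carrier A\<rbrakk> \<Longrightarrow> th a b \<oplus> th b a \<in> A_comm"
proof -
  assume ab: "a \<in> carrier A" "b \<in> carrier A"
  have "th a b \<oplus> th b a = th (a \<oplus> b) (a \<oplus> b) \<ominus> (th a a \<oplus> th b b)"
    using ab by (simp add: th_add Der_simps addhom_add[OF th_addhom] diff_simps)
  also have "\<dots> \<in> A_comm"
    using ab th_self by (intro A_comm_rules(5,3)) auto
  finally show ?thesis .
qed

end

section \<open>The moment map representative \<open>w\<close> and its Hamiltonian identities\<close>

locale moment_map = bisymplectic_form K R A \<eta> \<omega>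
  for K :: "'k ring" and R :: "('k, 'r) module" and A :: "('k, 'a) module" (structure) and \<eta> :: "'r \<Rightarrow> 'a"
    and \<omega> :: "(('a \<times> 'a) frag set \<times> ('a \<times> 'a) frag set) frag set set" +
  fixes e :: "('r \<times> 'r) frag set" and w :: 'a
  assumes e: "symmetric_separability_element K R e"
    and w [simp]: "w \<in> carrier A"
    and mu: "is_mu_nc e \<omega> (\<eta> ` carrier R +> w)"
begin

text \<open>d vanishes on the image of R and is therefore constant on the class of w, so the
  defining equation of the moment map becomes an equation for w itself.\<close>

lemma iota2_Delta: "iota2 (Delta e) lift = d0 w"
proof -
  have "the_elem (d0 ` (\<eta> ` carrier R +> w)) = d0 w"
  proof (rule the_elem_constant)
    show "\<zero> \<oplus> w \<in> \<eta> ` carrier R +> w"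
      using addhom_zero[OF eta_addhom R.is_abelian_group is_abelian_group] by (force simp: a_r_coset_def')
    fix x assume "x \<in> \<eta> ` carrier R +> w"
    then show "d0 x = d0 w"
      by (auto simp: a_r_coset_def' addhom_add[OF d0_addhom])
  qed
  then show ?thesis
    using mu iota_eq[OF Delta_DDer[OF e]] by (simp add: is_mu_nc_def)
qed

text \<open>Contraction with \<Delta> kills the commutator error as well as da, so the value at w is
  zero in A and not merely modulo [A, A]. Preserving the ideal generated by w relies on this
  exactness.\<close>

lemma th_w: "a \<in> carrier A \<Longrightarrow> th a w = \<zero>"
proof -
  assume a: "a \<in> carrier A"
  note d = Der_deriv[OF th_Der[OF a]] and D = DDer_deriv[OF Delta_DDer[OF e]]
  have c: "j2 (th a) lift \<ominus>\<^bsub>Omega1\<^esub> d0 a \<in> comm1"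
    using ham_th[OF a] by (simp add: ham_def)
  have "kap (Delta e) (j2 (th a) lift) = \<zero>"
    using kap_comm1[OF D c] a
    by (simp add: kap_diff[OF D] j2_closed[OF d] kap_Delta_d0[OF e] addhom_closed[OF kap_addhom[OF D]] diff_simps)
  then show ?thesis
    using j1_iota2[OF D d, of lift] by (simp add: iota2_Delta j1_d0[OF d])
qed

text \<open>The witness is read off from d(cw) = c dw + dc w: c\<Delta> contracts to c dw, w\<Phi>
  contracts to w dc, and w dc differs from dc w by a commutator. Multiplying out c\<Delta>(x) gives
  the inner part, and multiplying out w\<Phi>(x) places w between the two factors of
  \<Phi>(x).\<close>

lemma th_mult_w:
  assumes c: "c \<in> carrier A"
  obtains k \<Phi> where "k \<in> carrier A" "\<Phi> \<in> carrier DDer"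
    "\<And>x. x \<in> carrier A \<Longrightarrow> th (c \<otimes> w) x = (x \<otimes> k \<ominus> k \<otimes> x) \<oplus> mult2 K A (inner w \<one> (\<Phi> x))"
proof -
  obtain \<Phi> where \<Phi>: "\<Phi> \<in> carrier DDer" "iota2 \<Phi> lift = d0 c"
    using iota2_surj[OF d0_closed[OF c]] .
  let ?D = "\<lambda>x\<in>carrier A. inner c \<one> (Delta e x)" and ?P = "\<lambda>x\<in>carrier A. inner w \<one> (\<Phi> x)"
  note DP = DDer_act_closed[OF c one_closed Delta_DDer[OF e]] DDer_act_closed[OF w one_closed \<Phi>(1)]
  have "iota2 (?D \<oplus>\<^bsub>DDer\<^esub> ?P) lift = c \<triangleright>\<^bsub>Omega1\<^esub> d0 w \<oplus>\<^bsub>Omega1\<^esub> w \<triangleright>\<^bsub>Omega1\<^esub> d0 c"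
    using c by (simp add: addhom_add[OF iota2_addhom_left DP] iota2_act Delta_DDer[OF e] \<Phi> iota2_Delta)
  then have "iota2 (?D \<oplus>\<^bsub>DDer\<^esub> ?P) lift \<ominus>\<^bsub>Omega1\<^esub> d0 (c \<otimes> w) = w \<triangleright>\<^bsub>Omega1\<^esub> d0 c \<ominus>\<^bsub>Omega1\<^esub> d0 c \<triangleleft>\<^bsub>Omega1\<^esub> w"
    using c by (simp add: d0_mult O1.diff_simps)
  then have "iota2 (?D \<oplus>\<^bsub>DDer\<^esub> ?P) lift \<ominus>\<^bsub>Omega1\<^esub> d0 (c \<otimes> w) \<in> comm1"
    using comm1I[OF w d0_closed[OF c]] by simp
  then have t: "th (c \<otimes> w) = der_of (?D \<oplus>\<^bsub>DDer\<^esub> ?P)"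
    using c DP by (intro th_eqI ham_der_of) auto
  \<comment> \<open>The element e' c e'', obtained by inserting c between the factors of the
    separability element.\<close>
  let ?k = "mult2 K A (inner c \<one> (ee e))"
  have k: "inner c \<one> (ee e) \<in> carrier AA"
    using c by (simp add: inner_closed ee_closed[OF e])
  show thesis
  proof (rule that[OF _ \<Phi>(1)])
    show "?k \<in> carrier A"
      using k by simp
    fix x assume x: "x \<in> carrier A"
    have "mult2 K A (inner c \<one> (Delta e x)) = x \<otimes> ?k \<ominus> ?k \<otimes> x"
      using x c k
      by (simp add: Delta_eq[OF e] ee_closed[OF e] addhom_minus[OF inner_props(1) AA.abelian_group AA.abelian_group]
          addhom_minus[OF mult2_props(1) AA.abelian_group is_abelian_group] inner_lact inner_ract mult2_lact mult2_ract)
    then show "th (c \<otimes> w) x = (x \<otimes> ?k \<ominus> ?k \<otimes> x) \<oplus> mult2 K A (inner w \<one> (\<Phi> x))"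
      using x c \<Phi>(1) Delta_DDer[OF e]
      by (simp add: t der_of_def DDer_simps addhom_add[OF mult2_props(1)] inner_closed DDer_closed)
  qed
qed

end

section \<open>Quotients\<close>

text \<open>Serves four quotients: A by the ideal of w, A by [A, A], the quotient algebra by its own
  commutators, and derivations by inner derivations.\<close>

locale submod = module K M + additive_subgroup N M
  for K and M (structure) and N +
  assumes smult_sub: "\<lbrakk>c \<in> carrier K; x \<in> N\<rbrakk> \<Longrightarrow> c \<odot> x \<in> N"
begin

abbreviation Q where "Q \<equiv> quot_module M N"

lemma quot_carrier: "carrier Q = {N +> x | x. x \<in> carrier M}"
  by (auto simp: quot_module_def ring.defs FactRing_def A_RCOSETS_def')

lemma quot_closed [simp]: "x \<in> carrier M \<Longrightarrow> N +> x \<in> carrier Q"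
  by (auto simp: quot_carrier)

lemma quot_zero: "\<zero>\<^bsub>Q\<^esub> = N"
  by (simp add: quot_module_def ring.defs FactRing_def)

lemma zero_coset: "N +> \<zero> = N"
  using a_subset by simp

lemma coset_iff: "\<lbrakk>x \<in> carrier M; y \<in> carrier M\<rbrakk> \<Longrightarrow> N +> x = N +> y \<longleftrightarrow> x \<ominus> y \<in> N"
  by (rule coset_eq_iff[OF a_subgroup])

lemma coset_zero_iff: "x \<in> carrier M \<Longrightarrow> N +> x = \<zero>\<^bsub>Q\<^esub> \<longleftrightarrow> x \<in> N"
  using coset_iff[of x \<zero>] by (simp add: quot_zero zero_coset diff_zero)

lemma quot_add: "\<lbrakk>x \<in> carrier M; y \<in> carrier M\<rbrakk> \<Longrightarrow> (N +> x) \<oplus>\<^bsub>Q\<^esub> (N +> y) = N +> (x \<oplus> y)"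
  using abelian_subgroup.a_rcos_sum[OF abelian_subgroupI3, of N M x y]
  by (simp add: quot_module_def ring.defs FactRing_def additive_subgroup_axioms M.abelian_group_axioms)

text \<open>The scalar action on the quotient is encoded as a union over representatives, and the
  cosets in that union all coincide.\<close>

lemma quot_smult: "\<lbrakk>c \<in> carrier K; x \<in> carrier M\<rbrakk> \<Longrightarrow> c \<odot>\<^bsub>Q\<^esub> (N +> x) = N +> (c \<odot> x)"
proof -
  assume c: "c \<in> carrier K" and x: "x \<in> carrier M"
  have "N +> (c \<odot> y) = N +> (c \<odot> x)" if y: "y \<in> N +> x" for y
  proof -
    have y: "y \<in> carrier M" "y \<ominus> x \<in> N"
      using y coset_mem[OF a_subgroup x] by simp_all
    have "c \<odot> y \<ominus> c \<odot> x = c \<odot> (y \<ominus> x)"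
      using c x y by (simp add: a_minus_def smult_r_distr smult_r_minus)
    with smult_sub[OF c y(2)] show ?thesis
      using c x y by (simp add: coset_iff)
  qed
  then have "(\<Union>y\<in>N +> x. N +> (c \<odot> y)) = N +> (c \<odot> x)"
    using coset_self[OF a_subgroup x] by blast
  then show ?thesis
    by (simp add: quot_module_def ring.defs module.defs)
qed

lemma quot_abelian_group: "abelian_group Q"
proof (rule abelian_groupI)
  show "\<exists>Y\<in>carrier Q. Y \<oplus>\<^bsub>Q\<^esub> X = \<zero>\<^bsub>Q\<^esub>" if "X \<in> carrier Q" for X
  proof -
    obtain x where x: "x \<in> carrier M" "X = N +> x" using \<open>X \<in> carrier Q\<close> by (auto simp: quot_carrier)
    then have "(N +> (\<ominus> x)) \<oplus>\<^bsub>Q\<^esub> X = \<zero>\<^bsub>Q\<^esub>"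
      by (simp add: quot_add quot_zero zero_coset M.l_neg)
    then show ?thesis using x by (intro bexI[of _ "N +> (\<ominus> x)"]) auto
  qed
  have "\<zero>\<^bsub>Q\<^esub> = N +> \<zero>"
    by (simp add: quot_zero zero_coset)
  then show "\<zero>\<^bsub>Q\<^esub> \<in> carrier Q" "\<And>X. X \<in> carrier Q \<Longrightarrow> \<zero>\<^bsub>Q\<^esub> \<oplus>\<^bsub>Q\<^esub> X = X"
    by (auto simp: quot_carrier quot_add)
qed (auto simp: quot_carrier quot_add M.a_ac)

lemma quot_is_module: "module K Q"
proof (rule moduleI)
  show "cring K" ..
qed (auto simp: quot_abelian_group quot_carrier quot_smult quot_add smult_l_distr smult_r_distr smult_assoc1)

lemma quot_addhom: "(\<lambda>x. N +> x) \<in> addhom M Q"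
  by (rule addhomI) (simp_all add: quot_add)

lemma quot_minus: "\<lbrakk>x \<in> carrier M; y \<in> carrier M\<rbrakk> \<Longrightarrow> (N +> x) \<ominus>\<^bsub>Q\<^esub> (N +> y) = N +> (x \<ominus> y)"
  by (rule addhom_minus[OF quot_addhom M.abelian_group_axioms quot_abelian_group, symmetric])

lemma the_elem_coset:
  assumes x: "x \<in> carrier M"
    and f: "\<And>y. \<lbrakk>y \<in> carrier M; y \<ominus> x \<in> N\<rbrakk> \<Longrightarrow> f y = f x"
  shows "the_elem (f ` (N +> x)) = f x"
  by (rule the_elem_constant[OF coset_self[OF a_subgroup x]])
    (use f coset_mem[OF a_subgroup x] in auto)

end

lemma submodI:
  assumes "module K M" "subgroup N (add_monoid M)"
    and "\<And>c x. \<lbrakk>c \<in> carrier K; x \<in> N\<rbrakk> \<Longrightarrow> c \<odot>\<^bsub>M\<^esub> x \<in> N"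
  shows "submod K M N"
  using assms by (intro submod.intro additive_subgroup.intro submod_axioms.intro)

context kalgebra
begin

lemma ideal_submod: "ideal I A \<Longrightarrow> submod K A I"
proof -
  assume "ideal I A"
  then interpret I: ideal I A .
  show ?thesis
  proof
    show "c \<odot> x \<in> I" if "c \<in> carrier K" "x \<in> I" for c x
      using I.I_l_closed[of x "scal A c"] that I.a_subset by (auto simp: scal_mult)
  qed
qed

context
  fixes I assumes I: "ideal I A"
begin

interpretation I: ideal I A by (rule I)
interpretation S: submod K A I by (rule ideal_submod[OF I])

lemma quot_mult: "\<lbrakk>x \<in> carrier A; y \<in> carrier A\<rbrakk> \<Longrightarrow>
    (I +> x) \<otimes>\<^bsub>quot_module A I\<^esub> (I +> y) = I +> (x \<otimes> y)"
  using I.rcoset_mult_add[of x y] by (simp add: quot_module_def ring.defs FactRing_def)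

lemma quot_one: "\<one>\<^bsub>quot_module A I\<^esub> = I +> \<one>"
  by (simp add: quot_module_def ring.defs FactRing_def)

lemma quot_kalgebra: "kalgebra K (quot_module A I)"
proof -
  interpret Q: module K "quot_module A I" by (rule S.quot_is_module)
  interpret Q: ring "quot_module A I"
    by (rule ringI[OF S.quot_abelian_group monoidI])
      (auto simp: S.quot_carrier quot_mult quot_one m_assoc S.quot_add l_distr r_distr)
  show ?thesis
    by unfold_locales (auto simp: S.quot_carrier quot_mult S.quot_smult smult_mult_left smult_mult_right)
qed

end

end

section \<open>Commutators and inner derivations as submodules; outer derivations\<close>

context nc_forms
begin

lemma A_comm_submod: "submod K A A_comm"
proof (rule submodI)
  show "module K A" ..
  show "subgroup A_comm (add_monoid A)" by (rule A_comm_subgroup)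
  fix c x assume c: "c \<in> carrier K" and x: "x \<in> A_comm"
  have h: "(\<lambda>x. c \<odot> x) \<in> addhom A A"
    by (rule addhomI) (simp_all add: c smult_r_distr)
  show "c \<odot> x \<in> A_comm"
  proof (rule A_comm_into[OF is_abelian_group h A_comm_subgroup _ x])
    fix a b assume ab: "a \<in> carrier A" "b \<in> carrier A"
    have "c \<odot> (a \<otimes> b \<ominus> b \<otimes> a) = (c \<odot> a) \<otimes> b \<ominus> b \<otimes> (c \<odot> a)"
      using ab c by (simp add: a_minus_def smult_r_distr smult_r_minus smult_mult_left smult_mult_right)
    then show "c \<odot> (a \<otimes> b \<ominus> b \<otimes> a) \<in> A_comm"
      using A_commI[of "c \<odot> a" b] ab c by simp
  qed
qed

lemma Der_module: "module K Der"
proof (rule moduleI)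
  show "cring K" ..
  show "abelian_group Der" ..
  show "c \<odot>\<^bsub>Der\<^esub> D \<in> carrier Der" if "c \<in> carrier K" "D \<in> carrier Der" for c D
    using that by (rule Der_smult_closed)
qed (auto simp: Der_simps Der_closed smult_l_distr smult_r_distr smult_assoc1
    Der_iff extensional_def fun_eq_iff restrict_def)

lemma Inn_submod: "submod K Der Inn"
proof -
  have Inn: "D \<in> Inn \<longleftrightarrow> D \<in> carrier Der \<and> (\<exists>a\<in>carrier A. \<forall>x\<in>carrier A. D x = a \<otimes> x \<ominus> x \<otimes> a)" for D
    by (simp add: Inn_def)
  have minus: "(D \<ominus>\<^bsub>Der\<^esub> E) x = D x \<ominus> E x" if "D \<in> carrier Der" "E \<in> carrier Der" "x \<in> carrier A" for D E x
  proof -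
    have "(\<lambda>D. D x) \<in> addhom Der A"
      by (rule addhomI) (use that in \<open>auto simp: Der_closed Der_simps\<close>)
    from addhom_minus[OF this Der.abelian_group_axioms is_abelian_group that(1,2)] show ?thesis .
  qed
  show ?thesis
  proof (rule submodI[OF Der_module])
    show "subgroup Inn (add_monoid Der)"
    proof (rule Der.subgroupI_add)
      show "Inn \<subseteq> carrier Der" by (auto simp: Inn)
      show "\<zero>\<^bsub>Der\<^esub> \<in> Inn"
        by (auto simp: Inn Der_simps diff_self intro!: bexI[of _ \<zero>] Der.zero_closed[unfolded Der_simps])
      fix D E assume "D \<in> Inn" "E \<in> Inn"
      then obtain a b where ab: "D \<in> carrier Der" "E \<in> carrier Der" "a \<in> carrier A" "b \<in> carrier A"
        and eq: "\<And>x. x \<in> carrier A \<Longrightarrow> D x = a \<otimes> x \<ominus> x \<otimes> a" "\<And>x. x \<in> carrier A \<Longrightarrow> E x = b \<otimes> x \<ominus> x \<otimes> b"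
        by (auto simp: Inn)
      then show "D \<ominus>\<^bsub>Der\<^esub> E \<in> Inn"
        by (auto simp: Inn minus mult_diff diff_mult diff_simps intro!: bexI[of _ "a \<ominus> b"])
    qed
    fix c D assume c: "c \<in> carrier K" and "D \<in> Inn"
    then obtain a where a: "D \<in> carrier Der" "a \<in> carrier A"
      and eq: "\<And>x. x \<in> carrier A \<Longrightarrow> D x = a \<otimes> x \<ominus> x \<otimes> a"
      by (auto simp: Inn)
    have "(c \<odot>\<^bsub>Der\<^esub> D) x = (c \<odot> a) \<otimes> x \<ominus> x \<otimes> (c \<odot> a)" if "x \<in> carrier A" for x
      using that c a by (simp add: Der_simps eq a_minus_def smult_r_distr smult_r_minus smult_mult_left smult_mult_right)
    with c a show "c \<odot>\<^bsub>Der\<^esub> D \<in> Inn"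
      by (auto simp: Inn Der_smult_closed intro!: bexI[of _ "c \<odot> a"])
  qed
qed

text \<open>The bracket of D with the inner derivation of a is the inner derivation of D(a), so
  \<open>Inn\<close> is a Lie ideal.\<close>

lemma Inn_bracket:
  assumes D: "D \<in> carrier Der" and E: "E \<in> Inn"
  shows "bracket Der D E \<in> Inn" "bracket Der E D \<in> Inn"
proof -
  obtain a where a: "E \<in> carrier Der" "a \<in> carrier A"
    and eq: "\<And>x. x \<in> carrier A \<Longrightarrow> E x = a \<otimes> x \<ominus> x \<otimes> a"
    using E by (auto simp: Inn_def)
  note d = derivD[OF Der_deriv[OF D]]
  have dm: "D (x \<ominus> y) = D x \<ominus> D y" if "x \<in> carrier A" "y \<in> carrier A" for x y
    using addhom_minus[of D A A x y] d(1) that is_abelian_group by simp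
  have "bracket Der D E x = D a \<otimes> x \<ominus> x \<otimes> D a" if "x \<in> carrier A" for x
    using that a D d by (simp add: Der_simps eq dm Der_closed diff_simps)
  then show "bracket Der D E \<in> Inn"
    using D a d by (auto simp: Inn_def Der_bracket_closed intro!: bexI[of _ "D a"])
  have "bracket Der E D x = (\<ominus> D a) \<otimes> x \<ominus> x \<otimes> (\<ominus> D a)" if "x \<in> carrier A" for x
    using that a D d by (simp add: Der_simps eq dm Der_closed l_minus r_minus diff_simps)
  then show "bracket Der E D \<in> Inn"
    using D a d by (auto simp: Inn_def Der_bracket_closed intro!: bexI[of _ "\<ominus> D a"])
qed

text \<open>The quotient bracket is a union over pairs of representatives; that union is a single
  coset because \<open>Inn\<close> is a Lie ideal.\<close>

lemma quot_lie_Inn: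
  shows "carrier (quot_lie Der Inn) = {Inn +>\<^bsub>Der\<^esub> D | D. D \<in> carrier Der}"
    and "\<And>D E. \<lbrakk>D \<in> carrier Der; E \<in> carrier Der\<rbrakk> \<Longrightarrow>
      (Inn +>\<^bsub>Der\<^esub> D) \<oplus>\<^bsub>quot_lie Der Inn\<^esub> (Inn +>\<^bsub>Der\<^esub> E) = Inn +>\<^bsub>Der\<^esub> (D \<oplus>\<^bsub>Der\<^esub> E)"
    and "\<And>c D. \<lbrakk>c \<in> carrier K; D \<in> carrier Der\<rbrakk> \<Longrightarrow>
      c \<odot>\<^bsub>quot_lie Der Inn\<^esub> (Inn +>\<^bsub>Der\<^esub> D) = Inn +>\<^bsub>Der\<^esub> (c \<odot>\<^bsub>Der\<^esub> D)"
    and "\<And>D E. \<lbrakk>D \<in> carrier Der; E \<in> carrier Der\<rbrakk> \<Longrightarrow>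
      bracket (quot_lie Der Inn) (Inn +>\<^bsub>Der\<^esub> D) (Inn +>\<^bsub>Der\<^esub> E) = Inn +>\<^bsub>Der\<^esub> bracket Der D E"
proof -
  interpret S: submod K Der Inn by (rule Inn_submod)
  show "carrier (quot_lie Der Inn) = {Inn +>\<^bsub>Der\<^esub> D | D. D \<in> carrier Der}"
    by (simp add: quot_lie_def with_bracket_def module.defs S.quot_carrier)
  show "(Inn +>\<^bsub>Der\<^esub> D) \<oplus>\<^bsub>quot_lie Der Inn\<^esub> (Inn +>\<^bsub>Der\<^esub> E) = Inn +>\<^bsub>Der\<^esub> (D \<oplus>\<^bsub>Der\<^esub> E)"
    if "D \<in> carrier Der" "E \<in> carrier Der" for D E
    using S.quot_add[OF that] by (simp add: quot_lie_def with_bracket_def module.defs)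
  show "c \<odot>\<^bsub>quot_lie Der Inn\<^esub> (Inn +>\<^bsub>Der\<^esub> D) = Inn +>\<^bsub>Der\<^esub> (c \<odot>\<^bsub>Der\<^esub> D)"
    if "c \<in> carrier K" "D \<in> carrier Der" for c D
    using S.quot_smult[OF that] by (simp add: quot_lie_def with_bracket_def module.defs)
  show "bracket (quot_lie Der Inn) (Inn +>\<^bsub>Der\<^esub> D) (Inn +>\<^bsub>Der\<^esub> E) = Inn +>\<^bsub>Der\<^esub> bracket Der D E"
    if D: "D \<in> carrier Der" and E: "E \<in> carrier Der" for D E
  proof -
    have br: "bracket Der (F \<ominus>\<^bsub>Der\<^esub> D) G = bracket Der F G \<ominus>\<^bsub>Der\<^esub> bracket Der D G"
      "bracket Der G (F \<ominus>\<^bsub>Der\<^esub> D) = bracket Der G F \<ominus>\<^bsub>Der\<^esub> bracket Der G D"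
      if FG: "F \<in> carrier Der" "G \<in> carrier Der" "D \<in> carrier Der" for D F G
    proof -
      have add: "G (x \<oplus> y) = G x \<oplus> G y" if "x \<in> carrier A" "y \<in> carrier A" for x y
        using derivD(3)[OF Der_deriv[OF FG(2)]] that by simp
      have h: "(\<lambda>F. bracket Der F G) \<in> addhom Der Der" "(\<lambda>F. bracket Der G F) \<in> addhom Der Der"
      proof (safe intro!: addhomI Der_bracket_closed FG(2))
        fix D E assume D: "D \<in> carrier Der" and E: "E \<in> carrier Der"
        note [simp] = Der_closed[OF D] Der_closed[OF E] Der_closed[OF FG(2)]
        show "bracket Der (D \<oplus>\<^bsub>Der\<^esub> E) G = bracket Der D G \<oplus>\<^bsub>Der\<^esub> bracket Der E G"
          "bracket Der G (D \<oplus>\<^bsub>Der\<^esub> E) = bracket Der G D \<oplus>\<^bsub>Der\<^esub> bracket Der G E"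
          by (simp_all add: Der_simps fun_eq_iff restrict_def add add_diff diff_add diff_diff diff_diff2 a_ac)
      qed
      show "bracket Der (F \<ominus>\<^bsub>Der\<^esub> D) G = bracket Der F G \<ominus>\<^bsub>Der\<^esub> bracket Der D G"
        "bracket Der G (F \<ominus>\<^bsub>Der\<^esub> D) = bracket Der G F \<ominus>\<^bsub>Der\<^esub> bracket Der G D"
        by (rule addhom_minus[OF h(1) Der.abelian_group_axioms Der.abelian_group_axioms FG(1,3)]
            addhom_minus[OF h(2) Der.abelian_group_axioms Der.abelian_group_axioms FG(1,3)])+
    qed
    have "Inn +>\<^bsub>Der\<^esub> bracket Der F G = Inn +>\<^bsub>Der\<^esub> bracket Der D E"
      if F: "F \<in> Inn +>\<^bsub>Der\<^esub> D" and G: "G \<in> Inn +>\<^bsub>Der\<^esub> E" for F G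
    proof -
      have FG: "F \<in> carrier Der" "F \<ominus>\<^bsub>Der\<^esub> D \<in> Inn" "G \<in> carrier Der" "G \<ominus>\<^bsub>Der\<^esub> E \<in> Inn"
        using F G Der.coset_mem[OF S.a_subgroup] D E by simp_all
      \<comment> \<open>One argument is changed at a time, so that each summand has an entry in
        \<open>Inn\<close>.\<close>
      have "bracket Der F G \<ominus>\<^bsub>Der\<^esub> bracket Der D E = bracket Der (F \<ominus>\<^bsub>Der\<^esub> D) G \<oplus>\<^bsub>Der\<^esub> bracket Der D (G \<ominus>\<^bsub>Der\<^esub> E)"
        using FG D E by (simp add: br Der_bracket_closed Der.diff_simps)
      also have "\<dots> \<in> Inn"
        using FG D E Inn_bracket by blast
      finally show ?thesis
        using FG D E by (simp add: S.coset_iff Der_bracket_closed)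
    qed
    then have "(\<Union>F\<in>Inn +>\<^bsub>Der\<^esub> D. \<Union>G\<in>Inn +>\<^bsub>Der\<^esub> E. Inn +>\<^bsub>Der\<^esub> bracket Der F G) = Inn +>\<^bsub>Der\<^esub> bracket Der D E"
      using Der.coset_self[OF S.a_subgroup] D E by blast
    then show ?thesis
      by (simp add: quot_lie_def with_bracket_def module.defs lie.defs)
  qed
qed

end

section \<open>Reduction\<close>

lemma with_bracket_simps [simp]:
  "carrier (with_bracket M br) = carrier M" "add (with_bracket M br) = add M"
  "ring.zero (with_bracket M br) = ring.zero M" "smult (with_bracket M br) = smult M"
  "bracket (with_bracket M br) = br"
  by (simp_all add: with_bracket_def module.defs lie.defs)

lemma with_bracket_module:
  fixes M :: "('k, 'l) module"
  assumes "module K M"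
  shows "module K (with_bracket M br)"
proof -
  interpret module K M by fact
  have "abelian_group (with_bracket M br)"
    by (rule abelian_groupI) (auto simp: M.a_ac M.add.l_inv_ex)
  then show ?thesis
    by (intro moduleI) (auto simp: R.is_cring smult_l_distr smult_r_distr smult_assoc1)
qed

section \<open>The ideal generated by \<open>w\<close> and the quotient algebra\<close>

context moment_map
begin

abbreviation I where "I \<equiv> Ideal_w w"
abbreviation Aw where "Aw \<equiv> A_w w"

lemma ideal_I: "ideal I A"
  unfolding Ideal_w_def by (rule genideal_ideal) simp

sublocale I: ideal I A by (rule ideal_I)
sublocale I: submod K A I by (rule ideal_submod[OF ideal_I])

lemma w_in_I: "w \<in> I"
  unfolding Ideal_w_def by (rule genideal_self') simp

lemma I_rules: "I \<subseteq> carrier A" "\<lbrakk>x \<in> I; a \<in> carrier A\<rbrakk> \<Longrightarrow> a \<otimes> x \<in> I" "\<lbrakk>x \<in> I; a \<in> carrier A\<rbrakk> \<Longrightarrow> x \<otimes> a \<in> I"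
  "\<lbrakk>x \<in> I; y \<in> I\<rbrakk> \<Longrightarrow> x \<oplus> y \<in> I" "\<lbrakk>x \<in> I; y \<in> I\<rbrakk> \<Longrightarrow> x \<ominus> y \<in> I"
  using subgroupD_add[OF I.a_subgroup] I.I_l_closed I.I_r_closed by auto

text \<open>The additive span of the elements xwy is itself a two-sided ideal and contains w = 1w1.
  It gives the ideal additive generators on which maps can be tested.\<close>

lemma I_span: "I \<subseteq> add_span A {x \<otimes> w \<otimes> y | x y. x \<in> carrier A \<and> y \<in> carrier A}" (is "_ \<subseteq> add_span A ?S")
proof -
  have S: "?S \<subseteq> carrier A" by auto
  note sub = add_span_subgroup[OF S]
  have "ideal (add_span A ?S) A"
  proof (rule idealI[OF ring_axioms sub])
    fix a x assume a: "a \<in> add_span A ?S" and x: "x \<in> carrier A"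
    show "x \<otimes> a \<in> add_span A ?S"
    proof (rule addhom_span_into[where f = "\<lambda>a. x \<otimes> a", OF is_abelian_group is_abelian_group _ sub S _ a])
      fix b assume "b \<in> ?S"
      then obtain u v where b: "b = u \<otimes> w \<otimes> v" "u \<in> carrier A" "v \<in> carrier A" by blast
      then have "x \<otimes> b = (x \<otimes> u) \<otimes> w \<otimes> v" using x by (simp add: m_assoc)
      then have "x \<otimes> b \<in> ?S" using b x by (intro CollectI exI[of _ "x \<otimes> u"] exI[of _ v]) simp
      then show "x \<otimes> b \<in> add_span A ?S" by (rule add_span_incl)
    qed (use mult_addhoms(1)[OF x addhom_id] in simp)
    show "a \<otimes> x \<in> add_span A ?S"
    proof (rule addhom_span_into[where f = "\<lambda>a. a \<otimes> x", OF is_abelian_group is_abelian_group _ sub S _ a])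
      fix b assume "b \<in> ?S"
      then obtain u v where b: "b = u \<otimes> w \<otimes> v" "u \<in> carrier A" "v \<in> carrier A" by blast
      then have "b \<otimes> x = u \<otimes> w \<otimes> (v \<otimes> x)" using x by (simp add: m_assoc)
      then have "b \<otimes> x \<in> ?S" using b x by (intro CollectI exI[of _ u] exI[of _ "v \<otimes> x"]) simp
      then show "b \<otimes> x \<in> add_span A ?S" by (rule add_span_incl)
    qed (use mult_addhoms(2)[OF x addhom_id] in simp)
  qed
  moreover have "w \<in> add_span A ?S"
    by (rule add_span_incl) (auto intro!: exI[of _ \<one>])
  ultimately show ?thesis
    unfolding Ideal_w_def by (intro genideal_minimal) auto
qed

text \<open>By Leibniz theta(uwv) = uw theta(v) + theta(u) wv, the middle term vanishing because
  theta(w) = 0.\<close>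

lemma th_I: "\<lbrakk>a \<in> carrier A; x \<in> I\<rbrakk> \<Longrightarrow> th a x \<in> I"
proof -
  assume a: "a \<in> carrier A" and x: "x \<in> I"
  note d = derivD[OF Der_deriv[OF th_Der[OF a]]]
  show ?thesis
  proof (rule addhom_span_into[OF is_abelian_group is_abelian_group th_addhom[OF a] I.a_subgroup _ _ subsetD[OF I_span x]])
    fix b assume "b \<in> {x \<otimes> w \<otimes> y | x y. x \<in> carrier A \<and> y \<in> carrier A}"
    then obtain u v where b: "b = u \<otimes> w \<otimes> v" "u \<in> carrier A" "v \<in> carrier A" by blast
    then have "th a b = u \<otimes> w \<otimes> th a v \<oplus> th a u \<otimes> w \<otimes> v"
      using a d by (simp add: th_w[OF a])
    then show "th a b \<in> I"
      using a b w_in_I by (simp add: I_rules)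
  qed auto
qed

text \<open>On x \<otimes> y the inner action of w followed by multiplication gives xwy.\<close>

lemma mult2_inner_w: "t \<in> carrier AA \<Longrightarrow> mult2 K A (inner w \<one> t) \<in> I"
  by (rule A2_into[OF is_abelian_group addhom_comp[OF mult2_props(1) inner_props(1)[OF w one_closed]] I.a_subgroup])
    (use w_in_I in \<open>simp_all add: inner_props mult2_props I_rules\<close>)

lemma Aw_eq: "Aw = quot_module A I"
  by (simp add: A_w_def)

lemmas Aw_mult = quot_mult[OF ideal_I, folded Aw_eq]
lemmas Aw_add = I.quot_add[folded Aw_eq]
lemmas Aw_smult = I.quot_smult[folded Aw_eq]
lemmas Aw_minus = I.quot_minus[folded Aw_eq]
lemmas Aw_carrier = I.quot_carrier[folded Aw_eq]
lemmas Aw_closed [simp] = I.quot_closed[folded Aw_eq]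
lemmas Aw_addhom = I.quot_addhom[folded Aw_eq]
lemmas Aw_zero = I.coset_zero_iff[folded Aw_eq]

lemma Aw_zero_eq: "I +> \<zero> = \<zero>\<^bsub>Aw\<^esub>"
  by (simp add: Aw_zero subgroupD_add(2)[OF I.a_subgroup])

text \<open>The structure map of the quotient may fail to be injective, which is why the locale of
  forms allows any unital algebra map from R. The resulting second instance, with prefix
  \<open>Q\<close>, supplies derivations, inner derivations and commutators of the quotient
  algebra.\<close>

lemma nc_forms_Aw: "nc_forms K R Aw (eta_w w)"
proof -
  interpret Q: kalgebra K Aw
    unfolding Aw_eq by (rule quot_kalgebra[OF ideal_I])
  show ?thesis
  proof
    show "eta_w w \<in> ring_hom R Aw"
      by (rule ring_hom_memI)
        (auto simp: eta_w_def Aw_mult Aw_add quot_one[OF ideal_I, folded Aw_eq])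
  qed (auto simp: eta_w_def Aw_smult eta_smult)
qed

sublocale Q: nc_forms K R Aw "eta_w w" by (rule nc_forms_Aw)

section \<open>Induced derivations of the quotient algebra\<close>

definition tb :: "'a \<Rightarrow> 'a set \<Rightarrow> 'a set" where
  "tb a = theta_bar \<omega> w (A_comm +> a)"

lemma tb_apply: "\<lbrakk>a \<in> carrier A; x \<in> carrier A\<rbrakk> \<Longrightarrow> tb a (I +> x) = I +> th a x"
proof -
  assume a: "a \<in> carrier A" and x: "x \<in> carrier A"
  have "the_elem ((\<lambda>x. I +> th a x) ` (I +> x)) = I +> th a x"
  proof (rule I.the_elem_coset[OF x])
    fix y assume y: "y \<in> carrier A" "y \<ominus> x \<in> I"
    then show "I +> th a y = I +> th a x"
      using th_I[OF a y(2)] a x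
      by (simp add: I.coset_iff addhom_minus[OF th_addhom[OF a] is_abelian_group is_abelian_group])
  qed
  then show ?thesis
    using x by (simp add: tb_def theta_bar_def th_def)
qed

lemma tb_ext: "tb a \<in> extensional (carrier Aw)"
  by (simp add: tb_def theta_bar_def)

lemma tb_Der: "a \<in> carrier A \<Longrightarrow> tb a \<in> carrier Q.Der"
proof -
  assume a: "a \<in> carrier A"
  note d = derivD[OF Der_deriv[OF th_Der[OF a]]]
  have "Q.deriv Q.AS (tb a)"
    unfolding Q.deriv_def
    using a d
    by (auto simp: addhom_iff Aw_carrier tb_apply Aw_add Aw_mult eta_w_def Aw_zero_eq)
  then show ?thesis
    using tb_ext by (simp add: Q.Der_iff)
qed

text \<open>Both maps are extensional, so agreement on the cosets of elements of A is full equality.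
  Identities for \<open>th\<close> pass to \<open>tb\<close> in this way.\<close>

lemma tb_eqI:
  assumes "D \<in> carrier Q.Der" "a \<in> carrier A" "\<And>x. x \<in> carrier A \<Longrightarrow> D (I +> x) = I +> th a x"
  shows "tb a = D"
proof
  fix X
  show "tb a X = D X"
  proof (cases "X \<in> carrier Aw")
    case True
    then show ?thesis using assms by (auto simp: Aw_carrier tb_apply)
  next
    case False
    then show ?thesis using assms(1) tb_ext by (simp add: Q.Der_iff extensional_def)
  qed
qed

lemma tb_add: "\<lbrakk>a \<in> carrier A; b \<in> carrier A\<rbrakk> \<Longrightarrow> tb (a \<oplus> b) = tb a \<oplus>\<^bsub>Q.Der\<^esub> tb b"
  by (rule tb_eqI) (auto simp: tb_Der th_add, auto simp: Q.Der_simps Der_simps tb_apply Aw_add)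

lemma tb_smult: "\<lbrakk>c \<in> carrier K; a \<in> carrier A\<rbrakk> \<Longrightarrow> tb (c \<odot> a) = c \<odot>\<^bsub>Q.Der\<^esub> tb a"
  by (rule tb_eqI) (auto simp: tb_Der th_smult Q.Der_smult_closed, auto simp: Q.Der_simps Der_simps tb_apply Aw_smult)

lemma tb_bracket: "\<lbrakk>a \<in> carrier A; b \<in> carrier A\<rbrakk> \<Longrightarrow> tb (th a b) = bracket Q.Der (tb a) (tb b)"
  by (rule tb_eqI)
    (auto simp: tb_Der th_bracket Q.Der_bracket_closed, auto simp: Q.Der_simps Der_simps tb_apply Aw_minus)

lemma tb_minus: "\<lbrakk>a \<in> carrier A; b \<in> carrier A\<rbrakk> \<Longrightarrow> tb (a \<ominus> b) = tb a \<ominus>\<^bsub>Q.Der\<^esub> tb b"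
  by (rule addhom_minus[OF _ is_abelian_group Q.Der.abelian_group_axioms]) (auto intro!: addhomI simp: tb_Der tb_add)

lemma tb_inner_mult_w: "c \<in> carrier A \<Longrightarrow> tb (c \<otimes> w) \<in> Q.Inn"
proof -
  assume c: "c \<in> carrier A"
  obtain k \<Phi> where k: "k \<in> carrier A" and \<Phi>: "\<Phi> \<in> carrier DDer"
    and t: "\<And>x. x \<in> carrier A \<Longrightarrow> th (c \<otimes> w) x = (x \<otimes> k \<ominus> k \<otimes> x) \<oplus> mult2 K A (inner w \<one> (\<Phi> x))"
    by (rule th_mult_w[OF c]) blast
  \<comment> \<open>The sign reconciles the convention ax - xa for inner derivations with the form
    xk - kx found in \<open>th_mult_w\<close>; the remaining term lies in AwA and vanishes in the
    quotient.\<close>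
  have "tb (c \<otimes> w) (I +> x) = ((I +> \<ominus> k) \<otimes>\<^bsub>Aw\<^esub> (I +> x)) \<ominus>\<^bsub>Aw\<^esub> ((I +> x) \<otimes>\<^bsub>Aw\<^esub> (I +> \<ominus> k))"
    if x: "x \<in> carrier A" for x
  proof -
    let ?m = "mult2 K A (inner w \<one> (\<Phi> x))"
    have m: "?m \<in> I" "?m \<in> carrier A"
      using mult2_inner_w DDer_closed[OF \<Phi> x] I_rules(1) by auto
    have "th (c \<otimes> w) x \<ominus> ((\<ominus> k) \<otimes> x \<ominus> x \<otimes> (\<ominus> k)) = ?m"
      using x k m by (simp add: t l_minus r_minus diff_simps)
    then show ?thesis
      using x k c m by (simp add: tb_apply Aw_mult Aw_minus I.coset_iff)
  qed
  then show ?thesis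
    using c k tb_Der[of "c \<otimes> w"]
    by (auto simp: Q.Inn_def Aw_carrier intro!: bexI[of _ "I +> \<ominus> k"] exI[of _ "\<ominus> k"])
qed

lemma tb_A_comm: "a \<in> A_comm \<Longrightarrow> tb a \<in> Q.Inn"
proof -
  assume a: "a \<in> A_comm"
  then have "a \<in> carrier A" using A_comm_rules(1) by auto
  with a have "A_comm +> a = A_comm +> \<zero>"
    using submod.coset_iff[OF A_comm_submod, of a \<zero>] by (simp add: diff_zero)
  \<comment> \<open>\<open>tb\<close> depends only on the class modulo [A, A]. Writing the zero
    class as a difference 0 - 0 lets \<open>tb_minus\<close> produce the zero derivation.\<close>
  then have "tb a = tb (\<zero> \<ominus> \<zero>)"
    by (simp add: tb_def diff_self)
  also have "\<dots> = \<zero>\<^bsub>Q.Der\<^esub>"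
    by (simp add: tb_minus tb_Der Q.Der.diff_self)
  also have "\<dots> \<in> Q.Inn"
    using Q.Der.subgroupD_add(2)[of Q.Inn] submod.axioms(2)[OF Q.Inn_submod] by (simp add: additive_subgroup_def)
  finally show ?thesis .
qed

lemma tb_addhom: "tb \<in> addhom A Q.Der"
  by (rule addhomI) (simp_all add: tb_Der tb_add)

lemma Inn_subgroup: "subgroup Q.Inn (add_monoid Q.Der)"
  using submod.axioms(2)[OF Q.Inn_submod] by (simp add: additive_subgroup_def)

text \<open>Up to commutators \<open>xwy\<close> equals \<open>(yx)w\<close>.\<close>

lemma tb_I: "a \<in> I \<Longrightarrow> tb a \<in> Q.Inn"
proof -
  assume a: "a \<in> I"
  show ?thesis
  proof (rule addhom_span_into[OF is_abelian_group Q.Der.abelian_group_axioms tb_addhom Inn_subgroup _ _ subsetD[OF I_span a]])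
    fix b assume "b \<in> {x \<otimes> w \<otimes> y | x y. x \<in> carrier A \<and> y \<in> carrier A}"
    then obtain u v where b: "b = u \<otimes> w \<otimes> v" "u \<in> carrier A" "v \<in> carrier A" by blast
    then have "b = (u \<otimes> w \<otimes> v \<ominus> v \<otimes> (u \<otimes> w)) \<oplus> (v \<otimes> u) \<otimes> w"
      by (simp add: m_assoc diff_simps)
    then have "tb b = tb (u \<otimes> w \<otimes> v \<ominus> v \<otimes> (u \<otimes> w)) \<oplus>\<^bsub>Q.Der\<^esub> tb ((v \<otimes> u) \<otimes> w)"
      using tb_add[of "u \<otimes> w \<otimes> v \<ominus> v \<otimes> (u \<otimes> w)" "(v \<otimes> u) \<otimes> w"] b by simp
    also have "\<dots> \<in> Q.Inn"
      using b by (intro Q.Der.subgroupD_add(3)[OF Inn_subgroup] tb_A_comm tb_inner_mult_w A_commI) auto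
    finally show "tb b \<in> Q.Inn" .
  qed auto
qed

section \<open>The commutator quotient of the quotient algebra\<close>

abbreviation Awn where "Awn \<equiv> A_w_nat w"

lemma Awn_eq: "Awn = quot_module Aw Q.A_comm"
  by (simp add: A_w_nat_def Q.A_nat_def)

sublocale C: submod K Aw Q.A_comm by (rule Q.A_comm_submod)

definition pr :: "'a \<Rightarrow> 'a set set" where "pr a = Q.A_comm +>\<^bsub>Aw\<^esub> (I +> a)"

lemma pr_addhom: "pr \<in> addhom A Awn"
  unfolding pr_def Awn_eq by (rule addhom_comp[OF C.quot_addhom Aw_addhom])

lemma Awn_module: "module K Awn"
  unfolding Awn_eq by (rule C.quot_is_module)

sublocale Awn: module K Awn by (rule Awn_module)

lemma pr_closed [simp]: "a \<in> carrier A \<Longrightarrow> pr a \<in> carrier Awn"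
  by (rule addhom_closed[OF pr_addhom])

lemma pr_surj: "carrier Awn = pr ` carrier A"
  unfolding Awn_eq C.quot_carrier by (auto simp: pr_def Aw_carrier)

lemma pr_smult: "\<lbrakk>c \<in> carrier K; a \<in> carrier A\<rbrakk> \<Longrightarrow> pr (c \<odot> a) = c \<odot>\<^bsub>Awn\<^esub> pr a"
  unfolding Awn_eq pr_def by (simp add: C.quot_smult Aw_smult)

lemma pr_add: "\<lbrakk>a \<in> carrier A; b \<in> carrier A\<rbrakk> \<Longrightarrow> pr (a \<oplus> b) = pr a \<oplus>\<^bsub>Awn\<^esub> pr b"
  by (rule addhom_add[OF pr_addhom])

lemma pr_minus: "\<lbrakk>a \<in> carrier A; b \<in> carrier A\<rbrakk> \<Longrightarrow> pr (a \<ominus> b) = pr a \<ominus>\<^bsub>Awn\<^esub> pr b"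
  by (rule addhom_minus[OF pr_addhom is_abelian_group Awn.M.abelian_group_axioms])

lemma A_comm_quot: "a \<in> A_comm \<Longrightarrow> I +> a \<in> Q.A_comm"
proof (rule A_comm_into[where f = "\<lambda>a. I +> a", OF Q.is_abelian_group Aw_addhom Q.A_comm_subgroup])
  fix a b assume "a \<in> carrier A" "b \<in> carrier A"
  then show "I +> (a \<otimes> b \<ominus> b \<otimes> a) \<in> Q.A_comm"
    using Q.A_commI[of "I +> a" "I +> b"] by (simp add: Aw_minus Aw_mult)
qed

text \<open>Commutators of the quotient algebra lift to commutators of A, so the image of [A, A] is
  the whole commutator space and the kernel of the composite projection is the ideal plus [A, A].
  What has to descend can thus be checked separately on the two summands.\<close>

lemma pr_zero: "a \<in> carrier A \<Longrightarrow> pr a = \<zero>\<^bsub>Awn\<^esub> \<longleftrightarrow> (\<exists>i\<in>I. \<exists>c\<in>A_comm. a = i \<oplus> c)"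
proof
  assume a: "a \<in> carrier A" and "pr a = \<zero>\<^bsub>Awn\<^esub>"
  then have Ia: "I +> a \<in> Q.A_comm"
    using C.coset_zero_iff[of "I +> a"] by (simp add: pr_def Awn_eq)
  let ?B = "(\<lambda>c. I +> c) ` A_comm"
  have B: "subgroup ?B (add_monoid Aw)"
  proof (rule Q.subgroupI_add)
    show "?B \<subseteq> carrier Aw" using A_comm_rules(1) by auto
    show "\<zero>\<^bsub>Aw\<^esub> \<in> ?B"
      using Aw_zero[of \<zero>] A_comm_rules(2) subgroupD_add(2)[OF I.a_subgroup] by (metis imageI zero_closed)
    show "x \<ominus>\<^bsub>Aw\<^esub> y \<in> ?B" if "x \<in> ?B" "y \<in> ?B" for x y
      using that A_comm_rules(1,5) by (auto simp: subset_iff Aw_minus)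
  qed
  have "I +> a \<in> ?B"
  proof (rule Q.A_comm_into[OF Q.is_abelian_group addhom_id B _ Ia])
    fix X Y assume "X \<in> carrier Aw" "Y \<in> carrier Aw"
    then show "X \<otimes>\<^bsub>Aw\<^esub> Y \<ominus>\<^bsub>Aw\<^esub> Y \<otimes>\<^bsub>Aw\<^esub> X \<in> ?B"
      using A_commI by (auto simp: Aw_carrier Aw_mult Aw_minus)
  qed
  then obtain c where c: "c \<in> A_comm" "I +> a = I +> c" by blast
  then have "c \<in> carrier A" using A_comm_rules(1) by auto
  with a c have "a \<ominus> c \<in> I" "a = (a \<ominus> c) \<oplus> c"
    by (simp_all add: I.coset_iff diff_add diff_eq eq_diff)
  with c(1) show "\<exists>i\<in>I. \<exists>c\<in>A_comm. a = i \<oplus> c"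
    by blast
next
  assume a: "a \<in> carrier A" and "\<exists>i\<in>I. \<exists>c\<in>A_comm. a = i \<oplus> c"
  then obtain i c where ic: "i \<in> I" "c \<in> A_comm" "a = i \<oplus> c" by blast
  then have ic': "i \<in> carrier A" "c \<in> carrier A" using I_rules(1) A_comm_rules(1) by auto
  have "I +> a = I +> c"
  proof -
    have "a \<ominus> c = i"
      using ic(3) ic' by (simp add: diff_eq)
    then show ?thesis
      using ic(1) ic' a by (simp add: I.coset_iff)
  qed
  then show "pr a = \<zero>\<^bsub>Awn\<^esub>"
    using A_comm_quot[OF ic(2)] C.coset_zero_iff[of "I +> c"] ic' by (simp add: pr_def Awn_eq)
qed

lemma pr_I: "a \<in> I \<Longrightarrow> pr a = \<zero>\<^bsub>Awn\<^esub>"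
proof -
  assume a: "a \<in> I"
  then have "a \<in> carrier A" "a = a \<oplus> \<zero>" using I_rules(1) by auto
  with a A_comm_rules(2) show ?thesis using pr_zero by blast
qed

lemma pr_A_comm: "a \<in> A_comm \<Longrightarrow> pr a = \<zero>\<^bsub>Awn\<^esub>"
proof -
  assume a: "a \<in> A_comm"
  then have "a \<in> carrier A" "a = \<zero> \<oplus> a" using A_comm_rules(1) by auto
  with a subgroupD_add(2)[OF I.a_subgroup] show ?thesis using pr_zero by blast
qed

lemma pr_eq:
  assumes "a \<in> carrier A" "b \<in> carrier A" "pr a = pr b"
  obtains i c where "i \<in> I" "c \<in> A_comm" "a \<ominus> b = i \<oplus> c"
  using pr_zero[of "a \<ominus> b"] assms by (auto simp: pr_minus Awn.M.diff_self)

text \<open>\<open>tb\<close> is additive and sends both the ideal and [A, A] to inner derivations;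
  this is the well-definedness of the map to outer derivations.\<close>

lemma tb_cong:
  assumes a: "a \<in> carrier A" "a' \<in> carrier A" "pr a = pr a'"
  shows "Q.Inn +>\<^bsub>Q.Der\<^esub> tb a = Q.Inn +>\<^bsub>Q.Der\<^esub> tb a'"
proof -
  obtain i c where ic: "i \<in> I" "c \<in> A_comm" "a \<ominus> a' = i \<oplus> c"
    using pr_eq[OF a] .
  then have ic': "i \<in> carrier A" "c \<in> carrier A" using I_rules(1) A_comm_rules(1) by auto
  have "tb a \<ominus>\<^bsub>Q.Der\<^esub> tb a' = tb i \<oplus>\<^bsub>Q.Der\<^esub> tb c"
    using a ic ic' by (simp add: tb_minus[symmetric] tb_add)
  also have "\<dots> \<in> Q.Inn"
    using ic by (intro Q.Der.subgroupD_add(3)[OF Inn_subgroup] tb_I tb_A_comm)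
  finally show ?thesis
    using a by (simp add: Q.Der.coset_eq_iff[OF Inn_subgroup] tb_Der)
qed

text \<open>Theta_a preserves the ideal by \<open>th_I\<close>, and [A, A] as every derivation
  does.\<close>

lemma pr_th_right: "\<lbrakk>a \<in> carrier A; b \<in> carrier A; pr b = \<zero>\<^bsub>Awn\<^esub>\<rbrakk> \<Longrightarrow> pr (th a b) = \<zero>\<^bsub>Awn\<^esub>"
proof -
  assume a: "a \<in> carrier A" and b: "b \<in> carrier A" "pr b = \<zero>\<^bsub>Awn\<^esub>"
  then obtain i c where ic: "i \<in> I" "c \<in> A_comm" "b = i \<oplus> c"
    using pr_zero by blast
  then have ic': "i \<in> carrier A" "c \<in> carrier A" using I_rules(1) A_comm_rules(1) by auto
  show ?thesis
    using a ic ic' th_I[OF a ic(1)] Der_A_comm[OF th_Der[OF a] ic(2)]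
    by (simp add: addhom_add[OF th_addhom] pr_add pr_I pr_A_comm)
qed

lemma pr_th_antisym: "\<lbrakk>a \<in> carrier A; b \<in> carrier A\<rbrakk> \<Longrightarrow> pr (th a b) = \<ominus>\<^bsub>Awn\<^esub> pr (th b a)"
  using pr_A_comm[OF th_antisym[of a b]] by (simp add: pr_add Awn.M.eq_neg)

text \<open>Skew-symmetry modulo [A, A] moves the first argument into the second slot, where the
  derivation property applies.\<close>

lemma pr_th_left: "\<lbrakk>a \<in> carrier A; b \<in> carrier A; pr a = \<zero>\<^bsub>Awn\<^esub>\<rbrakk> \<Longrightarrow> pr (th a b) = \<zero>\<^bsub>Awn\<^esub>"
  using pr_th_antisym[of a b] pr_th_right[of b a] by simp

lemma th_diff_left: "\<lbrakk>a \<in> carrier A; a' \<in> carrier A; b \<in> carrier A\<rbrakk> \<Longrightarrow> th (a \<ominus> a') b = th a b \<ominus> th a' b"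
proof -
  assume *: "a \<in> carrier A" "a' \<in> carrier A" and b: "b \<in> carrier A"
  have "(\<lambda>a. th a b) \<in> addhom A A"
    using b by (intro addhomI) (auto simp: th_add Der_simps)
  from addhom_minus[OF this is_abelian_group is_abelian_group *] show ?thesis .
qed

lemma pr_th_cong:
  assumes "a \<in> carrier A" "a' \<in> carrier A" "b \<in> carrier A" "b' \<in> carrier A" "pr a = pr a'" "pr b = pr b'"
  shows "pr (th a b) = pr (th a' b')"
proof -
  have "pr (th (a \<ominus> a') b) = \<zero>\<^bsub>Awn\<^esub>"
    using assms by (intro pr_th_left) (auto simp: pr_minus Awn.M.diff_self)
  moreover have "pr (th a' (b \<ominus> b')) = \<zero>\<^bsub>Awn\<^esub>"
    using assms by (intro pr_th_right) (auto simp: pr_minus Awn.M.diff_self)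
  ultimately show ?thesis
    using assms
    by (simp add: th_diff_left addhom_minus[OF th_addhom is_abelian_group is_abelian_group] pr_minus Awn.M.diff_eq)
qed

section \<open>The reduced Lie bracket and the map to outer derivations\<close>

definition rep :: "'a set set \<Rightarrow> 'a" where "rep = inv_into (carrier A) pr"

lemma rep: "X \<in> carrier Awn \<Longrightarrow> rep X \<in> carrier A" "X \<in> carrier Awn \<Longrightarrow> pr (rep X) = X"
  by (auto simp: rep_def pr_surj inv_into_into f_inv_into_f)

text \<open>Chosen representatives in A make this a function on classes at once;
  \<open>br_pr\<close> removes the choice.\<close>

definition br :: "'a set set \<Rightarrow> 'a set set \<Rightarrow> 'a set set" where
  "br X Y = pr (th (rep X) (rep Y))"

lemma br_pr: "\<lbrakk>a \<in> carrier A; b \<in> carrier A\<rbrakk> \<Longrightarrow> br (pr a) (pr b) = pr (th a b)"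
  unfolding br_def by (rule pr_th_cong) (simp_all add: rep)

lemma lie_algebra_br:
  assumes "field K"
  shows "lie_algebra K (with_bracket Awn br)"
proof -
  interpret K: field K by fact
  interpret L: module K "with_bracket Awn br" by (rule with_bracket_module[OF Awn_module])
  show ?thesis
  proof
    fix X Y Z assume "X \<in> carrier (with_bracket Awn br)" "Y \<in> carrier (with_bracket Awn br)" "Z \<in> carrier (with_bracket Awn br)"
    then obtain x y z where xyz: "x \<in> carrier A" "y \<in> carrier A" "z \<in> carrier A" "X = pr x" "Y = pr y" "Z = pr z"
      by (auto simp: pr_surj)
    note add = addhom_add[OF th_addhom] addhom_minus[OF th_addhom is_abelian_group is_abelian_group]
      addhom_inv[OF th_addhom is_abelian_group is_abelian_group]
    show "bracket (with_bracket Awn br) X Y \<in> carrier (with_bracket Awn br)"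
      using xyz by (simp add: br_pr)
    show "bracket (with_bracket Awn br) (X \<oplus>\<^bsub>with_bracket Awn br\<^esub> Y) Z =
        bracket (with_bracket Awn br) X Z \<oplus>\<^bsub>with_bracket Awn br\<^esub> bracket (with_bracket Awn br) Y Z"
      using xyz by (simp add: br_pr pr_add[symmetric] th_add) (simp add: Der_simps)
    show "bracket (with_bracket Awn br) X (Y \<oplus>\<^bsub>with_bracket Awn br\<^esub> Z) =
        bracket (with_bracket Awn br) X Y \<oplus>\<^bsub>with_bracket Awn br\<^esub> bracket (with_bracket Awn br) X Z"
      using xyz by (simp add: br_pr pr_add[symmetric] add)
    show "bracket (with_bracket Awn br) X X = \<zero>\<^bsub>with_bracket Awn br\<^esub>"
      using xyz th_self by (simp add: br_pr pr_A_comm)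
    \<comment> \<open>Expanding theta of theta_x(y) as the bracket of theta_x and theta_y rewrites
      the cyclic sum as theta_y of one skew-symmetry defect plus another such defect, and both lie
      in [A, A].\<close>
    have "th x (th y z) \<oplus> th y (th z x) \<oplus> th z (th x y) = th y (th x z \<oplus> th z x) \<oplus> (th z (th x y) \<oplus> th (th x y) z)"
      using xyz by (simp add: th_bracket add) (simp add: Der_simps diff_simps)
    moreover have "pr (th y (th x z \<oplus> th z x)) = \<zero>\<^bsub>Awn\<^esub>" "pr (th z (th x y) \<oplus> th (th x y) z) = \<zero>\<^bsub>Awn\<^esub>"
      using xyz by (auto intro!: pr_A_comm th_antisym Der_A_comm[OF th_Der])
    ultimately have "pr (th x (th y z) \<oplus> th y (th z x) \<oplus> th z (th x y)) = \<zero>\<^bsub>Awn\<^esub>"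
      using xyz by (simp add: pr_add[of "th y (th x z \<oplus> th z x)"])
    then show "bracket (with_bracket Awn br) X (bracket (with_bracket Awn br) Y Z) \<oplus>\<^bsub>with_bracket Awn br\<^esub>
        bracket (with_bracket Awn br) Y (bracket (with_bracket Awn br) Z X) \<oplus>\<^bsub>with_bracket Awn br\<^esub>
        bracket (with_bracket Awn br) Z (bracket (with_bracket Awn br) X Y) = \<zero>\<^bsub>with_bracket Awn br\<^esub>"
      using xyz by (simp add: br_pr pr_add)
  next
    fix c X Y assume c: "c \<in> carrier K" and "X \<in> carrier (with_bracket Awn br)" "Y \<in> carrier (with_bracket Awn br)"
    then obtain x y where xy: "x \<in> carrier A" "y \<in> carrier A" "X = pr x" "Y = pr y"
      by (auto simp: pr_surj)
    show "bracket (with_bracket Awn br) (c \<odot>\<^bsub>with_bracket Awn br\<^esub> X) Y =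
        c \<odot>\<^bsub>with_bracket Awn br\<^esub> bracket (with_bracket Awn br) X Y"
      using xy c by (simp add: br_pr pr_smult[symmetric] th_smult) (simp add: Der_simps)
    show "bracket (with_bracket Awn br) X (c \<odot>\<^bsub>with_bracket Awn br\<^esub> Y) =
        c \<odot>\<^bsub>with_bracket Awn br\<^esub> bracket (with_bracket Awn br) X Y"
      using xy c deriv_smult_apply[OF central_self Der_deriv[OF th_Der], of x c y]
      by (simp add: br_pr pr_smult[symmetric] scal_mult)
  qed
qed

definition phi :: "'a set set \<Rightarrow> ('a set \<Rightarrow> 'a set) set" where
  "phi X = Q.Inn +>\<^bsub>Q.Der\<^esub> tb (rep X)"

lemma phi_pr: "a \<in> carrier A \<Longrightarrow> phi (pr a) = Q.Inn +>\<^bsub>Q.Der\<^esub> tb a"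
  unfolding phi_def by (rule tb_cong) (simp_all add: rep)

text \<open>On representatives the bracket condition is \<open>tb_bracket\<close>, which is the
  image in the quotient algebra of the identity between theta of theta_a(b) and the bracket of
  theta_a with theta_b.\<close>

lemma phi_lie_hom: "phi \<in> lie_hom K (with_bracket Awn br) (quot_lie Q.Der Q.Inn)"
  unfolding lie_hom_def
proof (intro CollectI conjI ballI)
  show "phi \<in> carrier (with_bracket Awn br) \<rightarrow> carrier (quot_lie Q.Der Q.Inn)"
    using tb_Der by (auto simp: pr_surj phi_pr Q.quot_lie_Inn)
next
  fix X Y assume "X \<in> carrier (with_bracket Awn br)" "Y \<in> carrier (with_bracket Awn br)"
  then obtain x y where xy: "x \<in> carrier A" "y \<in> carrier A" "X = pr x" "Y = pr y"
    by (auto simp: pr_surj)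
  show "phi (X \<oplus>\<^bsub>with_bracket Awn br\<^esub> Y) = phi X \<oplus>\<^bsub>quot_lie Q.Der Q.Inn\<^esub> phi Y"
    using xy by (simp add: pr_add[symmetric] phi_pr Q.quot_lie_Inn tb_Der tb_add)
  show "phi (bracket (with_bracket Awn br) X Y) = bracket (quot_lie Q.Der Q.Inn) (phi X) (phi Y)"
    using xy by (simp add: br_pr phi_pr Q.quot_lie_Inn tb_Der tb_bracket)
next
  fix c X assume c: "c \<in> carrier K" and "X \<in> carrier (with_bracket Awn br)"
  then obtain x where x: "x \<in> carrier A" "X = pr x"
    by (auto simp: pr_surj)
  show "phi (c \<odot>\<^bsub>with_bracket Awn br\<^esub> X) = c \<odot>\<^bsub>quot_lie Q.Der Q.Inn\<^esub> phi X"
    using x c by (simp add: pr_smult[symmetric] phi_pr Q.quot_lie_Inn tb_Der tb_smult)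
qed

lemma A_nat_carrier: "carrier A_nat = {A_comm +> a | a. a \<in> carrier A}"
  unfolding A_nat_def by (rule submod.quot_carrier[OF A_comm_submod])

lemma proj_w_eq: "a \<in> carrier A \<Longrightarrow> proj_w w (A_comm +> a) = pr a"
proof -
  assume a: "a \<in> carrier A"
  have "proj_w w (A_comm +> a) = the_elem (pr ` (A_comm +> a))"
    by (simp add: proj_w_def pr_def[abs_def])
  also have "\<dots> = pr a"
  proof (rule submod.the_elem_coset[OF A_comm_submod a])
    fix y assume "y \<in> carrier A" "y \<ominus> a \<in> A_comm"
    then show "pr y = pr a"
      using pr_A_comm[of "y \<ominus> a"] a by (simp add: pr_minus Awn.M.diff_eq)
  qed
  finally show ?thesis .
qed

lemma nc_bracket_eq: "\<lbrakk>a \<in> carrier A; b \<in> carrier A\<rbrakk> \<Longrightarrow>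
    nc_bracket \<omega> (A_comm +> a) (A_comm +> b) = A_comm +> th a b"
  unfolding nc_bracket_def th_def[symmetric]
  by (rule submod.the_elem_coset[OF A_comm_submod, where f = "\<lambda>x. A_comm +> th a x"])
    (auto simp: submod.coset_iff[OF A_comm_submod] addhom_minus[OF th_addhom is_abelian_group is_abelian_group, symmetric]
      Der_A_comm[OF th_Der])

end

theorem proposition4p4p3:
  fixes K :: "'k ring" and R :: "('k, 'r) module" and A :: "('k, 'a) module"
    and \<eta> :: "'r \<Rightarrow> 'a" and e :: "('r \<times> 'r) frag set" and w :: 'a
    and \<omega> :: "(('a \<times> 'a) frag set \<times> ('a \<times> 'a) frag set) frag set set"
  assumes "field K" and "char_zero K"
    and "assoc_algebra K R" and "finite_dim K R" and "semisimple R"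
    and "symmetric_separability_element K R e"
    and "R_algebra K R A \<eta>"
    and "algebra_over_data.bisymplectic K R A \<eta> \<omega>"
    and "w \<in> carrier A"
    and "algebra_over_data.is_mu_nc K R A \<eta> e \<omega> (\<eta> ` carrier R +>\<^bsub>A\<^esub> w)"
  shows
    "(\<forall>p\<in>carrier (algebra_over_data.A_nat A).
        algebra_over_data.theta K R A \<eta> \<omega> p ` algebra_over_data.Ideal_w A w
          \<subseteq> algebra_over_data.Ideal_w A w \<and>
        algebra_over_data.theta_bar K R A \<eta> \<omega> w p
          \<in> carrier (algebra_over_data.Der_w K R A \<eta> w) \<and>
        (\<forall>x\<in>carrier A.
          algebra_over_data.theta_bar K R A \<eta> \<omega> w p (algebra_over_data.Ideal_w A w +>\<^bsub>A\<^esub> x) =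
          algebra_over_data.Ideal_w A w +>\<^bsub>A\<^esub> algebra_over_data.theta K R A \<eta> \<omega> p x)) \<and>
     (\<exists>br.
        lie_algebra K (with_bracket (algebra_over_data.A_w_nat A w) br) \<and>
        (\<forall>p\<in>carrier (algebra_over_data.A_nat A). \<forall>q\<in>carrier (algebra_over_data.A_nat A).
          br (algebra_over_data.proj_w A w p) (algebra_over_data.proj_w A w q) =
          algebra_over_data.proj_w A w (algebra_over_data.nc_bracket K R A \<eta> \<omega> p q)) \<and>
        (\<exists>\<phi>\<in>lie_hom K (with_bracket (algebra_over_data.A_w_nat A w) br)
               (quot_lie (algebra_over_data.Der_w K R A \<eta> w) (algebra_over_data.Inn_w K R A \<eta> w)).
          \<forall>p\<in>carrier (algebra_over_data.A_nat A).
            \<phi> (algebra_over_data.proj_w A w p) =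
            algebra_over_data.Inn_w K R A \<eta> w
              +>\<^bsub>algebra_over_data.Der_w K R A \<eta> w\<^esub> algebra_over_data.theta_bar K R A \<eta> \<omega> w p))"
proof -
  interpret moment_map K R A \<eta> \<omega> e w
    using assms
    by (auto simp: R_algebra_def algebra_over_def moment_map_def moment_map_axioms_def bisymplectic_form_def
        bisymplectic_form_axioms_def nc_forms_def nc_forms_axioms_def kalgebra_def)
  have Der: "Der_w w = Q.Der" "Inn_w w = Q.Inn"
    by (simp_all add: Der_w_def Inn_w_def)
  show ?thesis
  proof (intro conjI ballI exI[of _ br] bexI[of _ phi])
    show "lie_algebra K (with_bracket Awn br)"
      by (rule lie_algebra_br[OF assms(1)])
    show "phi \<in> lie_hom K (with_bracket Awn br) (quot_lie (Der_w w) (Inn_w w))"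
      unfolding Der by (rule phi_lie_hom)
  next
    \<comment> \<open>A representative \<open>a\<close> of \<open>p\<close> turns the operations on
      classes into \<open>th a\<close>, \<open>tb a\<close> and \<open>pr a\<close>, for which the
      claims are established.\<close>
    fix p assume "p \<in> carrier A_nat"
    then obtain a where a: "a \<in> carrier A" "p = A_comm +>\<^bsub>A\<^esub> a"
      by (auto simp: A_nat_carrier)
    have t: "theta \<omega> p = th a" "theta_bar \<omega> w p = tb a"
      by (simp_all add: a th_def tb_def)
    show "theta \<omega> p ` I \<subseteq> I"
      unfolding t using th_I[OF a(1)] by auto
    show "theta_bar \<omega> w p \<in> carrier (Der_w w)"
      unfolding t Der by (rule tb_Der[OF a(1)])
    show "theta_bar \<omega> w p (I +>\<^bsub>A\<^esub> x) = I +>\<^bsub>A\<^esub> theta \<omega> p x" if "x \<in> carrier A" for x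
      unfolding t using a(1) that by (rule tb_apply)
    show "phi (proj_w w p) = Inn_w w +>\<^bsub>Der_w w\<^esub> theta_bar \<omega> w p"
      unfolding t Der using a by (simp add: proj_w_eq phi_pr)
    fix q assume "q \<in> carrier A_nat"
    then obtain b where b: "b \<in> carrier A" "q = A_comm +>\<^bsub>A\<^esub> b"
      by (auto simp: A_nat_carrier)
    show "br (proj_w w p) (proj_w w q) = proj_w w (nc_bracket \<omega> p q)"
      using a b by (simp add: nc_bracket_eq proj_w_eq br_pr)
  qed
qed

end
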